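(* Let $k\ge 2$. There exists a constant $c_k>0$ depending only on $k$ such that the following holds. Let $T\in\mathbb{R}^{d_1\times\cdots\times d_k}$ be a nonzero tensor with Tucker ranks $r_j=r_j(T)$ and coherences $\mu_j(T)$, $j=1,\dots,k$. Let $\lambda_*>0$ satisfy $$\lambda_*\ge \frac{1}{r_*}\max_{1\le j\le k}\{\mu_j(T)\,r_j(T)\},$$ and put $\delta_j=\sqrt{\lambda_* r_*/d_j}$ for $j=1,\dots,k$, where $\delta=(\delta_1,\dots,\delta_k)\in(0,1]^k$. Let $W_0$ be a dual tensor of $T$ (with respect to $\delta$), and let $\mu_*$, $\alpha_*$ be the associated quantities (all defined in the context). Let $\Omega$ be a uniformly sampled subset of $[d_1]\times\cdots\times[d_k]$ with $n:=|\Omega|$ elements, and let $\widehat{T}$ be the solution to $$\min_{X\in\mathbb{R}^{d_1\times\cdots\times d_k}}\|X\|_{\star,\delta}\quad\text{subject to}\quad \mathcal{P}_\Omega X=\mathcal{P}_\Omega T .$$ Then for every $\beta>0$, if $$n\ge c_k(1+\beta)\left((\mu_*+\alpha_*^2\lambda_*^{k-2})\,r_*^{k-1}d(\log d)^2+\alpha_*\lambda_*^{k/2-1}r_*^{(k-1)/2}d^{3/2}(\log d)^2\right),$$ then $\mathbb{P}\{\widehat{T}=T\}\ge 1-d^{-\beta}$.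
   Context: Notation: $[m]=\{1,\dots,m\}$; $\langle\cdot,\cdot\rangle$ is the entrywise (vectorized) inner product on $\mathbb{R}^{d_1\times\cdots\times d_k}$; $\|X\|_{\rm HS}=\langle X,X\rangle^{1/2}$; $\|X\|_{\max}$ is the largest absolute value of an entry. $d=\frac1k\sum_{j=1}^k d_j$ and $d_*=(d_1\cdots d_k)^{1/k}$. For $\Omega\subseteq[d_1]\times\cdots\times[d_k]$, $\mathcal{P}_\Omega X$ is the tensor that agrees with $X$ on $\Omega$ and is $0$ elsewhere. Incoherent norms: for $\delta\in(0,1]^k$ and $1\le j_1<j_2\le k$ let $$\mathscr{U}_{j_1j_2}(\delta)=\{u_1\otimes\cdots\otimes u_k:\ u_j\in\mathbb{R}^{d_j},\ \|u_j\|_{\ell_2}\le1\ \forall j;\ \|u_j\|_{\ell_\infty}\le\delta_j\ \forall j\ne j_1,j_2\},$$ $\mathscr{U}(\delta)=\bigcup_{1\le j_1<j_2\le k}\mathscr{U}_{j_1j_2}(\delta)$, $\|X\|_{\circ,\delta}=\sup_{Y\in\mathscr{U}(\delta)}\langle Y,X\rangle$ and $\|X\|_{\star,\delta}=\sup_{\|Y\|_{\circ,\delta}\le1}\langle Y,X\rangle$. Ranks, coherence, projections: $\mathcal{L}_j(T)\subseteq\mathbb{R}^{d_j}$ is the span of the mode-$j$ fibers $T(a_1,\dots,a_{j-1},\cdot,a_{j+1},\dots,a_k)$; $r_j(T)=\dim\mathcal{L}_j(T)$ are the Tucker ranks; $P_j$ is the orthogonal projection of $\mathbb{R}^{d_j}$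 onto $\mathcal{L}_j(T)$ and $P_j^\perp=I-P_j$; $\mu_j(T)=\frac{d_j}{r_j(T)}\max_{1\le i\le d_j}\|P_je_i\|_{\ell_2}^2$, with $e_i$ the canonical basis vectors. A tensor product of matrices $M_1\otimes\cdots\otimes M_k$ acts linearly on tensors by $u_1\otimes\cdots\otimes u_k\mapsto M_1u_1\otimes\cdots\otimes M_ku_k$. Set $$\mathcal{Q}_T^0=P_1\otimes\cdots\otimes P_k,\qquad \mathcal{Q}_T=\mathcal{Q}_T^0+\sum_{j=1}^kP_1\otimes\cdots\otimes P_{j-1}\otimes P_j^\perp\otimes P_{j+1}\otimes\cdots\otimes P_k.$$ Dual tensor: $W_0\in\mathbb{R}^{d_1\times\cdots\times d_k}$ is a tensor with $\mathcal{Q}_T^0W_0=W_0$, $\|W_0\|_{\circ,\delta}=1$ and $\langle W_0,T\rangle=\|T\|_{\star,\delta}$ (such a tensor exists when $\delta_j\ge\max_{\|u\|_{\ell_2}\le1}\|P_ju\|_{\ell_\infty}$ for all $j$, which is guaranteed by the condition on $\lambda_*$). Parameters: $$r_*=\left[\frac1{kd}\sum_{j=1}^k\left(\frac{d_j}{r_j}\prod_{\ell=1}^kr_\ell\right)\right]^{1/(k-1)},\qquad \mu_*=\frac{d_*^k}{k\,r_*^{k-1}d}\max_{i_1,\dots,i_k}\|\mathcal{Q}_T(e_{i_1}\otimes\cdots\otimes e_{i_k})\|_{\rm HS}^2,\qquad \alpha_*=(d_*^k/r_* )^{1/2}\|W_0\|_{\max}.$$ *)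

theory Defs
  imports "HOL-Analysis.Analysis" "HOL-Probability.Probability_Mass_Function"
    "HOL-Library.Function_Algebras"
begin

text \<open>
  The dimensions vary with the mode and are quantified inside the theorem, so tensors and vectors
  are real functions on indices that vanish off the index range. The shape of a tensor
  is the order \<open>k\<close> together with \<open>d :: nat \<Rightarrow> nat\<close>, of which only
  \<open>d 1, \<dots>, d k\<close> matter; indices start at 1.
  The pointwise vector space structure on functions gives access to the library's \<^const>\<open>span\<close>
  and \<^const>\<open>dim\<close>.
\<close>

instantiation "fun" :: (type, real_vector) real_vector
begin

definition scaleR_fun :: "real \<Rightarrow> ('a \<Rightarrow> 'b) \<Rightarrow> 'a \<Rightarrow> 'b" where
  "scaleR_fun c f = (\<lambda>x. c *\<^sub>R f x)"

instance
  by standard (simp_all add: scaleR_fun_def fun_eq_iff scaleR_add_right scaleR_add_left)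

end

type_synonym vect = "nat \<Rightarrow> real"
type_synonym tensor = "(nat \<Rightarrow> nat) \<Rightarrow> real"

definition grid :: "nat \<Rightarrow> (nat \<Rightarrow> nat) \<Rightarrow> (nat \<Rightarrow> nat) set" where
  "grid k d = PiE {1..k} (\<lambda>j. {1..d j})"

definition vecs :: "nat \<Rightarrow> vect set" where
  "vecs m = {v. \<forall>i. i \<notin> {1..m} \<longrightarrow> v i = 0}"

definition tensors :: "nat \<Rightarrow> (nat \<Rightarrow> nat) \<Rightarrow> tensor set" where
  "tensors k d = {X. \<forall>a. a \<notin> grid k d \<longrightarrow> X a = 0}"

definition unitv :: "nat \<Rightarrow> vect" where
  "unitv i = (\<lambda>j. if j = i then 1 else 0)"

definition tinner :: "nat \<Rightarrow> (nat \<Rightarrow> nat) \<Rightarrow> tensor \<Rightarrow> tensor \<Rightarrow> real" where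
  "tinner k d X Y = (\<Sum>a\<in>grid k d. X a * Y a)"

definition hs_norm :: "nat \<Rightarrow> (nat \<Rightarrow> nat) \<Rightarrow> tensor \<Rightarrow> real" where
  "hs_norm k d X = sqrt (tinner k d X X)"

definition max_norm :: "nat \<Rightarrow> (nat \<Rightarrow> nat) \<Rightarrow> tensor \<Rightarrow> real" where
  "max_norm k d X = (MAX a\<in>grid k d. \<bar>X a\<bar>)"

definition rank_one :: "nat \<Rightarrow> (nat \<Rightarrow> nat) \<Rightarrow> (nat \<Rightarrow> vect) \<Rightarrow> tensor" where
  "rank_one k d u = (\<lambda>a. if a \<in> grid k d then \<Prod>j=1..k. u j (a j) else 0)"

definition restrict_tensor :: "(nat \<Rightarrow> nat) set \<Rightarrow> tensor \<Rightarrow> tensor" where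
  "restrict_tensor \<Omega> X = (\<lambda>a. if a \<in> \<Omega> then X a else 0)"

definition avg_dim :: "nat \<Rightarrow> (nat \<Rightarrow> nat) \<Rightarrow> real" where
  "avg_dim k d = (\<Sum>j=1..k. real (d j)) / real k"

definition geo_dim :: "nat \<Rightarrow> (nat \<Rightarrow> nat) \<Rightarrow> real" where
  "geo_dim k d = (\<Prod>j=1..k. real (d j)) powr (1 / real k)"

definition linf :: "nat \<Rightarrow> vect \<Rightarrow> real" where
  "linf m v = (MAX i\<in>{1..m}. \<bar>v i\<bar>)"

definition incoh_at ::
  "nat \<Rightarrow> (nat \<Rightarrow> nat) \<Rightarrow> (nat \<Rightarrow> real) \<Rightarrow> nat \<Rightarrow> nat \<Rightarrow> tensor set" where
  "incoh_at k d \<delta> j1 j2 = {rank_one k d u | u.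
     (\<forall>j\<in>{1..k}. u j \<in> vecs (d j) \<and> L2_set (u j) {1..d j} \<le> 1) \<and>
     (\<forall>j\<in>{1..k} - {j1, j2}. linf (d j) (u j) \<le> \<delta> j)}"

definition incoh :: "nat \<Rightarrow> (nat \<Rightarrow> nat) \<Rightarrow> (nat \<Rightarrow> real) \<Rightarrow> tensor set" where
  "incoh k d \<delta> = (\<Union>(j1, j2)\<in>{(j1, j2). 1 \<le> j1 \<and> j1 < j2 \<and> j2 \<le> k}. incoh_at k d \<delta> j1 j2)"

text \<open>
  If \<open>k \<ge> 2\<close> and all \<open>d j\<close> and \<open>\<delta> j\<close> are positive, the sets in the two suprema below are
  nonempty and bounded above, so that the real-valued supremum is the genuine one.
\<close>

definition circ_norm :: "nat \<Rightarrow> (nat \<Rightarrow> nat) \<Rightarrow> (nat \<Rightarrow> real) \<Rightarrow> tensor \<Rightarrow> real" where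
  "circ_norm k d \<delta> X = (SUP Y\<in>incoh k d \<delta>. tinner k d Y X)"

definition star_norm :: "nat \<Rightarrow> (nat \<Rightarrow> nat) \<Rightarrow> (nat \<Rightarrow> real) \<Rightarrow> tensor \<Rightarrow> real" where
  "star_norm k d \<delta> X = (SUP Y\<in>{Y\<in>tensors k d. circ_norm k d \<delta> Y \<le> 1}. tinner k d Y X)"

definition fiber_space :: "nat \<Rightarrow> (nat \<Rightarrow> nat) \<Rightarrow> tensor \<Rightarrow> nat \<Rightarrow> vect set" where
  "fiber_space k d T j = span {(\<lambda>i. T (a(j := i))) | a. a \<in> grid k d}"

definition tucker_rank :: "nat \<Rightarrow> (nat \<Rightarrow> nat) \<Rightarrow> tensor \<Rightarrow> nat \<Rightarrow> nat" where
  "tucker_rank k d T j = dim (fiber_space k d T j)"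

text \<open>
  Projection with respect to the Euclidean inner product on the coordinates \<open>1, \<dots>, m\<close>;
  it is well defined because \<open>V\<close> is always a subspace of \<^term>\<open>vecs m\<close>.
\<close>

definition orth_proj :: "nat \<Rightarrow> vect set \<Rightarrow> vect \<Rightarrow> vect" where
  "orth_proj m V u = (THE v. v \<in> V \<and> (\<forall>w\<in>V. (\<Sum>i=1..m. (u i - v i) * w i) = 0))"

definition mode_proj :: "nat \<Rightarrow> (nat \<Rightarrow> nat) \<Rightarrow> tensor \<Rightarrow> nat \<Rightarrow> vect \<Rightarrow> vect" where
  "mode_proj k d T j = orth_proj (d j) (fiber_space k d T j)"

definition mode_proj_perp :: "nat \<Rightarrow> (nat \<Rightarrow> nat) \<Rightarrow> tensor \<Rightarrow> nat \<Rightarrow> vect \<Rightarrow> vect" where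
  "mode_proj_perp k d T j u = u - mode_proj k d T j u"

definition coherence :: "nat \<Rightarrow> (nat \<Rightarrow> nat) \<Rightarrow> tensor \<Rightarrow> nat \<Rightarrow> real" where
  "coherence k d T j = real (d j) / real (tucker_rank k d T j) *
     (MAX i\<in>{1..d j}. (L2_set (mode_proj k d T j (unitv i)) {1..d j})\<^sup>2)"

text \<open>
  The tensor product of linear maps is the linear extension of
  \<open>e\<^sub>b\<^sub>1 \<otimes> \<dots> \<otimes> e\<^sub>b\<^sub>k \<mapsto> M 1 e\<^sub>b\<^sub>1 \<otimes> \<dots> \<otimes> M k e\<^sub>b\<^sub>k\<close>, written out in coordinates;
  for linear \<open>M j\<close> it sends every \<open>u\<^sub>1 \<otimes> \<dots> \<otimes> u\<^sub>k\<close> to \<open>M 1 u\<^sub>1 \<otimes> \<dots> \<otimes> M k u\<^sub>k\<close>.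
\<close>

definition tensor_map ::
  "nat \<Rightarrow> (nat \<Rightarrow> nat) \<Rightarrow> (nat \<Rightarrow> vect \<Rightarrow> vect) \<Rightarrow> tensor \<Rightarrow> tensor" where
  "tensor_map k d M X = (\<Sum>b\<in>grid k d. X b *\<^sub>R rank_one k d (\<lambda>j. M j (unitv (b j))))"

definition Q0 :: "nat \<Rightarrow> (nat \<Rightarrow> nat) \<Rightarrow> tensor \<Rightarrow> tensor \<Rightarrow> tensor" where
  "Q0 k d T = tensor_map k d (mode_proj k d T)"

definition QT :: "nat \<Rightarrow> (nat \<Rightarrow> nat) \<Rightarrow> tensor \<Rightarrow> tensor \<Rightarrow> tensor" where
  "QT k d T X = Q0 k d T X +
     (\<Sum>j=1..k. tensor_map k d ((mode_proj k d T)(j := mode_proj_perp k d T j)) X)"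

definition dual_tensor ::
  "nat \<Rightarrow> (nat \<Rightarrow> nat) \<Rightarrow> (nat \<Rightarrow> real) \<Rightarrow> tensor \<Rightarrow> tensor \<Rightarrow> bool" where
  "dual_tensor k d \<delta> T W0 \<longleftrightarrow> W0 \<in> tensors k d \<and> Q0 k d T W0 = W0 \<and>
     circ_norm k d \<delta> W0 = 1 \<and> tinner k d W0 T = star_norm k d \<delta> T"

definition r_star :: "nat \<Rightarrow> (nat \<Rightarrow> nat) \<Rightarrow> tensor \<Rightarrow> real" where
  "r_star k d T =
     (1 / (real k * avg_dim k d) *
       (\<Sum>j=1..k. real (d j) / real (tucker_rank k d T j) *
          (\<Prod>l=1..k. real (tucker_rank k d T l)))) powr (1 / (real k - 1))"

definition mu_star :: "nat \<Rightarrow> (nat \<Rightarrow> nat) \<Rightarrow> tensor \<Rightarrow> real" where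
  "mu_star k d T =
     geo_dim k d ^ k / (real k * r_star k d T ^ (k - 1) * avg_dim k d) *
       (MAX a\<in>grid k d. (hs_norm k d (QT k d T (rank_one k d (\<lambda>j. unitv (a j)))))\<^sup>2)"

definition alpha_star :: "nat \<Rightarrow> (nat \<Rightarrow> nat) \<Rightarrow> tensor \<Rightarrow> tensor \<Rightarrow> real" where
  "alpha_star k d T W0 = sqrt (geo_dim k d ^ k / r_star k d T) * max_norm k d W0"

text \<open>
  The set of all minimizers of the completion program; exact recovery of \<open>T\<close> means that this
  set is \<open>{T}\<close>, so that uniqueness of the solution is part of the event.
\<close>

definition completions ::
  "nat \<Rightarrow> (nat \<Rightarrow> nat) \<Rightarrow> (nat \<Rightarrow> real) \<Rightarrow> tensor \<Rightarrow> (nat \<Rightarrow> nat) set \<Rightarrow> tensor set" where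
  "completions k d \<delta> T \<Omega> = {That. is_arg_min (star_norm k d \<delta>)
     (\<lambda>X. X \<in> tensors k d \<and> restrict_tensor \<Omega> X = restrict_tensor \<Omega> T) That}"

text \<open>The uniform distribution is meaningful only for \<open>n \<le> card (grid k d)\<close>.\<close>

definition sample_pmf :: "nat \<Rightarrow> (nat \<Rightarrow> nat) \<Rightarrow> nat \<Rightarrow> (nat \<Rightarrow> nat) set pmf" where
  "sample_pmf k d n = pmf_of_set {\<Omega>. \<Omega> \<subseteq> grid k d \<and> card \<Omega> = n}"

end

theory Submission
  imports Defs
begin

text \<open>
  A dual certificate is built by the golfing scheme from independent batches of samples drawn with
  replacement; passing to a uniform subset costs nothing because exact recovery is monotone in
  \<open>\<Omega>\<close>. Every probabilistic estimate reduces to a scalar Bernstein inequality and a union bound.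
  No operator norm bound for the sampling operator is needed: golfing also from the projected unit tensors
  \<open>Q e\<^sub>a\<close> bounds the component of a perturbation in the range of \<open>Q\<^sub>T\<close> by
  the orthogonal one, up to a power of \<open>d\<close> that logarithmically many rounds absorb.

  For the incoherent norm of the sampling error, each factor \<open>u\<^sub>j\<close> is rounded to a lattice of mesh
  \<open>d\<^sub>j powr (- 1/2)\<close> with \<open>exp (O(d))\<close> points. For the two modes without incoherence, the entries with
  \<open>\<bar>u\<^sub>j\<^sub>1 u\<^sub>j\<^sub>2\<bar>\<close> small are handled by Bernstein. On the others
  \<open>\<bar>u\<^sub>j\<^sub>1 u\<^sub>j\<^sub>2\<bar>\<close> is dominated by a multiple of \<open>(u\<^sub>j\<^sub>1 u\<^sub>j\<^sub>2)\<^sup>2\<close>, a product of two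
  summable weights, so the largest multiplicity of a pair of coordinates in the sample controls them
  for all \<open>u\<close> at once. The balance of the two parts produces the term with \<open>d powr (3/2)\<close>.
\<close>

subsection \<open>Sampling with and without replacement\<close>

text \<open>The certificate tolerates any small correction in the kernel of \<open>Q\<close> because
  of a second-order effect. On an incoherent rank-one tensor whose projected factors have norms c_j,
  the dual tensor is at most the product p of the c_j. A tensor killed by \<open>Q\<close> only sees
  terms with two or more complementary factors, and any two of these have norms with product at most
  1 - p. This is why \<open>Q\<close> gathers the components with at most one complementary mode,
  and why a fixed margin such as \<open>(1 / 8) ^ k\<close> suffices: half of it is spent on the
  certificate, half on a multiple of the complementary part of the perturbation, which makes the
  inequality strict.

  Rounding to the lattice costs no approximation error: the form is affine in every coordinate, so
  some vertex of the lattice cell does at least as well. The only price is the number of lattice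
  points in the union bound.

  Of the two logarithms in the sample size, one pays for the golfing rounds and the other for the
  failure exponent of a round. Probabilities with replacement are counts of lists, so independence
  becomes factorization of sums.\<close>

definition nlists :: "nat \<Rightarrow> 'a set \<Rightarrow> 'a list set" where
  "nlists n A = {xs. set xs \<subseteq> A \<and> length xs = n}"

lemma finite_nlists [simp]: "finite A \<Longrightarrow> finite (nlists n A)" by (simp add: nlists_def finite_lists_length_eq)

lemma card_nlists: "finite A \<Longrightarrow> card (nlists n A) = card A ^ n" by (simp add: nlists_def card_lists_length_eq)

lemma nlists_0 [simp]: "nlists 0 A = {[]}" by (auto simp: nlists_def)

lemma nlists_Suc: "nlists (Suc n) A = (\<lambda>(x, xs). x # xs) ` (A \<times> nlists n A)"
  by (auto simp: nlists_def length_Suc_conv image_iff)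

lemma sum_nlists_Suc:
  assumes "finite A"
  shows "(\<Sum>xs\<in>nlists (Suc n) A. f xs) = (\<Sum>x\<in>A. \<Sum>xs\<in>nlists n A. f (x # xs))"
proof -
  have "inj_on (\<lambda>(x, xs). x # xs) (A \<times> nlists n A)" by (auto simp: inj_on_def)
  then have "(\<Sum>xs\<in>nlists (Suc n) A. f xs) = (\<Sum>(x, xs)\<in>A \<times> nlists n A. f (x # xs))"
    unfolding nlists_Suc by (subst sum.reindex) (auto simp: case_prod_unfold)
  then show ?thesis by (simp add: sum.cartesian_product)
qed

lemma sum_nlists_prod_list:
  fixes g :: "'a \<Rightarrow> real"
  assumes "finite A"
  shows "(\<Sum>xs\<in>nlists n A. prod_list (map g xs)) = (\<Sum>x\<in>A. g x) ^ n"
  by (induction n) (simp_all add: sum_nlists_Suc assms sum_distrib_left[symmetric] sum_distrib_right[symmetric])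

section \<open>Scalar tail bounds for lists of independent draws\<close>

lemma exp_le_quadratic:
  fixes y :: real
  assumes "y \<le> 1"
  shows "exp y \<le> 1 + y + y\<^sup>2"
proof (cases "y \<ge> 0")
  case True
  then show ?thesis using exp_bound assms by blast
next
  case False
  define z where "z = - y"
  have z: "z > 0" using False by (simp add: z_def)
  have "1 + z + z\<^sup>2 / 2 \<le> exp z" using exp_lower_Taylor_quadratic[of z] z by simp
  moreover have "0 \<le> 1 - z + z\<^sup>2"
  proof -
    have "1 - z + z\<^sup>2 = (1 - z / 2)\<^sup>2 + 3 / 4 * z\<^sup>2" by (simp add: power2_eq_square field_simps)
    then show ?thesis by simp
  qed
  \<comment> \<open>Multiplying the lower Taylor bound of exp z by the candidate avoids expanding
    exp at a negative argument: the product of the two quadratics is 1 plus nonnegative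
    terms.\<close>
  ultimately have "(1 - z + z\<^sup>2) * (1 + z + z\<^sup>2 / 2) \<le> (1 - z + z\<^sup>2) * exp z" by (intro mult_left_mono) auto
  moreover have "(1 - z + z\<^sup>2) * (1 + z + z\<^sup>2 / 2) = 1 + (z\<^sup>2 + z ^ 3 + z ^ 4) / 2"
    by (simp add: field_simps power2_eq_square power3_eq_cube power4_eq_xxxx)
  moreover have "0 \<le> z\<^sup>2 + z ^ 3 + z ^ 4" using z by simp
  ultimately have "1 \<le> (1 - z + z\<^sup>2) * exp z" by (smt (verit) divide_nonneg_nonneg)
  then have "exp (- z) \<le> 1 - z + z\<^sup>2" by (simp add: exp_minus divide_simps)
  then show ?thesis by (simp add: z_def)
qed

lemma prod_list_exp: "prod_list (map (\<lambda>x. exp (f x :: real)) xs) = exp (sum_list (map f xs))"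
  by (induction xs) (auto simp: exp_add)

text \<open>The exponential moment method, with \<open>sum_nlists_prod_list\<close> in place of
  independence. The raw second moment serves as variance proxy, so \<open>f\<close> is never
  centred, and only an upper bound on \<open>f\<close> enters the exponential estimate.\<close>

lemma bernstein_count:
  fixes f :: "'a \<Rightarrow> real"
  assumes A: "finite A" "A \<noteq> {}"
    and le: "\<And>x. x \<in> A \<Longrightarrow> f x \<le> b"
    and mean: "(\<Sum>x\<in>A. f x) \<le> real (card A) * \<mu>"
    and var: "(\<Sum>x\<in>A. (f x)\<^sup>2) \<le> real (card A) * v"
    and s: "s > 0" and v: "v \<ge> 0" and b: "b \<ge> 0" and pos: "2 * v + b * s > 0"
  shows "real (card {xs \<in> nlists m A. sum_list (map f xs) \<ge> real m * (\<mu> + s)})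
    \<le> exp (- (real m * s\<^sup>2 / (2 * (2 * v + b * s)))) * real (card A) ^ m"
proof -
  \<comment> \<open>Chosen so that \<open>\<theta> * b \<le> 1\<close>, which makes the quadratic
    bound on exp applicable, and \<open>2 * (\<theta> * v) \<le> s\<close>, so that the quadratic
    loss eats at most half of the linear gain.\<close>
  define \<theta> where "\<theta> = s / (2 * v + b * s)"
  have \<theta>: "\<theta> > 0" using s pos by (simp add: \<theta>_def)
  have \<theta>b: "\<theta> * b \<le> 1" using pos v by (simp add: \<theta>_def divide_simps mult.commute)
  have \<theta>v: "2 * (\<theta> * v) \<le> s"
  proof -
    have "2 * (s * v) \<le> s * (2 * v + b * s)" using s b by (simp add: algebra_simps)
    then show ?thesis using pos by (simp add: \<theta>_def divide_simps)
  qed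
  define N where "N = real (card A)"
  have N: "N > 0" using A by (simp add: N_def card_gt_0_iff)
  have "(\<Sum>x\<in>A. exp (\<theta> * f x)) \<le> (\<Sum>x\<in>A. 1 + \<theta> * f x + \<theta>\<^sup>2 * (f x)\<^sup>2)"
  proof (rule sum_mono)
    fix x assume "x \<in> A"
    then have "\<theta> * f x \<le> 1" using le[of x] \<theta> \<theta>b by (meson dual_order.trans less_eq_real_def mult_left_mono)
    then show "exp (\<theta> * f x) \<le> 1 + \<theta> * f x + \<theta>\<^sup>2 * (f x)\<^sup>2"
      using exp_le_quadratic[of "\<theta> * f x"] by (simp add: power_mult_distrib)
  qed
  also have "\<dots> = N + \<theta> * (\<Sum>x\<in>A. f x) + \<theta>\<^sup>2 * (\<Sum>x\<in>A. (f x)\<^sup>2)"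
    by (simp add: sum.distrib sum_distrib_left N_def)
  also have "\<dots> \<le> N + \<theta> * (N * \<mu>) + \<theta>\<^sup>2 * (N * v)"
    using mean var \<theta> by (intro add_mono mult_left_mono) (auto simp: N_def)
  also have "\<dots> = N * (1 + (\<theta> * \<mu> + \<theta>\<^sup>2 * v))" by (simp add: algebra_simps)
  also have "\<dots> \<le> N * exp (\<theta> * \<mu> + \<theta>\<^sup>2 * v)" using N by (intro mult_left_mono exp_ge_add_one_self) auto
  finally have mgf: "(\<Sum>x\<in>A. exp (\<theta> * f x)) \<le> N * exp (\<theta> * \<mu> + \<theta>\<^sup>2 * v)" .
  let ?S = "{xs \<in> nlists m A. sum_list (map f xs) \<ge> real m * (\<mu> + s)}"
  have "real (card ?S) = (\<Sum>xs\<in>?S. 1)" by simp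
  also have "\<dots> \<le> (\<Sum>xs\<in>?S. exp (\<theta> * sum_list (map f xs) - \<theta> * (real m * (\<mu> + s))))"
    using \<theta> by (intro sum_mono) (auto simp: right_diff_distrib[symmetric])
  also have "\<dots> \<le> (\<Sum>xs\<in>nlists m A. exp (\<theta> * sum_list (map f xs) - \<theta> * (real m * (\<mu> + s))))"
    using A by (intro sum_mono2) auto
  also have "\<dots> = exp (- (\<theta> * (real m * (\<mu> + s)))) * (\<Sum>xs\<in>nlists m A. prod_list (map (\<lambda>x. exp (\<theta> * f x)) xs))"
    by (simp add: prod_list_exp sum_list_const_mult sum_distrib_left exp_add[symmetric])
  also have "\<dots> = exp (- (\<theta> * (real m * (\<mu> + s)))) * (\<Sum>x\<in>A. exp (\<theta> * f x)) ^ m"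
    by (simp add: sum_nlists_prod_list A)
  also have "\<dots> \<le> exp (- (\<theta> * (real m * (\<mu> + s)))) * (N * exp (\<theta> * \<mu> + \<theta>\<^sup>2 * v)) ^ m"
    using mgf by (intro mult_left_mono power_mono sum_nonneg) auto
  also have "\<dots> = exp (real m * (\<theta> * (\<theta> * v - s))) * N ^ m"
    by (simp add: power_mult_distrib exp_of_nat_mult[symmetric] exp_add[symmetric] algebra_simps power2_eq_square)
  also have "\<dots> \<le> exp (real m * (\<theta> * (- (s / 2)))) * N ^ m"
    using \<theta>v \<theta> N by (intro mult_right_mono iffD2[OF exp_le_cancel_iff] mult_left_mono) auto
  also have "real m * (\<theta> * (- (s / 2))) = - (real m * s\<^sup>2 / (2 * (2 * v + b * s)))"
    by (simp add: \<theta>_def power2_eq_square)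
  finally show ?thesis by (simp add: N_def)
qed

lemma chernoff_count:
  assumes A: "finite A" "A \<noteq> {}" and S: "S \<subseteq> A" and p: "real (card S) \<le> real (card A) * p"
    and p0: "p > 0" and x: "x \<ge> 0" and m: "m > 0"
  shows "real (card {xs \<in> nlists m A. real (length (filter (\<lambda>a. a \<in> S) xs)) \<ge> 2 * real m * p + x})
    \<le> exp (- (x / 6)) * real (card A) ^ m"
proof -
  \<comment> \<open>Turns the threshold \<open>real m * (p + s)\<close> into
    \<open>2 * real m * p + x\<close>. Since \<open>s \<ge> p\<close>, the Bernstein denominator is
    at most \<open>6 * s\<close>, and the exponent is at least \<open>real m * s / 6\<close>, hence
    at least \<open>x / 6\<close>.\<close>
  define s where "s = p + x / real m"
  have s: "s \<ge> p" "s > 0" using p0 x by (auto simp: s_def add_pos_nonneg)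
  have S_sum: "(\<Sum>a\<in>A. of_bool (a \<in> S) :: real) = real (card S)" using S A by (simp add: Int_absorb1)
  have len: "sum_list (map (\<lambda>a. of_bool (a \<in> S) :: real) xs) = real (length (filter (\<lambda>a. a \<in> S) xs))" for xs
    by (induction xs) auto
  have "real (card {xs \<in> nlists m A. sum_list (map (\<lambda>a. of_bool (a \<in> S)) xs) \<ge> real m * (p + s)})
    \<le> exp (- (real m * s\<^sup>2 / (2 * (2 * p + 1 * s)))) * real (card A) ^ m"
  proof (rule bernstein_count[OF A])
    have "(\<Sum>a\<in>A. (of_bool (a \<in> S) :: real)\<^sup>2) = (\<Sum>a\<in>A. of_bool (a \<in> S))" by (intro sum.cong) auto
    then show "(\<Sum>a\<in>A. (of_bool (a \<in> S) :: real)\<^sup>2) \<le> real (card A) * p" using S_sum p by simp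
  qed (use S_sum p p0 s in auto)
  also have "\<dots> \<le> exp (- (x / 6)) * real (card A) ^ m"
  proof -
    have "x / 6 * (2 * (2 * p + s)) \<le> x / 6 * (2 * (3 * s))" using s x by (intro mult_left_mono) auto
    also have "\<dots> = x * s" by simp
    also have "\<dots> \<le> (real m * s) * s" using s x p0 m by (intro mult_right_mono) (auto simp: s_def field_simps)
    finally have "x / 6 \<le> real m * s\<^sup>2 / (2 * (2 * p + s))"
      using p0 s by (simp add: power2_eq_square pos_le_divide_eq)
    then show ?thesis by (intro mult_right_mono) auto
  qed
  also have "{xs \<in> nlists m A. sum_list (map (\<lambda>a. of_bool (a \<in> S)) xs) \<ge> real m * (p + s)}
    = {xs \<in> nlists m A. real (length (filter (\<lambda>a. a \<in> S) xs)) \<ge> 2 * real m * p + x}"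
    using m by (simp add: len s_def algebra_simps)
  finally show ?thesis .
qed

section \<open>Comparison of lists with uniform subsets for monotone functions\<close>

definition nsub :: "nat \<Rightarrow> 'a set \<Rightarrow> 'a set set" where
  "nsub n G = {\<Omega>. \<Omega> \<subseteq> G \<and> card \<Omega> = n}"

lemma finite_nsub [simp]: "finite G \<Longrightarrow> finite (nsub n G)"
  unfolding nsub_def by (rule finite_subset[of _ "Pow G"]) auto

lemma card_nsub: "finite G \<Longrightarrow> card (nsub n G) = card G choose n" by (simp add: nsub_def n_subsets)

text \<open>Double counting of pairs: a set with \<open>Suc n\<close> elements arises by insertion
  once for each of its elements.\<close>

lemma sum_nsub_insert:
  fixes h :: "'a set \<Rightarrow> real"
  assumes G: "finite G"
  shows "(\<Sum>\<Omega>\<in>nsub n G. \<Sum>x\<in>G - \<Omega>. h (insert x \<Omega>)) = real (Suc n) * (\<Sum>\<Omega>\<in>nsub (Suc n) G. h \<Omega>)"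
proof -
  have fin: "finite \<Omega>" if "\<Omega> \<in> nsub n' G" for \<Omega> n' using that G by (auto simp: nsub_def intro: finite_subset)
  have "(\<Sum>\<Omega>\<in>nsub n G. \<Sum>x\<in>G - \<Omega>. h (insert x \<Omega>)) = (\<Sum>(\<Omega>, x)\<in>(SIGMA \<Omega>:nsub n G. G - \<Omega>). h (insert x \<Omega>))"
    using G by (subst sum.Sigma) auto
  also have "\<dots> = (\<Sum>(\<Omega>, x)\<in>(SIGMA \<Omega>:nsub (Suc n) G. \<Omega>). h \<Omega>)"
    by (rule sum.reindex_bij_witness[of _ "\<lambda>(\<Omega>, x). (\<Omega> - {x}, x)" "\<lambda>(\<Omega>, x). (insert x \<Omega>, x)"])
       (auto simp: nsub_def insert_absorb card_insert_if dest: finite_subset[OF _ G])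
  also have "\<dots> = (\<Sum>\<Omega>\<in>nsub (Suc n) G. \<Sum>x\<in>\<Omega>. h \<Omega>)" using G fin by (subst sum.Sigma) auto
  also have "\<dots> = real (Suc n) * (\<Sum>\<Omega>\<in>nsub (Suc n) G. h \<Omega>)"
    unfolding sum_distrib_left by (rule sum.cong) (auto simp: nsub_def)
  finally show ?thesis .
qed

lemma sum_nsub_mono_insert:
  fixes g :: "'a set \<Rightarrow> real"
  assumes G: "finite G" and mono: "\<And>\<Omega> \<Omega>'. \<Omega> \<subseteq> \<Omega>' \<Longrightarrow> \<Omega>' \<subseteq> G \<Longrightarrow> g \<Omega> \<le> g \<Omega>'"
    and n: "n \<le> card G"
  shows "real (card G - n) * (\<Sum>\<Omega>\<in>nsub n G. g \<Omega>) \<le> (\<Sum>\<Omega>\<in>nsub n G. \<Sum>x\<in>G - \<Omega>. g (insert x \<Omega>))"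
  unfolding sum_distrib_left
proof (rule sum_mono)
  fix \<Omega> assume \<Omega>: "\<Omega> \<in> nsub n G"
  then have "real (card G - n) * g \<Omega> = (\<Sum>x\<in>G - \<Omega>. g \<Omega>)"
    using G by (auto simp: nsub_def card_Diff_subset finite_subset)
  also have "\<dots> \<le> (\<Sum>x\<in>G - \<Omega>. g (insert x \<Omega>))" using \<Omega> by (intro sum_mono mono) (auto simp: nsub_def)
  finally show "real (card G - n) * g \<Omega> \<le> (\<Sum>x\<in>G - \<Omega>. g (insert x \<Omega>))" .
qed

lemma binomial_Suc_real:
  assumes "n < N"
  shows "real (N choose n) * real (N - n) = real (N choose Suc n) * real (Suc n)"
proof -
  have "Suc n * (N choose Suc n) = (N - n) * (N choose n)"
    using binomial_absorb_comp[of N n] binomial_absorption[of n N] by simp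
  then show ?thesis by (metis mult.commute of_nat_mult)
qed

lemma nsub_average_Suc:
  fixes g :: "'a set \<Rightarrow> real"
  assumes G: "finite G" and mono: "\<And>\<Omega> \<Omega>'. \<Omega> \<subseteq> \<Omega>' \<Longrightarrow> \<Omega>' \<subseteq> G \<Longrightarrow> g \<Omega> \<le> g \<Omega>'"
    and n: "n < card G"
  shows "(\<Sum>\<Omega>\<in>nsub n G. g \<Omega>) / real (card G choose n) \<le> (\<Sum>\<Omega>\<in>nsub (Suc n) G. g \<Omega>) / real (card G choose Suc n)"
proof -
  let ?N = "card G"
  have *: "real (?N - n) * (\<Sum>\<Omega>\<in>nsub n G. g \<Omega>) \<le> real (Suc n) * (\<Sum>\<Omega>\<in>nsub (Suc n) G. g \<Omega>)"
    using sum_nsub_mono_insert[of G g n] sum_nsub_insert[of G g n] G mono n by simp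
  have b: "real (?N choose n) > 0" "real (?N choose Suc n) > 0" "real (?N - n) > 0" using n by auto
  have eq: "real (?N choose n) * real (?N - n) = real (?N choose Suc n) * real (Suc n)"
    using binomial_Suc_real n by blast
  have "(\<Sum>\<Omega>\<in>nsub n G. g \<Omega>) / real (?N choose n) = real (?N - n) * (\<Sum>\<Omega>\<in>nsub n G. g \<Omega>) / (real (?N choose n) * real (?N - n))"
    using b by simp
  also have "\<dots> \<le> real (Suc n) * (\<Sum>\<Omega>\<in>nsub (Suc n) G. g \<Omega>) / (real (?N choose n) * real (?N - n))"
    using * b by (intro divide_right_mono) auto
  also have "\<dots> = (\<Sum>\<Omega>\<in>nsub (Suc n) G. g \<Omega>) / real (?N choose Suc n)" unfolding eq by simp
  finally show ?thesis .
qed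

lemma nsub_average_mono:
  fixes g :: "'a set \<Rightarrow> real"
  assumes G: "finite G" and mono: "\<And>\<Omega> \<Omega>'. \<Omega> \<subseteq> \<Omega>' \<Longrightarrow> \<Omega>' \<subseteq> G \<Longrightarrow> g \<Omega> \<le> g \<Omega>'"
    and "j \<le> n" "n \<le> card G"
  shows "(\<Sum>\<Omega>\<in>nsub j G. g \<Omega>) / real (card G choose j) \<le> (\<Sum>\<Omega>\<in>nsub n G. g \<Omega>) / real (card G choose n)"
  using assms(3,4)
proof (induction n rule: dec_induct)
  case (step n)
  then show ?case using nsub_average_Suc[of G g n] G mono by fastforce
qed simp

text \<open>A repeated draw adds nothing, a fresh draw can only help. The induction peels off the
  first entry x and applies the hypothesis to the function sending \<Omega> to
  \<open>g (insert x \<Omega>)\<close>, which is again monotone; this is why \<open>g\<close> is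
  generalized.\<close>

lemma nlists_average_le_nsub:
  fixes g :: "'a set \<Rightarrow> real"
  assumes G: "finite G" and mono: "\<And>\<Omega> \<Omega>'. \<Omega> \<subseteq> \<Omega>' \<Longrightarrow> \<Omega>' \<subseteq> G \<Longrightarrow> g \<Omega> \<le> g \<Omega>'"
    and n: "n \<le> card G"
  shows "(\<Sum>xs\<in>nlists n G. g (set xs)) / real (card G) ^ n \<le> (\<Sum>\<Omega>\<in>nsub n G. g \<Omega>) / real (card G choose n)"
  using mono n
proof (induction n arbitrary: g)
  case 0
  have "nsub 0 G = {{}}" using G by (auto simp: nsub_def dest: finite_subset)
  then show ?case by simp
next
  case (Suc n)
  let ?N = "real (card G)"
  have n: "n < card G" using Suc.prems by simp
  have N: "?N > 0" "?N > real n" using n by auto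
  have b: "real (card G choose n) > 0" "real (card G choose Suc n) > 0" using n by auto
  have IH: "(\<Sum>xs\<in>nlists n G. g (insert x (set xs))) \<le> ?N ^ n / real (card G choose n) * (\<Sum>\<Omega>\<in>nsub n G. g (insert x \<Omega>))" if "x \<in> G" for x
  proof -
    have "g (insert x \<Omega>) \<le> g (insert x \<Omega>')" if "\<Omega> \<subseteq> \<Omega>'" "\<Omega>' \<subseteq> G" for \<Omega> \<Omega>'
      using that \<open>x \<in> G\<close> by (intro Suc.prems) auto
    then have "(\<Sum>xs\<in>nlists n G. g (insert x (set xs))) / ?N ^ n \<le> (\<Sum>\<Omega>\<in>nsub n G. g (insert x \<Omega>)) / real (card G choose n)"
      using Suc.IH[of "\<lambda>\<Omega>. g (insert x \<Omega>)"] n by simp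
    then show ?thesis using N by (simp add: pos_divide_le_eq) (simp add: mult.commute)
  qed
  let ?T = "\<Sum>\<Omega>\<in>nsub n G. \<Sum>x\<in>G - \<Omega>. g (insert x \<Omega>)"
  have "(\<Sum>x\<in>G. \<Sum>\<Omega>\<in>nsub n G. g (insert x \<Omega>)) = (\<Sum>\<Omega>\<in>nsub n G. \<Sum>x\<in>G. g (insert x \<Omega>))"
    by (rule sum.swap)
  also have "\<dots> = (\<Sum>\<Omega>\<in>nsub n G. real n * g \<Omega> + (\<Sum>x\<in>G - \<Omega>. g (insert x \<Omega>)))"
  proof (rule sum.cong)
    fix \<Omega> assume \<Omega>: "\<Omega> \<in> nsub n G"
    then have "(\<Sum>x\<in>G. g (insert x \<Omega>)) = (\<Sum>x\<in>\<Omega>. g (insert x \<Omega>)) + (\<Sum>x\<in>G - \<Omega>. g (insert x \<Omega>))"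
      using G by (subst sum.subset_diff[of \<Omega> G]) (auto simp: nsub_def)
    also have "(\<Sum>x\<in>\<Omega>. g (insert x \<Omega>)) = real n * g \<Omega>" using \<Omega> by (simp add: nsub_def insert_absorb)
    finally show "(\<Sum>x\<in>G. g (insert x \<Omega>)) = real n * g \<Omega> + (\<Sum>x\<in>G - \<Omega>. g (insert x \<Omega>))" .
  qed simp
  also have "\<dots> = real n * (\<Sum>\<Omega>\<in>nsub n G. g \<Omega>) + ?T" by (simp add: sum.distrib sum_distrib_left)
  \<comment> \<open>Each of the n wasted draws inside \<Omega> contributes
    \<open>g \<Omega>\<close>, which monotonicity bounds by the average over the N - n fresh
    draws.\<close>
  also have "\<dots> \<le> ?N / (?N - real n) * ?T"
  proof -
    have "(?N - real n) * (\<Sum>\<Omega>\<in>nsub n G. g \<Omega>) \<le> ?T"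
      using sum_nsub_mono_insert[of G g n] G Suc.prems n by (simp add: of_nat_diff)
    then have "real n * ((?N - real n) * (\<Sum>\<Omega>\<in>nsub n G. g \<Omega>)) \<le> real n * ?T" by (intro mult_left_mono) auto
    then have "(?N - real n) * (real n * (\<Sum>\<Omega>\<in>nsub n G. g \<Omega>) + ?T) \<le> ?N * ?T" by (simp add: algebra_simps)
    then show ?thesis using N by (simp add: pos_le_divide_eq mult.commute)
  qed
  also have "?T = real (Suc n) * (\<Sum>\<Omega>\<in>nsub (Suc n) G. g \<Omega>)" by (rule sum_nsub_insert[OF G])
  finally have A: "(\<Sum>x\<in>G. \<Sum>\<Omega>\<in>nsub n G. g (insert x \<Omega>)) \<le> ?N / (?N - real n) * (real (Suc n) * (\<Sum>\<Omega>\<in>nsub (Suc n) G. g \<Omega>))" .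
  have "(\<Sum>xs\<in>nlists (Suc n) G. g (set xs)) = (\<Sum>x\<in>G. \<Sum>xs\<in>nlists n G. g (insert x (set xs)))"
    by (simp add: sum_nlists_Suc G)
  also have "\<dots> \<le> (\<Sum>x\<in>G. ?N ^ n / real (card G choose n) * (\<Sum>\<Omega>\<in>nsub n G. g (insert x \<Omega>)))"
    by (intro sum_mono IH)
  also have "\<dots> \<le> ?N ^ n / real (card G choose n) * (?N / (?N - real n) * (real (Suc n) * (\<Sum>\<Omega>\<in>nsub (Suc n) G. g \<Omega>)))"
    unfolding sum_distrib_left[symmetric] using A by (intro mult_left_mono) auto
  also have "\<dots> = ?N ^ Suc n * (real (Suc n) / (real (card G choose n) * (?N - real n)) * (\<Sum>\<Omega>\<in>nsub (Suc n) G. g \<Omega>))"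
    by simp
  also have "real (card G choose n) * (?N - real n) = real (card G choose Suc n) * real (Suc n)"
    using binomial_Suc_real[OF n] n by (simp add: of_nat_diff)
  finally have "(\<Sum>xs\<in>nlists (Suc n) G. g (set xs)) \<le> ?N ^ Suc n * ((\<Sum>\<Omega>\<in>nsub (Suc n) G. g \<Omega>) / real (card G choose Suc n))"
    by (simp del: of_nat_Suc)
  then show ?case using N by (simp add: pos_divide_le_eq mult.commute del: of_nat_Suc)
qed

section \<open>Union bounds along an adaptive trajectory\<close>

fun traj :: "('s \<Rightarrow> 'x \<Rightarrow> 's) \<Rightarrow> ('s \<Rightarrow> 'x \<Rightarrow> bool) \<Rightarrow> 's \<Rightarrow> 'x list \<Rightarrow> bool" where
  "traj step good s [] = True"
| "traj step good s (x # xs) = (good s x \<and> traj step good (step s x) xs)"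

lemma card_filter_real: "finite X \<Longrightarrow> real (card {x \<in> X. P x}) = (\<Sum>x\<in>X. of_bool (P x))"
  by (simp add: of_bool_def sum.If_cases Int_def)

text \<open>The state tested against a batch depends only on earlier batches, and the failure bound
  is uniform over states satisfying \<open>I\<close>. Summing over the first batch, a bad one costs
  p, and a good one preserves \<open>I\<close>, so that the induction hypothesis applies from the
  new state.\<close>

lemma adaptive_union_bound:
  assumes X: "finite X"
    and inv: "\<And>s x. I s \<Longrightarrow> x \<in> X \<Longrightarrow> good s x \<Longrightarrow> I (step s x)"
    and bad: "\<And>s. I s \<Longrightarrow> real (card {x \<in> X. \<not> good s x}) \<le> p * real (card X)"
    and s: "I s"
  shows "real (card {xs \<in> nlists L X. \<not> traj step good s xs}) \<le> real L * p * real (card X) ^ L" using s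
proof (induction L arbitrary: s)
  case 0
  have "{xs \<in> nlists 0 X. \<not> traj step good s xs} = {}" by auto
  then show ?case by (metis card.empty mult_zero_left of_nat_0 order.refl)
next
  case (Suc L)
  let ?q = "real (card X)"
  have card_eq: "real (card {xs \<in> nlists n X. P xs}) = (\<Sum>xs\<in>nlists n X. of_bool (P xs))" for n P
    by (intro card_filter_real finite_nlists X)
  have p: "0 \<le> p * ?q" using bad[OF Suc.prems] by (meson dual_order.trans of_nat_0_le_iff)
  have "real (card {xs \<in> nlists (Suc L) X. \<not> traj step good s xs})
     = (\<Sum>x\<in>X. \<Sum>xs\<in>nlists L X. of_bool (\<not> (good s x \<and> traj step good (step s x) xs)))"
    unfolding card_eq by (subst sum_nlists_Suc[OF X]) simp
  also have "\<dots> \<le> (\<Sum>x\<in>X. of_bool (\<not> good s x) * ?q ^ L + real L * p * ?q ^ L)"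
  proof (rule sum_mono)
    fix x assume x: "x \<in> X"
    have n: "(\<Sum>xs\<in>nlists L X. 1 :: real) = ?q ^ L" using X by (simp add: card_nlists)
    \<comment> \<open>Only the product \<open>p * ?q\<close> is known to be nonnegative, so one
      factor is split off from the power.\<close>
    have pos: "0 \<le> real L * p * ?q ^ L"
    proof (cases L)
      case (Suc l)
      have "0 \<le> real L * (p * ?q) * ?q ^ l" using mult_nonneg_nonneg[OF mult_nonneg_nonneg[OF _ p], of "real L" "?q ^ l"] by simp
      then show ?thesis using Suc by (simp add: algebra_simps)
    qed simp
    show "(\<Sum>xs\<in>nlists L X. of_bool (\<not> (good s x \<and> traj step good (step s x) xs))) \<le> of_bool (\<not> good s x) * ?q ^ L + real L * p * ?q ^ L"
    proof (cases "good s x")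
      case True
      then show ?thesis using Suc.IH[OF inv[OF Suc.prems x True]] by (simp add: card_eq)
    next
      case False
      then show ?thesis using n pos by simp
    qed
  qed
  also have "\<dots> = real (card {x \<in> X. \<not> good s x}) * ?q ^ L + real L * p * ?q ^ Suc L"
    using X by (simp add: sum.distrib sum_distrib_right[symmetric] card_filter_real)
  also have "\<dots> \<le> p * ?q * ?q ^ L + real L * p * ?q ^ Suc L"
    using mult_right_mono[OF bad[OF Suc.prems], of "?q ^ L"] by simp
  also have "\<dots> = real (Suc L) * p * ?q ^ Suc L" by (simp add: algebra_simps)
  finally show ?case .
qed

text \<open>Blocks of equal length can be recovered from their concatenation, so L batches of size m
  inject into lists of length L * m with the same set of entries.\<close>

lemma card_nlists_concat_le:
  assumes G: "finite G"
  shows "card {xss \<in> nlists L (nlists m G). g (set (concat xss))} \<le> card {xs \<in> nlists (L * m) G. g (set xs)}"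
proof (rule card_inj_on_le)
  have len: "length (concat xss) = L * m" if "xss \<in> nlists L (nlists m G)" for xss
    using that by (induction xss arbitrary: L) (auto simp: nlists_def)
  show "inj_on concat {xss \<in> nlists L (nlists m G). g (set (concat xss))}"
  proof (rule inj_onI)
    fix x y :: "'a list list"
    assume xy: "x \<in> {xss \<in> nlists L (nlists m G). g (set (concat xss))}"
      "y \<in> {xss \<in> nlists L (nlists m G). g (set (concat xss))}" and eq: "concat x = concat y"
    have l: "length x = length y" using xy by (auto simp: nlists_def)
    have "\<forall>(a, b)\<in>set (zip x y). length a = length b"
    proof clarify
      fix a b assume "(a, b) \<in> set (zip x y)"
      then have "a \<in> set x" "b \<in> set y" by (auto dest: set_zip_leftD set_zip_rightD)
      then show "length a = length b" using xy by (auto simp: nlists_def)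
    qed
    then show "x = y" using concat_injective[OF eq l] by auto
  qed
  show "concat ` {xss \<in> nlists L (nlists m G). g (set (concat xss))} \<subseteq> {xs \<in> nlists (L * m) G. g (set xs)}"
    using len by (fastforce simp: nlists_def)
qed (use G in simp)

subsection \<open>Multilinear forms and lattice rounding\<close>

text \<open>The factors of a rank-one tensor are determined only up to scaling, so all estimates are
  phrased for the family \<open>u\<close> itself.\<close>

definition mform :: "nat \<Rightarrow> (nat \<Rightarrow> nat) \<Rightarrow> tensor \<Rightarrow> (nat \<Rightarrow> vect) \<Rightarrow> real" where
  "mform k d X u = (\<Sum>a\<in>grid k d. X a * (\<Prod>j=1..k. u j (a j)))"

lemma finite_grid [simp]: "finite (grid k d)" by (simp add: grid_def finite_PiE)

lemma gridD: "a \<in> grid k d \<Longrightarrow> j \<in> {1..k} \<Longrightarrow> a j \<in> {1..d j}" by (auto simp: grid_def PiE_def Pi_def)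

lemma card_grid: "card (grid k d) = (\<Prod>j=1..k. d j)" by (simp add: grid_def card_PiE)

lemma sum_grid_prod:
  fixes g :: "nat \<Rightarrow> nat \<Rightarrow> real"
  shows "(\<Sum>a\<in>grid k d. \<Prod>j=1..k. g j (a j)) = (\<Prod>j=1..k. \<Sum>i=1..d j. g j i)"
  unfolding grid_def by (rule prod_sum_PiE[symmetric]) auto

lemma tinner_rank_one: "tinner k d (rank_one k d u) X = mform k d X u"
  by (auto simp: tinner_def rank_one_def mform_def mult.commute intro!: sum.cong)

lemma tinner_commute: "tinner k d X Y = tinner k d Y X" by (simp add: tinner_def mult.commute)

lemma tinner_add_left: "tinner k d (X + Y) Z = tinner k d X Z + tinner k d Y Z"
  by (simp add: tinner_def distrib_right sum.distrib)

lemma tinner_add_right: "tinner k d Z (X + Y) = tinner k d Z X + tinner k d Z Y"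
  by (simp add: tinner_def distrib_left sum.distrib)

lemma tinner_diff_left: "tinner k d (X - Y) Z = tinner k d X Z - tinner k d Y Z"
  by (simp add: tinner_def left_diff_distrib sum_subtractf)

lemma tinner_scaleR_left: "tinner k d (c *\<^sub>R X) Z = c * tinner k d X Z"
  by (simp add: tinner_def scaleR_fun_def sum_distrib_left mult.assoc)

lemma mform_cong:
  "(\<And>j i. j \<in> {1..k} \<Longrightarrow> i \<in> {1..d j} \<Longrightarrow> u j i = v j i) \<Longrightarrow> (\<And>a. a \<in> grid k d \<Longrightarrow> X a = Y a)
   \<Longrightarrow> mform k d X u = mform k d Y v"
  unfolding mform_def by (intro sum.cong arg_cong2[of _ _ _ _ "(*)"] prod.cong) (auto dest: gridD)

lemma mform_add: "mform k d (X + Y) u = mform k d X u + mform k d Y u"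
  by (simp add: mform_def distrib_right sum.distrib)

lemma mform_diff: "mform k d (X - Y) u = mform k d X u - mform k d Y u"
  by (simp add: mform_def left_diff_distrib sum_subtractf)

lemma mform_scaleR: "mform k d (c *\<^sub>R X) u = c * mform k d X u"
  by (simp add: mform_def scaleR_fun_def sum_distrib_left mult.assoc)

lemma mform_zero [simp]: "mform k d 0 u = 0" by (simp add: mform_def)

lemma sum_fun_apply: "(\<Sum>i\<in>A. X i) a = (\<Sum>i\<in>A. X i a)" for X :: "'a \<Rightarrow> 'b \<Rightarrow> real"
  by (induction A rule: infinite_finite_induct) auto

lemma mform_sum: "mform k d (\<Sum>i\<in>A. X i) u = (\<Sum>i\<in>A. mform k d (X i) u)"
  by (simp add: mform_def sum_fun_apply sum_distrib_right sum.swap[of _ A])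

lemma mform_scale: "mform k d X (\<lambda>j i. c j * u j i) = (\<Prod>j=1..k. c j) * mform k d X u"
  by (simp add: mform_def prod.distrib sum_distrib_left algebra_simps)

lemma mform_eq_0:
  assumes "j \<in> {1..k}" "\<And>i. i \<in> {1..d j} \<Longrightarrow> u j i = 0"
  shows "mform k d X u = 0" unfolding mform_def
proof (intro sum.neutral ballI)
  fix a assume "a \<in> grid k d"
  then have "u j (a j) = 0" using gridD assms by blast
  then have "(\<Prod>j=1..k. u j (a j)) = 0" using assms(1) by (intro prod_zero) auto
  then show "X a * (\<Prod>j=1..k. u j (a j)) = 0" by simp
qed

lemma mform_unitv:
  assumes "b \<in> grid k d"
  shows "mform k d X (\<lambda>j. unitv (b j)) = X b"
proof -
  have "(\<Prod>j=1..k. unitv (b j) (a j)) = of_bool (a = b)" if a: "a \<in> grid k d" for a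
  proof (cases "a = b")
    case False
    then obtain j where j: "a j \<noteq> b j" "j \<in> {1..k}"
    proof -
      have "\<exists>j\<in>{1..k}. a j \<noteq> b j"
      proof (rule ccontr)
        assume "\<not> (\<exists>j\<in>{1..k}. a j \<noteq> b j)"
        then have "a = b" using PiE_ext[OF a[unfolded grid_def] assms[unfolded grid_def]] by simp
        with False show False by simp
      qed
      then show thesis using that by auto
    qed
    then have "(\<Prod>j=1..k. unitv (b j) (a j)) = 0" by (intro prod_zero bexI[of _ j]) (auto simp: unitv_def)
    then show ?thesis using False by simp
  qed (simp add: unitv_def)
  then have "mform k d X (\<lambda>j. unitv (b j)) = (\<Sum>a\<in>grid k d. X a * of_bool (a = b))"
    unfolding mform_def by (intro sum.cong) auto
  also have "\<dots> = (\<Sum>a\<in>grid k d. if a = b then X a else 0)" by (intro sum.cong) auto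
  also have "\<dots> = X b" using assms by simp
  finally show ?thesis .
qed

lemma mform_expand:
  assumes "\<And>j i. j \<in> {1..k} \<Longrightarrow> i \<in> {1..d j} \<Longrightarrow> u j i = q j i + p j i"
  shows "mform k d X u = (\<Sum>S\<in>Pow {1..k}. mform k d X (\<lambda>j. if j \<in> S then q j else p j))"
proof -
  have "(\<Prod>j=1..k. u j (a j)) = (\<Sum>S\<in>Pow {1..k}. \<Prod>j=1..k. (if j \<in> S then q j else p j) (a j))"
    if "a \<in> grid k d" for a
  proof -
    have "(\<Prod>j=1..k. u j (a j)) = (\<Prod>j=1..k. q j (a j) + p j (a j))"
      using assms that by (intro prod.cong) (auto dest: gridD)
    also have "\<dots> = (\<Sum>S\<in>Pow {1..k}. (\<Prod>j\<in>S. q j (a j)) * (\<Prod>j\<in>{1..k} - S. p j (a j)))" by (rule prod_add) simp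
    also have "\<dots> = (\<Sum>S\<in>Pow {1..k}. \<Prod>j=1..k. (if j \<in> S then q j else p j) (a j))"
    proof (rule sum.cong)
      fix S assume "S \<in> Pow {1..k}"
      then show "(\<Prod>j\<in>S. q j (a j)) * (\<Prod>j\<in>{1..k} - S. p j (a j)) = (\<Prod>j=1..k. (if j \<in> S then q j else p j) (a j))"
        by (subst prod.subset_diff[of S "{1..k}"]) (auto simp: mult.commute intro!: arg_cong2[of _ _ _ _ "(*)"] prod.cong)
    qed simp
    finally show ?thesis .
  qed
  then have "mform k d X u = (\<Sum>a\<in>grid k d. \<Sum>S\<in>Pow {1..k}. X a * (\<Prod>j=1..k. (if j \<in> S then q j else p j) (a j)))"
    unfolding mform_def by (intro sum.cong) (auto simp: sum_distrib_left)
  also have "\<dots> = (\<Sum>S\<in>Pow {1..k}. mform k d X (\<lambda>j. if j \<in> S then q j else p j))"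
    unfolding mform_def by (rule sum.swap)
  finally show ?thesis .
qed

text \<open>The constraints of \<open>incoh_at\<close>, on the index ranges only. Membership in
  \<open>vecs\<close> is left out so that derived families can be tested without truncating
  them.\<close>

definition incoherent :: "nat \<Rightarrow> (nat \<Rightarrow> nat) \<Rightarrow> (nat \<Rightarrow> real) \<Rightarrow> nat \<Rightarrow> nat \<Rightarrow> (nat \<Rightarrow> vect) \<Rightarrow> bool" where
  "incoherent k d \<delta> j1 j2 u \<longleftrightarrow> (\<forall>j\<in>{1..k}. (\<Sum>i=1..d j. (u j i)\<^sup>2) \<le> 1) \<and>
     (\<forall>j\<in>{1..k} - {j1, j2}. \<forall>i\<in>{1..d j}. \<bar>u j i\<bar> \<le> \<delta> j)"

lemma abs_le_one_of_sumsq: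
  fixes f :: "nat \<Rightarrow> real"
  assumes "(\<Sum>i=1..m. (f i)\<^sup>2) \<le> 1" "i \<in> {1..m}"
  shows "\<bar>f i\<bar> \<le> 1"
proof -
  have "(f i)\<^sup>2 \<le> (\<Sum>i=1..m. (f i)\<^sup>2)" using assms(2) by (intro member_le_sum) auto
  then have "(f i)\<^sup>2 \<le> 1" using assms(1) by linarith
  then show ?thesis by (simp add: abs_square_le_1)
qed

lemma mform_abs_le:
  assumes "\<And>j i. j \<in> {1..k} \<Longrightarrow> i \<in> {1..d j} \<Longrightarrow> \<bar>u j i\<bar> \<le> 1"
  shows "\<bar>mform k d X u\<bar> \<le> (\<Sum>a\<in>grid k d. \<bar>X a\<bar>)"
proof -
  have "\<bar>\<Prod>j=1..k. u j (a j)\<bar> \<le> 1" if "a \<in> grid k d" for a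
    unfolding abs_prod by (intro prod_le_1) (use assms that in \<open>auto dest: gridD\<close>)
  then have "\<bar>X a * (\<Prod>j=1..k. u j (a j))\<bar> \<le> \<bar>X a\<bar>" if "a \<in> grid k d" for a
    using that mult_left_le[of "\<bar>\<Prod>j=1..k. u j (a j)\<bar>" "\<bar>X a\<bar>"] by (simp add: abs_mult)
  then show ?thesis unfolding mform_def by (intro order.trans[OF sum_abs] sum_mono)
qed

lemma incoherent_abs_le_one:
  "incoherent k d \<delta> j1 j2 u \<Longrightarrow> j \<in> {1..k} \<Longrightarrow> i \<in> {1..d j} \<Longrightarrow> \<bar>u j i\<bar> \<le> 1"
  unfolding incoherent_def using abs_le_one_of_sumsq by blast

section \<open>Passing to the vertices of a box\<close>

lemma affine_sum:
  fixes f :: "'a \<Rightarrow> real \<Rightarrow> real"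
  assumes "\<And>a. a \<in> A \<Longrightarrow> \<exists>\<alpha> \<beta>. \<forall>s. f a s = \<alpha> + \<beta> * s"
  shows "\<exists>\<alpha> \<beta>. \<forall>s. (\<Sum>a\<in>A. f a s) = \<alpha> + \<beta> * s"
proof -
  obtain \<alpha> \<beta> where "\<And>a s. a \<in> A \<Longrightarrow> f a s = \<alpha> a + \<beta> a * s" using assms by metis
  then have "\<forall>s. (\<Sum>a\<in>A. f a s) = (\<Sum>a\<in>A. \<alpha> a) + (\<Sum>a\<in>A. \<beta> a) * s"
    by (simp add: sum.distrib sum_distrib_right)
  then show ?thesis by blast
qed

text \<open>Each index a meets the coordinate (j, i) at most once, namely when
  \<open>a j = i\<close>. The family is encoded as one function on pairs so that a single coordinate
  can be updated.\<close>

lemma mform_affine: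
  fixes x :: "nat \<times> nat \<Rightarrow> real"
  assumes j: "j \<in> {1..k}"
  shows "\<exists>\<alpha> \<beta>. \<forall>s. mform k d X (\<lambda>j' i'. (x((j, i) := s)) (j', i')) = \<alpha> + \<beta> * s" unfolding mform_def
proof (rule affine_sum)
  fix a
  let ?R = "\<Prod>j'\<in>{1..k} - {j}. x (j', a j')"
  have *: "(\<Prod>j'=1..k. (x((j, i) := s)) (j', a j')) = (x((j, i) := s)) (j, a j) * ?R" for s
    using j by (subst prod.remove[of _ j]) (auto intro!: prod.cong)
  show "\<exists>\<alpha> \<beta>. \<forall>s. X a * (\<Prod>j'=1..k. (x((j, i) := s)) (j', a j')) = \<alpha> + \<beta> * s"
  proof (cases "a j = i")
    case True
    then show ?thesis unfolding * by (intro exI[of _ 0] exI[of _ "X a * ?R"]) simp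
  next
    case False
    then show ?thesis unfolding * by (intro exI[of _ "X a * (x (j, a j) * ?R)"] exI[of _ 0]) simp
  qed
qed

text \<open>An affine function on an interval attains its maximum at an endpoint, so the coordinates
  can be pushed to endpoints one after another without decreasing \<open>F\<close>.\<close>

lemma affine_box_vertex:
  fixes F :: "('i \<Rightarrow> real) \<Rightarrow> real"
  assumes "finite I" and aff: "\<And>x p. p \<in> I \<Longrightarrow> \<exists>\<alpha> \<beta>. \<forall>s. F (x(p := s)) = \<alpha> + \<beta> * s"
    and "\<And>p. p \<in> I \<Longrightarrow> lo p \<le> x p \<and> x p \<le> hi p"
  shows "\<exists>y. (\<forall>p\<in>I. y p \<in> {lo p, hi p}) \<and> (\<forall>p. p \<notin> I \<longrightarrow> y p = x p) \<and> F x \<le> F y"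
  using assms
proof (induction I rule: finite_induct)
  case (insert p I)
  obtain y where y: "\<forall>q\<in>I. y q \<in> {lo q, hi q}" "\<forall>q. q \<notin> I \<longrightarrow> y q = x q" "F x \<le> F y"
    using insert.IH insert.prems by (metis insertCI)
  obtain \<alpha> \<beta> where ab: "\<And>s. F (y(p := s)) = \<alpha> + \<beta> * s" using insert.prems(1)[of p y] by blast
  have yp: "y p = x p" using y(2) insert.hyps by simp
  define t where "t = (if \<beta> \<ge> 0 then hi p else lo p)"
  have "\<beta> * x p \<le> \<beta> * t"
    using insert.prems(2)[of p] by (auto simp: t_def intro: mult_left_mono mult_left_mono_neg)
  then have "F (y(p := y p)) \<le> F (y(p := t))" unfolding ab yp by simp
  then have "F x \<le> F (y(p := t))" using y(3) by simp
  moreover have "\<forall>q\<in>insert p I. (y(p := t)) q \<in> {lo q, hi q}" "\<forall>q. q \<notin> insert p I \<longrightarrow> (y(p := t)) q = x q"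
    using y(1,2) insert.hyps by (auto simp: t_def)
  ultimately show ?case by blast
qed auto

section \<open>The lattice net\<close>

definition gidx :: "nat \<Rightarrow> (nat \<Rightarrow> nat) \<Rightarrow> (nat \<times> nat) set" where
  "gidx k d = (SIGMA j:{1..k}. {1..d j})"

text \<open>Integer coordinates in units of the mesh; the bound \<open>4 * int (d j)\<close> says
  that the scaled vector has squared norm at most 4. The surrounding cube supplies the finite
  product set over which the counting sum factorizes.\<close>

definition lattice_net :: "nat \<Rightarrow> (nat \<Rightarrow> nat) \<Rightarrow> (nat \<times> nat \<Rightarrow> int) set" where
  "lattice_net k d = {z \<in> PiE (gidx k d) (\<lambda>_. {- int (4 * (\<Sum>j=1..k. d j))..int (4 * (\<Sum>j=1..k. d j))}).
     \<forall>j\<in>{1..k}. (\<Sum>i=1..d j. (z (j, i))\<^sup>2) \<le> 4 * int (d j)}"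

definition lattice_vec :: "(nat \<Rightarrow> nat) \<Rightarrow> (nat \<times> nat \<Rightarrow> int) \<Rightarrow> nat \<Rightarrow> vect" where
  "lattice_vec d z j i = real_of_int (z (j, i)) / sqrt (real (d j))"

lemma finite_gidx [simp]: "finite (gidx k d)" by (simp add: gidx_def)

lemma card_gidx: "card (gidx k d) = (\<Sum>j=1..k. d j)" by (simp add: gidx_def)

lemma finite_lattice_net [simp]: "finite (lattice_net k d)"
  unfolding lattice_net_def by (rule finite_subset[of _ "PiE (gidx k d) (\<lambda>_. {- int (4 * (\<Sum>j=1..k. d j))..int (4 * (\<Sum>j=1..k. d j))})"])
    (auto intro!: finite_PiE)

text \<open>Comparison with a geometric series, as exp (-n^2) is at most 2^(-n). The subtracted
  remainder makes the induction close on a bound that is uniform in n.\<close>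

lemma sum_exp_square_le: "(\<Sum>t\<in>{- int n..int n}. exp (- (real_of_int t)\<^sup>2)) \<le> 3 - 2 * (1 / 2) ^ n"
proof (induction n)
  case (Suc n)
  have "{- int (Suc n)..int (Suc n)} = insert (- int (Suc n)) (insert (int (Suc n)) {- int n..int n})" by auto
  then have "(\<Sum>t\<in>{- int (Suc n)..int (Suc n)}. exp (- (real_of_int t)\<^sup>2))
     = 2 * exp (- (real (Suc n))\<^sup>2) + (\<Sum>t\<in>{- int n..int n}. exp (- (real_of_int t)\<^sup>2))"
    by (simp del: of_nat_Suc)
  also have "exp (- (real (Suc n))\<^sup>2) \<le> (1 / 2) ^ Suc n"
  proof -
    have "exp (- (real (Suc n))\<^sup>2) \<le> exp (- real (Suc n))"
      using self_le_power[of "real (Suc n)" 2] by (simp del: of_nat_Suc)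
    also have "\<dots> = exp (- 1) ^ Suc n" using exp_of_nat_mult[of "Suc n" "- 1 :: real"] by simp
    also have "\<dots> \<le> (1 / 2) ^ Suc n"
    proof (rule power_mono)
      show "exp (- 1) \<le> (1 / 2 :: real)" using exp_ge_add_one_self[of 1] by (simp add: exp_minus field_simps)
    qed simp
    finally show ?thesis .
  qed
  finally show ?case using Suc.IH by simp
qed simp

text \<open>Lattice points in a ball are counted by Gaussian weights. With s the sum of the
  dimensions, each net point has weight exp (4 s - |z|^2) at least 1, and the total weight over the
  cube factorizes into at most exp (4 s) times 3^s.\<close>

lemma card_lattice_net: "real (card (lattice_net k d)) \<le> exp (6 * real (\<Sum>j=1..k. d j))"
proof -
  define s where "s = (\<Sum>j=1..k. d j)"
  let ?I = "gidx k d" and ?B = "{- int (4 * s)..int (4 * s)}"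
  have sq: "(\<Sum>p\<in>?I. (real_of_int (z p))\<^sup>2) \<le> 4 * real s" if "z \<in> lattice_net k d" for z
  proof -
    have "(\<Sum>p\<in>?I. (real_of_int (z p))\<^sup>2) = real_of_int (\<Sum>j=1..k. \<Sum>i=1..d j. (z (j, i))\<^sup>2)"
      by (simp add: gidx_def sum.Sigma case_prod_unfold)
    also have "\<dots> \<le> real_of_int (\<Sum>j=1..k. 4 * int (d j))"
      using that unfolding lattice_net_def of_int_le_iff by (intro sum_mono) auto
    also have "\<dots> = 4 * real s" by (simp add: s_def sum_distrib_left[symmetric])
    finally show ?thesis .
  qed
  have "real (card (lattice_net k d)) = (\<Sum>z\<in>lattice_net k d. 1)" by simp
  also have "\<dots> \<le> (\<Sum>z\<in>lattice_net k d. exp (4 * real s - (\<Sum>p\<in>?I. (real_of_int (z p))\<^sup>2)))"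
    using sq by (intro sum_mono) auto
  also have "\<dots> \<le> (\<Sum>z\<in>PiE ?I (\<lambda>_. ?B). exp (4 * real s - (\<Sum>p\<in>?I. (real_of_int (z p))\<^sup>2)))"
    by (intro sum_mono2) (auto simp: lattice_net_def s_def intro!: finite_PiE)
  also have "\<dots> = exp (4 * real s) * (\<Sum>z\<in>PiE ?I (\<lambda>_. ?B). \<Prod>p\<in>?I. exp (- (real_of_int (z p))\<^sup>2))"
    by (simp add: exp_diff exp_sum sum_distrib_left exp_minus prod_inversef[symmetric] divide_inverse)
  also have "\<dots> = exp (4 * real s) * (\<Prod>p\<in>?I. \<Sum>t\<in>?B. exp (- (real_of_int t)\<^sup>2))" by (subst prod_sum_PiE) auto
  also have "\<dots> \<le> exp (4 * real s) * (\<Prod>p\<in>?I. exp 2)"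
  proof (intro mult_left_mono prod_mono conjI sum_nonneg)
    have "(\<Sum>t\<in>?B. exp (- (real_of_int t)\<^sup>2)) \<le> 3 - 2 * (1 / 2) ^ (4 * s)" by (rule sum_exp_square_le)
    also have "\<dots> \<le> 3" by simp
    also have "\<dots> \<le> exp (2 :: real)" using exp_ge_add_one_self[of 2] by simp
    finally show "(\<Sum>t\<in>?B. exp (- (real_of_int t)\<^sup>2)) \<le> exp 2" .
  qed auto
  also have "\<dots> = exp (6 * real s)"
    unfolding prod_constant card_gidx s_def[symmetric] by (simp add: exp_of_nat_mult[symmetric] exp_add[symmetric])
  finally show ?thesis by (simp add: s_def)
qed

lemma le_sum_of_member:
  fixes f :: "nat \<Rightarrow> nat"
  shows "j \<in> {1..k} \<Longrightarrow> f j \<le> (\<Sum>j=1..k. f j)" by (rule member_le_sum) auto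

lemma floor_scaled_bounds:
  fixes h :: real
  assumes "h > 0"
  shows "h * of_int \<lfloor>u / h\<rfloor> \<le> u \<and> u \<le> h * of_int \<lfloor>u / h\<rfloor> + h"
proof -
  have "of_int \<lfloor>u / h\<rfloor> \<le> u / h" "u / h \<le> of_int \<lfloor>u / h\<rfloor> + 1" by linarith+
  then show ?thesis using assms by (simp only: pos_le_divide_eq pos_divide_le_eq) (simp add: algebra_simps)
qed

text \<open>\<open>affine_box_vertex\<close> moves every coordinate to a neighbouring lattice point
  without decreasing the form. A move has length at most the mesh, which is below
  \<open>\<delta> j\<close>, so sup norms at most double, and the squared norm is at most twice that
  of \<open>u j\<close> plus 2.\<close>

lemma lattice_rounding:
  assumes d: "\<And>j. j \<in> {1..k} \<Longrightarrow> d j \<ge> 1"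
    and \<delta>: "\<And>j. j \<in> {1..k} \<Longrightarrow> 1 / sqrt (real (d j)) \<le> \<delta> j"
    and u: "incoherent k d \<delta> j1 j2 u"
  shows "\<exists>z\<in>lattice_net k d. (\<forall>j\<in>{1..k} - {j1, j2}. \<forall>i\<in>{1..d j}. \<bar>lattice_vec d z j i\<bar> \<le> 2 * \<delta> j) \<and>
    mform k d X u \<le> mform k d X (lattice_vec d z)"
proof -
  let ?h = "\<lambda>j. 1 / sqrt (real (d j))"
  define x where "x = (\<lambda>(j, i). u j i)"
  define lo where "lo = (\<lambda>(j, i). ?h j * real_of_int \<lfloor>u j i / ?h j\<rfloor>)"
  define hi where "hi = (\<lambda>(j, i). lo (j, i) + ?h j)"
  have hpos: "?h j > 0" if "j \<in> {1..k}" for j using d[OF that] by simp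
  have bounds: "lo p \<le> x p \<and> x p \<le> hi p" if p: "p \<in> gidx k d" for p
  proof -
    obtain j i where p': "p = (j, i)" "j \<in> {1..k}" using p by (auto simp: gidx_def)
    show ?thesis
      using floor_scaled_bounds[OF hpos[OF p'(2)], of "u j i"] unfolding p' x_def lo_def hi_def prod.case by blast
  qed
  let ?F = "\<lambda>x. mform k d X (\<lambda>j i. x (j, i))"
  have "\<exists>y. (\<forall>p\<in>gidx k d. y p \<in> {lo p, hi p}) \<and> (\<forall>p. p \<notin> gidx k d \<longrightarrow> y p = x p) \<and> ?F x \<le> ?F y"
  proof (rule affine_box_vertex)
    fix y :: "nat \<times> nat \<Rightarrow> real" and p assume "p \<in> gidx k d"
    then show "\<exists>\<alpha> \<beta>. \<forall>s. ?F (y(p := s)) = \<alpha> + \<beta> * s"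
      using mform_affine[of "fst p" k d X y "snd p"] by (auto simp: gidx_def)
  qed (use bounds in auto)
  then obtain y where y: "\<And>p. p \<in> gidx k d \<Longrightarrow> y p \<in> {lo p, hi p}" and Fy: "?F x \<le> ?F y" by blast
  define z where "z = (\<lambda>p\<in>gidx k d. if y p = lo p then \<lfloor>u (fst p) (snd p) / ?h (fst p)\<rfloor> else \<lfloor>u (fst p) (snd p) / ?h (fst p)\<rfloor> + 1)"
  have zy: "lattice_vec d z j i = y (j, i)" if "j \<in> {1..k}" "i \<in> {1..d j}" for j i
  proof -
    have p: "(j, i) \<in> gidx k d" using that by (simp add: gidx_def)
    show ?thesis using y[OF p] p by (auto simp: lattice_vec_def z_def lo_def hi_def add_divide_distrib)
  qed
  have near: "\<bar>y (j, i) - u j i\<bar> \<le> ?h j" if "j \<in> {1..k}" "i \<in> {1..d j}" for j i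
  proof -
    have p: "(j, i) \<in> gidx k d" using that by (simp add: gidx_def)
    have "y (j, i) = lo (j, i) \<or> y (j, i) = lo (j, i) + ?h j" using y[OF p] by (auto simp: hi_def)
    moreover have "lo (j, i) \<le> u j i" "u j i \<le> lo (j, i) + ?h j"
      using bounds[OF p] by (auto simp: x_def hi_def)
    ultimately show ?thesis using hpos[OF that(1)] by linarith
  qed
  have ysq: "(\<Sum>i=1..d j. (y (j, i))\<^sup>2) \<le> 4" if j: "j \<in> {1..k}" for j
  proof -
    have "(y (j, i))\<^sup>2 \<le> 2 * (u j i)\<^sup>2 + 2 * (?h j)\<^sup>2" if "i \<in> {1..d j}" for i
    proof -
      have "(y (j, i) - u j i)\<^sup>2 \<le> (?h j)\<^sup>2" using power_mono[OF near[OF j that], of 2] by simp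
      moreover have "(y (j, i))\<^sup>2 \<le> 2 * (u j i)\<^sup>2 + 2 * (y (j, i) - u j i)\<^sup>2"
      proof -
        have "2 * (u j i)\<^sup>2 + 2 * (y (j, i) - u j i)\<^sup>2 - (y (j, i))\<^sup>2 = (y (j, i) - 2 * u j i)\<^sup>2"
          by (simp add: power2_eq_square algebra_simps)
        then show ?thesis using zero_le_power2[of "y (j, i) - 2 * u j i"] by linarith
      qed
      ultimately show ?thesis by linarith
    qed
    then have "(\<Sum>i=1..d j. (y (j, i))\<^sup>2) \<le> (\<Sum>i=1..d j. 2 * (u j i)\<^sup>2 + 2 * (?h j)\<^sup>2)" by (intro sum_mono)
    also have "\<dots> = 2 * (\<Sum>i=1..d j. (u j i)\<^sup>2) + 2"
      using d[OF j] by (simp add: sum.distrib sum_distrib_left power_divide)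
    also have "\<dots> \<le> 4" using u j by (auto simp: incoherent_def)
    finally show ?thesis .
  qed
  have zsq: "(\<Sum>i=1..d j. (z (j, i))\<^sup>2) \<le> 4 * int (d j)" if j: "j \<in> {1..k}" for j
  proof -
    have "real_of_int (\<Sum>i=1..d j. (z (j, i))\<^sup>2) = real (d j) * (\<Sum>i=1..d j. (y (j, i))\<^sup>2)"
      unfolding of_int_sum sum_distrib_left
    proof (rule sum.cong)
      fix i assume i: "i \<in> {1..d j}"
      show "real_of_int ((z (j, i))\<^sup>2) = real (d j) * (y (j, i))\<^sup>2"
        using d[OF j] by (simp add: zy[OF j i, symmetric] lattice_vec_def power_divide)
    qed simp
    also have "\<dots> \<le> real (d j) * 4" using ysq[OF j] by (intro mult_left_mono) auto
    finally have "real_of_int (\<Sum>i=1..d j. (z (j, i))\<^sup>2) \<le> real_of_int (4 * int (d j))" by simp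
    then show ?thesis unfolding of_int_le_iff .
  qed
  have "z \<in> lattice_net k d"
  proof -
    have "\<bar>z (j, i)\<bar> \<le> int (4 * (\<Sum>j=1..k. d j))" if "j \<in> {1..k}" "i \<in> {1..d j}" for j i
    proof -
      have "(z (j, i))\<^sup>2 \<le> (\<Sum>i=1..d j. (z (j, i))\<^sup>2)" using that by (intro member_le_sum) auto
      also have "\<dots> \<le> 4 * int (d j)" using zsq that by blast
      also have "\<dots> \<le> int (4 * (\<Sum>j=1..k. d j))" using le_sum_of_member[OF that(1), of d] by linarith
      finally have "(z (j, i))\<^sup>2 \<le> int (4 * (\<Sum>j=1..k. d j))" .
      moreover have "\<bar>z (j, i)\<bar> \<le> (z (j, i))\<^sup>2"
      proof (cases "z (j, i) = 0")
        case False
        then have "\<bar>z (j, i)\<bar> * 1 \<le> \<bar>z (j, i)\<bar> * \<bar>z (j, i)\<bar>" by (intro mult_left_mono) auto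
        then show ?thesis by (simp add: power2_eq_square)
      qed simp
      ultimately show ?thesis by linarith
    qed
    then have "z p \<in> {- int (4 * (\<Sum>j=1..k. d j))..int (4 * (\<Sum>j=1..k. d j))}" if "p \<in> gidx k d" for p
      using that unfolding gidx_def atLeastAtMost_iff abs_le_iff by (cases p) (simp add: minus_le_iff)
    moreover have "z \<in> extensional (gidx k d)" by (simp add: z_def)
    ultimately have "z \<in> PiE (gidx k d) (\<lambda>_. {- int (4 * (\<Sum>j=1..k. d j))..int (4 * (\<Sum>j=1..k. d j))})"
      by (intro PiE_I) (auto simp: extensional_def)
    then show ?thesis using zsq unfolding lattice_net_def by blast
  qed
  moreover have "\<bar>lattice_vec d z j i\<bar> \<le> 2 * \<delta> j" if "j \<in> {1..k} - {j1, j2}" "i \<in> {1..d j}" for j i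
  proof -
    have "\<bar>u j i\<bar> \<le> \<delta> j" using u that by (auto simp: incoherent_def)
    then show ?thesis using near[of j i] zy[of j i] \<delta>[of j] that by auto
  qed
  moreover have "mform k d X u \<le> mform k d X (lattice_vec d z)"
  proof -
    have "mform k d X (lattice_vec d z) = ?F y" by (rule mform_cong) (use zy in auto)
    then show ?thesis using Fy by (simp add: x_def)
  qed
  ultimately show ?thesis by blast
qed

declare One_nat_def [simp del]

subsection \<open>Incoherent norms\<close>

text \<open>\<open>\<delta>_ge\<close> is the trace of the coherence condition (see
  \<open>\<sigma>_ge_1\<close>). It makes flat vectors admissible and keeps the lattice mesh below
  the incoherence level.\<close>

locale tensor_shape =
  fixes k :: nat and d :: "nat \<Rightarrow> nat" and \<delta> :: "nat \<Rightarrow> real"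
  assumes k2: "2 \<le> k"
    and dpos: "\<And>j. j \<in> {1..k} \<Longrightarrow> 1 \<le> d j"
    and \<delta>_ge: "\<And>j. j \<in> {1..k} \<Longrightarrow> 1 / sqrt (real (d j)) \<le> \<delta> j"
begin

abbreviation "G \<equiv> grid k d"
abbreviation "N \<equiv> real (card G)"
abbreviation "form \<equiv> mform k d"
abbreviation "circ \<equiv> circ_norm k d \<delta>"

lemma \<delta>_pos: "j \<in> {1..k} \<Longrightarrow> 0 < \<delta> j"
proof -
  assume j: "j \<in> {1..k}"
  have "0 < 1 / sqrt (real (d j))" using dpos[OF j] by simp
  then show ?thesis using \<delta>_ge[OF j] by linarith
qed

lemma N_eq: "N = (\<Prod>j=1..k. real (d j))" by (simp add: card_grid)

lemma N_ge_1: "1 \<le> N" unfolding N_eq by (intro prod_ge_1) (use dpos in auto)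

lemma grid_nonempty: "G \<noteq> {}" using N_ge_1 by auto

lemma mem_incoh_iff: "Y \<in> incoh k d \<delta> \<longleftrightarrow> (\<exists>j1 j2 u. 1 \<le> j1 \<and> j1 < j2 \<and> j2 \<le> k \<and>
   (\<forall>j\<in>{1..k}. u j \<in> vecs (d j)) \<and> incoherent k d \<delta> j1 j2 u \<and> Y = rank_one k d u)"
proof -
  have linf: "linf (d j) v \<le> e \<longleftrightarrow> (\<forall>i\<in>{1..d j}. \<bar>v i\<bar> \<le> e)" if "j \<in> {1..k}" for j v e
    unfolding linf_def using dpos[OF that] by (subst Max_le_iff) auto
  have l2: "L2_set v A \<le> 1 \<longleftrightarrow> (\<Sum>i\<in>A. (v i)\<^sup>2) \<le> 1" for v :: vect and A by (simp add: L2_set_def)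
  have "Y \<in> incoh_at k d \<delta> j1 j2 \<longleftrightarrow> (\<exists>u. (\<forall>j\<in>{1..k}. u j \<in> vecs (d j)) \<and> incoherent k d \<delta> j1 j2 u \<and> Y = rank_one k d u)"
    for j1 j2 unfolding incoh_at_def incoherent_def using linf by (auto simp: l2)
  then show ?thesis unfolding incoh_def by auto
qed

lemma incoh_nonempty: "incoh k d \<delta> \<noteq> {}"
proof -
  have "incoherent k d \<delta> 1 2 (\<lambda>_ _. 0)" using \<delta>_pos by (auto simp: incoherent_def intro: less_imp_le)
  then have "rank_one k d (\<lambda>_ _. 0) \<in> incoh k d \<delta>"
    unfolding mem_incoh_iff using k2 by (intro exI[of _ 1] exI[of _ 2] exI[of _ "\<lambda>_ _. 0"]) (auto simp: vecs_def)
  then show ?thesis by auto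
qed

lemma circ_le:
  assumes "\<And>j1 j2 u. 1 \<le> j1 \<Longrightarrow> j1 < j2 \<Longrightarrow> j2 \<le> k \<Longrightarrow> (\<And>j. j \<in> {1..k} \<Longrightarrow> u j \<in> vecs (d j)) \<Longrightarrow>
    incoherent k d \<delta> j1 j2 u \<Longrightarrow> form X u \<le> t"
  shows "circ X \<le> t" unfolding circ_norm_def
proof (rule cSUP_least[OF incoh_nonempty])
  fix Y assume "Y \<in> incoh k d \<delta>"
  then obtain j1 j2 u where u: "1 \<le> j1" "j1 < j2" "j2 \<le> k" "\<forall>j\<in>{1..k}. u j \<in> vecs (d j)" "incoherent k d \<delta> j1 j2 u"
    and Y: "Y = rank_one k d u" unfolding mem_incoh_iff by blast
  show "tinner k d Y X \<le> t" unfolding Y tinner_rank_one by (rule assms[OF u(1-3) _ u(5)]) (use u(4) in blast)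
qed

lemma le_circ:
  assumes "1 \<le> j1" "j1 < j2" "j2 \<le> k" and u: "incoherent k d \<delta> j1 j2 u"
  shows "form X u \<le> circ X"
proof -
  \<comment> \<open>Truncation to the index ranges, since elements of \<open>incoh\<close> are built
    from factors in \<open>vecs\<close>; the form does not notice it.\<close>
  define v where "v = (\<lambda>j i. if i \<in> {1..d j} then u j i else 0)"
  have v: "incoherent k d \<delta> j1 j2 v" using u by (simp add: incoherent_def v_def)
  have "bdd_above ((\<lambda>Y. tinner k d Y X) ` incoh k d \<delta>)"
  proof (rule bdd_aboveI2)
    fix Y assume "Y \<in> incoh k d \<delta>"
    then obtain j1 j2 w where w: "incoherent k d \<delta> j1 j2 w" and Y: "Y = rank_one k d w"
      unfolding mem_incoh_iff by blast
    have "\<bar>form X w\<bar> \<le> (\<Sum>a\<in>G. \<bar>X a\<bar>)" using incoherent_abs_le_one[OF w] by (rule mform_abs_le)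
    then show "tinner k d Y X \<le> (\<Sum>a\<in>G. \<bar>X a\<bar>)" unfolding Y tinner_rank_one by linarith
  qed
  moreover have "rank_one k d v \<in> incoh k d \<delta>"
  proof -
    have "\<forall>j\<in>{1..k}. v j \<in> vecs (d j)" by (simp add: v_def vecs_def)
    then show ?thesis unfolding mem_incoh_iff using assms(1-3) v by blast
  qed
  ultimately have "tinner k d (rank_one k d v) X \<le> circ X" unfolding circ_norm_def by (intro cSUP_upper)
  moreover have "form X v = form X u" by (rule mform_cong) (auto simp: v_def)
  ultimately show ?thesis by (simp add: tinner_rank_one)
qed

lemma abs_form_le_circ:
  assumes "1 \<le> j1" "j1 < j2" "j2 \<le> k" and u: "incoherent k d \<delta> j1 j2 u"
  shows "\<bar>form X u\<bar> \<le> circ X"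
proof -
  \<comment> \<open>Negating a single factor negates the form and preserves incoherence.\<close>
  define c where "c = (\<lambda>j::nat. if j = 1 then - 1 else 1 :: real)"
  have c2: "\<And>j. (c j)\<^sup>2 = 1" "\<And>j. \<bar>c j\<bar> = 1" by (auto simp: c_def)
  have "incoherent k d \<delta> j1 j2 (\<lambda>j i. c j * u j i)"
    using u by (simp add: incoherent_def power_mult_distrib c2 abs_mult)
  then have "form X (\<lambda>j i. c j * u j i) \<le> circ X" by (rule le_circ[OF assms(1-3)])
  moreover have "form X (\<lambda>j i. c j * u j i) = - form X u"
    unfolding mform_scale using k2 by (simp add: c_def prod.delta)
  ultimately show ?thesis using le_circ[OF assms, of X] by linarith
qed

text \<open>Every factor is rescaled by its own \<open>c j\<close>; a vanishing \<open>c j\<close>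
  forces the factor, hence the form, to vanish. Weights that vary with the mode are what allows
  \<open>circ_dual_sum_le_one\<close> to exploit several small factors at once.\<close>

lemma abs_form_le_scaled_circ:
  assumes j: "1 \<le> j1" "j1 < j2" "j2 \<le> k"
    and c: "\<And>j. j \<in> {1..k} \<Longrightarrow> 0 \<le> c j"
    and sq: "\<And>j. j \<in> {1..k} \<Longrightarrow> (\<Sum>i=1..d j. (u j i)\<^sup>2) \<le> (c j)\<^sup>2"
    and bd: "\<And>j i. j \<in> {1..k} \<Longrightarrow> j \<noteq> j1 \<Longrightarrow> j \<noteq> j2 \<Longrightarrow> i \<in> {1..d j} \<Longrightarrow> \<bar>u j i\<bar> \<le> c j * \<delta> j"
  shows "\<bar>form X u\<bar> \<le> (\<Prod>j=1..k. c j) * circ X"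
proof (cases "\<exists>j\<in>{1..k}. c j = 0")
  case True
  then obtain j where j0: "j \<in> {1..k}" "c j = 0" by blast
  then have "(\<Sum>i=1..d j. (u j i)\<^sup>2) \<le> 0" using sq by fastforce
  then have "(\<Sum>i=1..d j. (u j i)\<^sup>2) = 0" by (simp add: sum_nonneg antisym)
  then have "form X u = 0" by (intro mform_eq_0[OF j0(1)]) (simp add: sum_nonneg_eq_0_iff)
  moreover have "(\<Prod>j=1..k. c j) = 0" using j0 by (intro prod_zero) auto
  ultimately show ?thesis by (simp only: abs_zero mult_zero_left order.refl)
next
  case False
  then have cpos: "0 < c j" if "j \<in> {1..k}" for j using c[OF that] that by fastforce
  have "incoherent k d \<delta> j1 j2 (\<lambda>j i. u j i / c j)" unfolding incoherent_def
  proof (intro conjI ballI)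
    fix j assume "j \<in> {1..k}"
    then show "(\<Sum>i=1..d j. (u j i / c j)\<^sup>2) \<le> 1"
      using sq[of j] cpos[of j] by (simp add: power_divide sum_divide_distrib[symmetric])
  next
    fix j i assume "j \<in> {1..k} - {j1, j2}" "i \<in> {1..d j}"
    then show "\<bar>u j i / c j\<bar> \<le> \<delta> j"
      using bd[of j i] cpos[of j] by (simp add: abs_divide pos_divide_le_eq mult.commute)
  qed
  from abs_form_le_circ[OF j this, of X] have "\<bar>form X (\<lambda>j i. u j i / c j)\<bar> \<le> circ X" .
  moreover have "form X u = (\<Prod>j=1..k. c j) * form X (\<lambda>j i. u j i / c j)"
    unfolding mform_scale[symmetric] by (rule mform_cong) (simp_all add: less_imp_neq[OF cpos, symmetric])
  moreover have "0 < (\<Prod>j=1..k. c j)" using cpos by (intro prod_pos) auto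
  ultimately show ?thesis by (simp add: abs_mult)
qed

lemma circ_nonneg: "0 \<le> circ X"
proof -
  have "incoherent k d \<delta> 1 2 (\<lambda>_ _. 0)" using \<delta>_pos by (auto simp: incoherent_def intro: less_imp_le)
  then have "\<bar>form X (\<lambda>_ _. 0)\<bar> \<le> circ X" using k2 by (intro abs_form_le_circ) auto
  then show ?thesis by linarith
qed

lemma circ_zero [simp]: "circ 0 = 0"
proof (rule antisym)
  show "circ 0 \<le> 0" by (rule circ_le) simp
  show "0 \<le> circ 0" by (rule circ_nonneg)
qed

lemma circ_add: "circ (X + Y) \<le> circ X + circ Y"
proof (rule circ_le)
  fix j1 j2 u assume "1 \<le> j1" "j1 < j2" "j2 \<le> k" "incoherent k d \<delta> j1 j2 u"
  then show "form (X + Y) u \<le> circ X + circ Y" unfolding mform_add by (intro add_mono le_circ)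
qed

lemma circ_scale: "circ (c *\<^sub>R X) \<le> \<bar>c\<bar> * circ X"
proof (rule circ_le)
  fix j1 j2 u assume "1 \<le> j1" "j1 < j2" "j2 \<le> k" "incoherent k d \<delta> j1 j2 u"
  then have "\<bar>form X u\<bar> \<le> circ X" by (rule abs_form_le_circ)
  then have "\<bar>c\<bar> * \<bar>form X u\<bar> \<le> \<bar>c\<bar> * circ X" by (intro mult_left_mono) auto
  then show "form (c *\<^sub>R X) u \<le> \<bar>c\<bar> * circ X"
    unfolding mform_scaleR using abs_ge_self[of "c * form X u"] by (simp add: abs_mult)
qed

lemma circ_le_sum_abs: "circ X \<le> (\<Sum>a\<in>G. \<bar>X a\<bar>)"
proof (rule circ_le)
  fix j1 j2 u assume "incoherent k d \<delta> j1 j2 u"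
  then have "\<bar>form X u\<bar> \<le> (\<Sum>a\<in>G. \<bar>X a\<bar>)" by (intro mform_abs_le) (rule incoherent_abs_le_one)
  then show "form X u \<le> (\<Sum>a\<in>G. \<bar>X a\<bar>)" by linarith
qed

text \<open>Unit vectors may violate the sup bound, but divided by \<open>sqrt (real (d j))\<close>
  they satisfy it by \<open>\<delta>_ge\<close>. The loss is polynomial, which is enough to bound
  the dual ball in \<open>le_star\<close> and the entries of the dual tensor.\<close>

lemma entry_le_circ:
  assumes a: "a \<in> G"
  shows "\<bar>X a\<bar> \<le> N * circ X"
proof -
  let ?u = "\<lambda>j i. 1 / sqrt (real (d j)) * unitv (a j) i"
  have "incoherent k d \<delta> 1 2 ?u" unfolding incoherent_def
  proof (intro conjI ballI)
    fix j assume j: "j \<in> {1..k}"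
    have "(\<Sum>i=1..d j. (?u j i)\<^sup>2) = (\<Sum>i=1..d j. if i = a j then 1 / real (d j) else 0)"
      by (intro sum.cong) (auto simp: unitv_def power_divide)
    also have "\<dots> \<le> 1" using gridD[OF a j] dpos[OF j] by simp
    finally show "(\<Sum>i=1..d j. (?u j i)\<^sup>2) \<le> 1" .
  next
    fix j i assume "j \<in> {1..k} - {1, 2}"
    then show "\<bar>?u j i\<bar> \<le> \<delta> j" using \<delta>_ge[of j] \<delta>_pos[of j] by (auto simp: unitv_def)
  qed
  from abs_form_le_circ[OF _ _ _ this, of X] have "\<bar>form X ?u\<bar> \<le> circ X" using k2 by simp
  moreover have "form X ?u = (\<Prod>j=1..k. 1 / sqrt (real (d j))) * X a"
    unfolding mform_scale mform_unitv[OF a] ..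
  moreover have "(\<Prod>j=1..k. 1 / sqrt (real (d j))) = 1 / sqrt N"
  proof -
    have "(\<Prod>j\<in>A. 1 / sqrt (real (d j))) = 1 / sqrt (\<Prod>j\<in>A. real (d j))" for A
      by (induction A rule: infinite_finite_induct) (auto simp: real_sqrt_mult)
    then show ?thesis by (simp add: N_eq)
  qed
  ultimately have "\<bar>X a\<bar> \<le> sqrt N * circ X" using N_ge_1 by (simp add: abs_mult pos_divide_le_eq mult.commute)
  moreover have "sqrt N \<le> N" using N_ge_1 by (simp add: real_le_lsqrt power2_eq_square)
  moreover have "0 \<le> circ X" using \<open>\<bar>form X ?u\<bar> \<le> circ X\<close> by linarith
  ultimately show ?thesis using mult_right_mono[of "sqrt N" N "circ X"] by linarith
qed

lemma le_star:
  assumes "Y \<in> tensors k d" "circ Y \<le> 1"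
  shows "tinner k d Y X \<le> star_norm k d \<delta> X" unfolding star_norm_def
proof (rule cSUP_upper)
  show "bdd_above ((\<lambda>Y. tinner k d Y X) ` {Y \<in> tensors k d. circ Y \<le> 1})"
  proof (rule bdd_aboveI2)
    fix Y assume Y: "Y \<in> {Y \<in> tensors k d. circ Y \<le> 1}"
    have "Y a * X a \<le> N * \<bar>X a\<bar>" if "a \<in> G" for a
    proof -
      have "N * circ Y \<le> N * 1" using Y by (intro mult_left_mono) auto
      with entry_le_circ[OF that, of Y] have "\<bar>Y a\<bar> \<le> N" by simp
      then have "\<bar>Y a\<bar> * \<bar>X a\<bar> \<le> N * \<bar>X a\<bar>" by (intro mult_right_mono) auto
      then show ?thesis using abs_ge_self[of "Y a * X a"] by (simp add: abs_mult)
    qed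
    then show "tinner k d Y X \<le> (\<Sum>a\<in>G. N * \<bar>X a\<bar>)" unfolding tinner_def by (intro sum_mono)
  qed
qed (use assms in auto)

end

subsection \<open>Projections and dual certificates\<close>

text \<open>Orthogonal projections described by their algebra alone. \<open>P_incoherent\<close>
  makes projected factors satisfy the sup bound in every mode, including the two exempt
  ones.\<close>

locale tensor_proj = tensor_shape +
  fixes P :: "nat \<Rightarrow> vect \<Rightarrow> vect"
  assumes P_vecs: "\<And>j u. j \<in> {1..k} \<Longrightarrow> u \<in> vecs (d j) \<Longrightarrow> P j u \<in> vecs (d j)"
    and P_sym: "\<And>j u v. j \<in> {1..k} \<Longrightarrow> u \<in> vecs (d j) \<Longrightarrow> v \<in> vecs (d j) \<Longrightarrow>
      (\<Sum>i=1..d j. P j u i * v i) = (\<Sum>i=1..d j. u i * P j v i)"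
    and P_idem: "\<And>j u. j \<in> {1..k} \<Longrightarrow> u \<in> vecs (d j) \<Longrightarrow> P j (P j u) = P j u"
    and P_diff: "\<And>j u v. j \<in> {1..k} \<Longrightarrow> u \<in> vecs (d j) \<Longrightarrow> v \<in> vecs (d j) \<Longrightarrow> P j (u - v) = P j u - P j v"
    and P_incoherent: "\<And>j u i. j \<in> {1..k} \<Longrightarrow> u \<in> vecs (d j) \<Longrightarrow> i \<in> {1..d j} \<Longrightarrow>
      \<bar>P j u i\<bar> \<le> \<delta> j * sqrt (\<Sum>i=1..d j. (u i)\<^sup>2)"
begin

definition mix :: "nat set \<Rightarrow> (nat \<Rightarrow> vect) \<Rightarrow> nat \<Rightarrow> vect" where
  "mix S u j = (if j \<in> S then u j - P j (u j) else P j (u j))"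

text \<open>The maps \<open>QS S\<close> for \<open>S \<subseteq> {1..k}\<close> are mutually
  annihilating projections with sum the identity on tensors; S lists the modes in which the
  complement is taken.\<close>

definition QS :: "nat set \<Rightarrow> tensor \<Rightarrow> tensor" where
  "QS S = tensor_map k d (\<lambda>j. if j \<in> S then (\<lambda>u. u - P j u) else P j)"

definition Q :: "tensor \<Rightarrow> tensor" where
  "Q X = QS {} X + (\<Sum>j=1..k. QS {j} X)"

definition vfam :: "(nat \<Rightarrow> vect) \<Rightarrow> bool" where
  "vfam u \<longleftrightarrow> (\<forall>j\<in>{1..k}. u j \<in> vecs (d j))"

lemma vecs_diff: "u \<in> vecs m \<Longrightarrow> v \<in> vecs m \<Longrightarrow> u - v \<in> vecs m" by (simp add: vecs_def)

lemma vfam_mix: "vfam u \<Longrightarrow> vfam (mix S u)" by (simp add: vfam_def mix_def P_vecs vecs_diff)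

lemma unitv_vecs: "i \<in> {1..m} \<Longrightarrow> unitv i \<in> vecs m" by (auto simp: vecs_def unitv_def)

lemma vfam_unitv: "a \<in> G \<Longrightarrow> vfam (\<lambda>j. unitv (a j))" by (auto simp: vfam_def intro!: unitv_vecs dest: gridD)

lemma sum_unitv: "b \<in> {1..m} \<Longrightarrow> (\<Sum>i=1..m. unitv b i * f i) = f b" for f :: "nat \<Rightarrow> real"
proof -
  assume "b \<in> {1..m}"
  have "(\<Sum>i=1..m. unitv b i * f i) = (\<Sum>i=1..m. if i = b then f i else 0)"
    by (intro sum.cong) (auto simp: unitv_def)
  then show ?thesis using \<open>b \<in> {1..m}\<close> by simp
qed

lemma P_pythagoras:
  assumes "j \<in> {1..k}" "u \<in> vecs (d j)"
  shows "(\<Sum>i=1..d j. (P j u i)\<^sup>2) + (\<Sum>i=1..d j. (u i - P j u i)\<^sup>2) = (\<Sum>i=1..d j. (u i)\<^sup>2)"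
proof -
  have "(\<Sum>i=1..d j. P j u i * P j u i) = (\<Sum>i=1..d j. u i * P j u i)"
    using P_sym[OF assms P_vecs[OF assms]] by (simp add: P_idem[OF assms])
  moreover have "(\<Sum>i=1..d j. (u i - P j u i)\<^sup>2) = (\<Sum>i=1..d j. (u i)\<^sup>2) - 2 * (\<Sum>i=1..d j. u i * P j u i) + (\<Sum>i=1..d j. P j u i * P j u i)"
    unfolding sum_distrib_left sum_subtractf[symmetric] sum.distrib[symmetric]
    by (intro sum.cong) (simp_all add: power2_eq_square algebra_simps)
  ultimately show ?thesis by (simp add: power2_eq_square)
qed

text \<open>Symmetry of each \<open>P j\<close> moves the tensor map onto the factors. Identities
  between operators on tensors thereby become identities between families of vectors.\<close>

lemma form_QS:
  assumes u: "vfam u"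
  shows "form (QS S X) u = form X (mix S u)"
proof -
  let ?M = "\<lambda>j. if j \<in> S then (\<lambda>u. u - P j u) else P j"
  have inner: "(\<Sum>i=1..d j. ?M j (unitv b) i * u j i) = mix S u j b" if "j \<in> {1..k}" "b \<in> {1..d j}" for j b
  proof -
    have uj: "u j \<in> vecs (d j)" using u that by (simp add: vfam_def)
    have "(\<Sum>i=1..d j. P j (unitv b) i * u j i) = P j (u j) b"
      using P_sym[OF that(1) unitv_vecs[OF that(2)] uj] sum_unitv[OF that(2)] by simp
    moreover have "(\<Sum>i=1..d j. unitv b i * u j i) = u j b" by (rule sum_unitv[OF that(2)])
    ultimately show ?thesis by (simp add: mix_def left_diff_distrib sum_subtractf)
  qed
  have "form (rank_one k d (\<lambda>j. ?M j (unitv (b j)))) u = (\<Prod>j=1..k. mix S u j (b j))" if "b \<in> G" for b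
  proof -
    have "form (rank_one k d (\<lambda>j. ?M j (unitv (b j)))) u = (\<Sum>a\<in>G. \<Prod>j=1..k. ?M j (unitv (b j)) (a j) * u j (a j))"
      unfolding mform_def by (intro sum.cong) (auto simp: rank_one_def prod.distrib)
    also have "\<dots> = (\<Prod>j=1..k. \<Sum>i=1..d j. ?M j (unitv (b j)) i * u j i)" by (rule sum_grid_prod)
    also have "\<dots> = (\<Prod>j=1..k. mix S u j (b j))" using inner gridD[OF that] by (intro prod.cong) auto
    finally show ?thesis .
  qed
  then show ?thesis unfolding QS_def tensor_map_def mform_sum mform_scaleR by (simp add: mform_def[of k d X])
qed

lemma form_Q: "vfam u \<Longrightarrow> form (Q X) u = form X (mix {} u) + (\<Sum>j=1..k. form X (mix {j} u))"
  by (simp add: Q_def mform_add mform_sum form_QS)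

lemma tensors_add: "X \<in> tensors k d \<Longrightarrow> Y \<in> tensors k d \<Longrightarrow> X + Y \<in> tensors k d"
  and tensors_diff: "X \<in> tensors k d \<Longrightarrow> Y \<in> tensors k d \<Longrightarrow> X - Y \<in> tensors k d"
  and tensors_scale: "X \<in> tensors k d \<Longrightarrow> c *\<^sub>R X \<in> tensors k d" by (simp_all add: tensors_def scaleR_fun_def)

lemma tensors_sum: "(\<And>i. i \<in> A \<Longrightarrow> X i \<in> tensors k d) \<Longrightarrow> (\<Sum>i\<in>A. X i) \<in> tensors k d"
  by (simp add: tensors_def sum_fun_apply)

lemma QS_tensors: "QS S X \<in> tensors k d"
  unfolding QS_def tensor_map_def by (intro tensors_sum tensors_scale) (simp add: tensors_def rank_one_def)

lemma Q_tensors: "Q X \<in> tensors k d" unfolding Q_def by (intro tensors_add tensors_sum QS_tensors)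

text \<open>Unit vectors already read off all entries, so a tensor is determined by its multilinear
  form.\<close>

lemma tensor_eqI:
  assumes "X \<in> tensors k d" "Y \<in> tensors k d" "\<And>u. vfam u \<Longrightarrow> form X u = form Y u"
  shows "X = Y"
proof
  fix a
  show "X a = Y a"
  proof (cases "a \<in> G")
    case True
    then show ?thesis using assms(3)[OF vfam_unitv[OF True]] by (simp add: mform_unitv)
  qed (use assms in \<open>auto simp: tensors_def\<close>)
qed

text \<open>In a mode that belongs to only one of the two sets, a projection meets its complement
  and the factor vanishes.\<close>

lemma form_mix_mix:
  assumes u: "vfam u" and S: "S \<subseteq> {1..k}" "S' \<subseteq> {1..k}"
  shows "form X (mix S (mix S' u)) = (if S = S' then form X (mix S u) else 0)"
proof (cases "S = S'")
  case True
  have "mix S (mix S u) j = mix S u j" if "j \<in> {1..k}" for j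
    using u that by (simp add: vfam_def mix_def P_idem P_diff P_vecs)
  then show ?thesis using True by (auto intro!: mform_cong)
next
  case False
  then obtain j where j: "(j \<in> S) \<noteq> (j \<in> S')" by blast
  then have jk: "j \<in> {1..k}" using S by blast
  have "mix S (mix S' u) j = 0" using u j jk by (auto simp: vfam_def mix_def P_idem P_diff P_vecs)
  then have "form X (mix S (mix S' u)) = 0" by (intro mform_eq_0[OF jk]) auto
  then show ?thesis using False by simp
qed

lemma sum_singleton_eq:
  "l \<in> {1..k} \<Longrightarrow> (\<Sum>j=1..k. if {j} = {l} then f j else 0) = (f l :: real)" by simp

lemma Q_Q: "Q (Q X) = Q X"
proof (rule tensor_eqI[OF Q_tensors Q_tensors])
  fix u assume u: "vfam u"
  have 1: "form (Q X) (mix {} u) = form X (mix {} u)"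
    by (subst form_Q) (simp_all add: vfam_mix u form_mix_mix)
  have 2: "form (Q X) (mix {l} u) = form X (mix {l} u)" if "l \<in> {1..k}" for l
  proof -
    have "form (Q X) (mix {l} u) = form X (mix {} (mix {l} u)) + (\<Sum>j=1..k. form X (mix {j} (mix {l} u)))"
      by (rule form_Q[OF vfam_mix[OF u]])
    also have "(\<Sum>j=1..k. form X (mix {j} (mix {l} u))) = (\<Sum>j=1..k. if {j} = {l} then form X (mix {j} u) else 0)"
      using that by (intro sum.cong) (auto simp: form_mix_mix u)
    also have "\<dots> = form X (mix {l} u)" by (rule sum_singleton_eq[OF that])
    finally show ?thesis using that by (simp add: form_mix_mix u)
  qed
  show "form (Q (Q X)) u = form (Q X) u" by (simp add: form_Q[OF u, of "Q X"] 1 2) (simp add: form_Q[OF u])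
qed

lemma Q_eq_self_if_QS_empty:
  assumes Z: "Z \<in> tensors k d" "QS {} Z = Z"
  shows "Q Z = Z"
proof (rule tensor_eqI[OF Q_tensors Z(1)])
  fix u assume u: "vfam u"
  have *: "form Z (mix {l} u) = 0" if "l \<in> {1..k}" for l
  proof -
    have "form Z (mix {l} u) = form (QS {} Z) (mix {l} u)" using Z by simp
    also have "\<dots> = form Z (mix {} (mix {l} u))" by (rule form_QS[OF vfam_mix[OF u]])
    also have "\<dots> = 0" using that by (simp add: form_mix_mix u)
    finally show ?thesis .
  qed
  have "form Z (mix {} u) = form (QS {} Z) u" by (simp add: form_QS u)
  then show "form (Q Z) u = form Z u" using * Z(2) by (simp add: form_Q[OF u])
qed

lemma mix_unitv_sym:
  assumes "j \<in> {1..k}" "a j \<in> {1..d j}" "b j \<in> {1..d j}"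
  shows "mix S (\<lambda>j. unitv (a j)) j (b j) = mix S (\<lambda>j. unitv (b j)) j (a j)"
proof -
  have "P j (unitv (a j)) (b j) = P j (unitv (b j)) (a j)"
    using P_sym[OF assms(1) unitv_vecs[OF assms(2)] unitv_vecs[OF assms(3)]]
      sum_unitv[OF assms(2), of "P j (unitv (b j))"] sum_unitv[OF assms(3), of "P j (unitv (a j))"]
    by (simp add: mult.commute)
  then show ?thesis by (auto simp: mix_def unitv_def)
qed

lemma QS_apply: "a \<in> G \<Longrightarrow> QS S X a = (\<Sum>b\<in>G. X b * (\<Prod>j=1..k. mix S (\<lambda>j. unitv (a j)) j (b j)))"
  using form_QS[OF vfam_unitv, of a S X] by (simp add: mform_unitv mform_def[of k d X])

lemma QS_sym: "tinner k d (QS S X) Y = tinner k d X (QS S Y)"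
proof -
  have "tinner k d (QS S X) Y = (\<Sum>a\<in>G. \<Sum>b\<in>G. X b * Y a * (\<Prod>j=1..k. mix S (\<lambda>j. unitv (a j)) j (b j)))"
    unfolding tinner_def by (intro sum.cong) (auto simp: QS_apply sum_distrib_left sum_distrib_right mult_ac)
  also have "\<dots> = (\<Sum>b\<in>G. \<Sum>a\<in>G. X b * Y a * (\<Prod>j=1..k. mix S (\<lambda>j. unitv (a j)) j (b j)))" by (rule sum.swap)
  also have "\<dots> = (\<Sum>b\<in>G. \<Sum>a\<in>G. X b * Y a * (\<Prod>j=1..k. mix S (\<lambda>j. unitv (b j)) j (a j)))"
    by (intro sum.cong arg_cong2[of _ _ _ _ "(*)"] prod.cong refl mix_unitv_sym) (auto dest: gridD)
  also have "\<dots> = tinner k d X (QS S Y)"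
    unfolding tinner_def by (intro sum.cong) (auto simp: QS_apply sum_distrib_left sum_distrib_right mult_ac)
  finally show ?thesis .
qed

lemma tinner_sum_left: "tinner k d (\<Sum>i\<in>A. X i) Y = (\<Sum>i\<in>A. tinner k d (X i) Y)"
  unfolding tinner_def sum_fun_apply sum_distrib_right by (rule sum.swap)

lemma tinner_sum_right: "tinner k d Y (\<Sum>i\<in>A. X i) = (\<Sum>i\<in>A. tinner k d Y (X i))"
  unfolding tinner_commute[of k d Y] by (rule tinner_sum_left)

lemma Q_sym: "tinner k d (Q X) Y = tinner k d X (Q Y)"
  unfolding Q_def tinner_add_left tinner_add_right tinner_sum_left tinner_sum_right QS_sym ..

lemma Q_add: "Q (X + Y) = Q X + Q Y"
  by (rule tensor_eqI) (auto simp: Q_tensors tensors_add form_Q mform_add sum.distrib)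

lemma Q_diff: "Q (X - Y) = Q X - Q Y"
  by (rule tensor_eqI) (auto simp: Q_tensors tensors_diff form_Q mform_diff sum_subtractf)

lemma Q_scale: "Q (c *\<^sub>R X) = c *\<^sub>R Q X"
  by (rule tensor_eqI) (auto simp: Q_tensors tensors_scale form_Q mform_scaleR sum_distrib_left distrib_left)

lemma form_expand_mix: "form X u = (\<Sum>S\<in>Pow {1..k}. form X (mix S u))"
proof -
  have "form X u = (\<Sum>S\<in>Pow {1..k}. form X (\<lambda>j. if j \<in> S then u j - P j (u j) else P j (u j)))"
    by (rule mform_expand) simp
  then show ?thesis by (simp add: mix_def[abs_def])
qed

lemma form_Q_perp:
  assumes u: "vfam u"
  shows "form (X - Q X) u = (\<Sum>S | S \<subseteq> {1..k} \<and> 2 \<le> card S. form X (mix S u))"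
proof -
  let ?A = "insert {} ((\<lambda>j. {j}) ` {1..k})" and ?B = "{S. S \<subseteq> {1..k} \<and> 2 \<le> card S}"
  have "S \<in> ?A" if "S \<subseteq> {1..k}" "\<not> 2 \<le> card S" for S
  proof -
    have "finite S" using that(1) finite_subset by blast
    moreover have "card S = 0 \<or> card S = 1" using that(2) by linarith
    ultimately have "S = {} \<or> (\<exists>j. S = {j})" by (auto simp: card_1_singleton_iff One_nat_def)
    then show ?thesis using that(1) by blast
  qed
  moreover have "card S < 2" if "S \<in> ?A" for S using that by auto
  ultimately have split: "Pow {1..k} = ?A \<union> ?B" "?A \<inter> ?B = {}" by (auto 4 3)
  have fin: "finite ?B" by (rule finite_subset[of _ "Pow {1..k}"]) auto
  have "form X u = (\<Sum>S\<in>?A. form X (mix S u)) + (\<Sum>S\<in>?B. form X (mix S u))"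
    unfolding form_expand_mix[of X u] split(1) by (rule sum.union_disjoint) (use fin split in auto)
  also have "(\<Sum>S\<in>?A. form X (mix S u)) = form X (mix {} u) + (\<Sum>j=1..k. form X (mix {j} u))"
    by (subst sum.insert) (auto simp: sum.reindex)
  finally show ?thesis by (simp add: mform_diff form_Q u)
qed

section \<open>Incoherent norms and projections\<close>

lemma mix_bounds:
  assumes u: "vfam u" "incoherent k d \<delta> j1 j2 u" and j: "j \<in> {1..k}"
  shows "(\<Sum>i=1..d j. (P j (u j) i)\<^sup>2) + (\<Sum>i=1..d j. (u j i - P j (u j) i)\<^sup>2) \<le> 1"
    and "i \<in> {1..d j} \<Longrightarrow> \<bar>P j (u j) i\<bar> \<le> \<delta> j"
    and "i \<in> {1..d j} \<Longrightarrow> j \<noteq> j1 \<Longrightarrow> j \<noteq> j2 \<Longrightarrow> \<bar>u j i - P j (u j) i\<bar> \<le> 2 * \<delta> j"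
proof -
  have uj: "u j \<in> vecs (d j)" and le: "(\<Sum>i=1..d j. (u j i)\<^sup>2) \<le> 1"
    using u j by (auto simp: vfam_def incoherent_def)
  show "(\<Sum>i=1..d j. (P j (u j) i)\<^sup>2) + (\<Sum>i=1..d j. (u j i - P j (u j) i)\<^sup>2) \<le> 1"
    using P_pythagoras[OF j uj] le by simp
  show *: "\<bar>P j (u j) i\<bar> \<le> \<delta> j" if i: "i \<in> {1..d j}" for i
  proof -
    have "\<bar>P j (u j) i\<bar> \<le> \<delta> j * sqrt (\<Sum>i=1..d j. (u j i)\<^sup>2)" by (rule P_incoherent[OF j uj i])
    also have "\<dots> \<le> \<delta> j * 1" using le \<delta>_pos[OF j] by (intro mult_left_mono) auto
    finally show ?thesis by simp
  qed
  show "\<bar>u j i - P j (u j) i\<bar> \<le> 2 * \<delta> j" if i: "i \<in> {1..d j}" and "j \<noteq> j1" "j \<noteq> j2" for i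
  proof -
    have "\<bar>u j i\<bar> \<le> \<delta> j" using u(2) that j by (auto simp: incoherent_def)
    then show ?thesis using *[OF i] by linarith
  qed
qed

text \<open>The constant counts X itself, the fully projected term, and twice each of the k terms
  with one complementary factor, whose sup norm can reach \<open>2 * \<delta> j\<close>.\<close>

lemma circ_Q_perp_le: "circ (X - Q X) \<le> (2 + 2 * real k) * circ X"
proof (rule circ_le)
  fix j1 j2 u
  assume j: "1 \<le> j1" "j1 < j2" "j2 \<le> k" and "\<And>j. j \<in> {1..k} \<Longrightarrow> u j \<in> vecs (d j)"
    and inc: "incoherent k d \<delta> j1 j2 u"
  then have u: "vfam u" by (simp add: vfam_def)
  have *: "\<bar>form X (mix S u)\<bar> \<le> (\<Prod>j=1..k. if j \<in> S then 2 else 1) * circ X" for S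
  proof (rule abs_form_le_scaled_circ[OF j])
    fix j assume jk: "j \<in> {1..k}"
    note b = mix_bounds(1)[OF u inc jk]
    have "0 \<le> (\<Sum>i=1..d j. (P j (u j) i)\<^sup>2)" "0 \<le> (\<Sum>i=1..d j. (u j i - P j (u j) i)\<^sup>2)"
      by (auto intro: sum_nonneg)
    then show "(\<Sum>i=1..d j. (mix S u j i)\<^sup>2) \<le> (if j \<in> S then 2 else 1)\<^sup>2" using b by (simp add: mix_def)
    show "\<bar>mix S u j i\<bar> \<le> (if j \<in> S then 2 else 1) * \<delta> j" if "j \<noteq> j1" "j \<noteq> j2" "i \<in> {1..d j}" for i
      using mix_bounds(2,3)[OF u inc jk that(3)] that by (simp add: mix_def)
  qed auto
  have e: "\<bar>form X (mix {} u)\<bar> \<le> circ X" using *[of "{}"] by simp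
  have s: "\<bar>form X (mix {j} u)\<bar> \<le> 2 * circ X" if "j \<in> {1..k}" for j
    using *[of "{j}"] that by (simp add: prod.delta')
  have "\<bar>\<Sum>j=1..k. form X (mix {j} u)\<bar> \<le> (\<Sum>j=1..k. 2 * circ X)" by (intro order.trans[OF sum_abs] sum_mono s)
  then have "\<bar>\<Sum>j=1..k. form X (mix {j} u)\<bar> \<le> 2 * real k * circ X" by simp
  moreover have "form X u \<le> circ X" by (rule le_circ[OF j inc])
  ultimately show "form (X - Q X) u \<le> (2 + 2 * real k) * circ X"
    using e unfolding mform_diff form_Q[OF u] by (simp add: algebra_simps)
qed

text \<open>The dual tensor falls short of 1 by 1 - p, with p the product of the norms of the
  projected factors, and the form of \<open>W1\<close> is at most a small multiple of the same
  quantity. The two bounds therefore add up to at most 1.\<close>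

lemma circ_dual_sum_le_one:
  assumes W0: "QS {} W0 = W0" "circ W0 \<le> 1" and W1: "Q W1 = 0" "circ W1 \<le> (1 / 8) ^ k"
  shows "circ (W0 + W1) \<le> 1"
proof (rule circ_le)
  fix l1 l2 u
  assume l: "1 \<le> l1" "l1 < l2" "l2 \<le> k" and "\<And>j. j \<in> {1..k} \<Longrightarrow> u j \<in> vecs (d j)"
    and inc: "incoherent k d \<delta> l1 l2 u"
  then have u: "vfam u" by (simp add: vfam_def)
  define c where "c j = sqrt (\<Sum>i=1..d j. (P j (u j) i)\<^sup>2)" for j
  define s where "s j = sqrt (\<Sum>i=1..d j. (u j i - P j (u j) i)\<^sup>2)" for j
  have c0: "0 \<le> c j" "(\<Sum>i=1..d j. (P j (u j) i)\<^sup>2) = (c j)\<^sup>2" for j by (simp_all add: c_def sum_nonneg)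
  have s0: "0 \<le> s j" "(\<Sum>i=1..d j. (u j i - P j (u j) i)\<^sup>2) = (s j)\<^sup>2" for j
    by (simp_all add: s_def sum_nonneg)
  have cs: "(c j)\<^sup>2 + (s j)\<^sup>2 \<le> 1" if "j \<in> {1..k}" for j
    using mix_bounds(1)[OF u inc that] by (simp add: c0 s0)
  have c1: "c j \<le> 1" "(c j)\<^sup>2 \<le> 1" if "j \<in> {1..k}" for j
  proof -
    show "(c j)\<^sup>2 \<le> 1" using cs[OF that] zero_le_power2[of "s j"] by linarith
    then show "c j \<le> 1" using c0[of j] by (simp add: power_le_one_iff)
  qed
  let ?p = "\<Prod>j=1..k. c j"
  have p01: "0 \<le> ?p" "?p \<le> 1" using c0 c1 by (auto intro!: prod_nonneg prod_le_1)
  have t0: "form W0 u \<le> ?p"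
  proof -
    have "form W0 u = form (QS {} W0) u" using W0 by simp
    also have "\<dots> = form W0 (mix {} u)" by (rule form_QS[OF u])
    also have "\<dots> \<le> \<bar>form W0 (mix {} u)\<bar>" by simp
    also have "\<dots> \<le> ?p * circ W0"
    proof (rule abs_form_le_scaled_circ[OF l])
      fix j i assume j: "j \<in> {1..k}" and i: "i \<in> {1..d j}"
      have v: "u j \<in> vecs (d j)" using u j by (simp add: vfam_def)
      \<comment> \<open>\<open>P_incoherent\<close> is applied to the projected vector, so the sup
        norm is measured against \<open>c j\<close> and every mode contributes its factor.\<close>
      show "\<bar>mix {} u j i\<bar> \<le> c j * \<delta> j"
        using P_incoherent[OF j P_vecs[OF j v] i] by (simp add: mix_def P_idem[OF j v] c_def mult.commute)
    qed (auto simp: c0 mix_def)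
    also have "\<dots> \<le> ?p" using W0(2) p01 by (simp add: mult_left_le)
    finally show ?thesis .
  qed
  have tS: "\<bar>form W1 (mix S u)\<bar> \<le> 2 ^ k * (1 - ?p) * (1 / 8) ^ k" if S: "S \<subseteq> {1..k}" "2 \<le> card S" for S
  proof -
    have fS: "finite S" using S finite_subset by blast
    \<comment> \<open>The pair of exempt modes is replaced by a pair B inside S that contains every
      mode of S which was exempt for u. A complementary factor there has no sup bound; an exempt
      mode outside S carries a projected factor, which has one.\<close>
    have "card (S \<inter> {l1, l2}) \<le> 2" using card_mono[of "{l1, l2}" "S \<inter> {l1, l2}"] l by simp
    then obtain B where B: "S \<inter> {l1, l2} \<subseteq> B" "B \<subseteq> S" "card B = 2"
      using exists_subset_between[of "S \<inter> {l1, l2}" 2 S] S fS by auto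
    then obtain x y where "B = {x, y}" "x \<noteq> y" by (auto simp: card_2_iff)
    then obtain j1 j2 where Bj: "B = {j1, j2}" "j1 < j2" by (metis insert_commute linorder_neqE_nat)
    have jk: "j1 \<in> {1..k}" "j2 \<in> {1..k}" using Bj B S by auto
    \<comment> \<open>On B the small Euclidean norm is exploited; on the rest of S the sup bound
      \<open>2 * \<delta> j\<close> dictates the weight 2.\<close>
    define e where "e j = (if j \<in> B then s j else if j \<in> S then 2 else 1)" for j
    have e0: "0 \<le> e j" for j by (simp add: e_def s0)
    have "\<bar>form W1 (mix S u)\<bar> \<le> (\<Prod>j=1..k. e j) * circ W1"
    proof (rule abs_form_le_scaled_circ)
      show "1 \<le> j1" "j1 < j2" "j2 \<le> k" using jk Bj by auto
      fix j assume j: "j \<in> {1..k}"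
      have "(c j)\<^sup>2 \<le> 1" "(s j)\<^sup>2 \<le> 4"
        using cs[OF j] zero_le_power2[of "c j"] zero_le_power2[of "s j"] by linarith+
      then show "(\<Sum>i=1..d j. (mix S u j i)\<^sup>2) \<le> (e j)\<^sup>2" using B(2) by (auto simp: mix_def e_def c0 s0)
      show "\<bar>mix S u j i\<bar> \<le> e j * \<delta> j" if "j \<noteq> j1" "j \<noteq> j2" "i \<in> {1..d j}" for i
      proof (cases "j \<in> S")
        case True
        then have "j \<noteq> l1" "j \<noteq> l2" using B(1) Bj that by auto
        then show ?thesis using True that Bj mix_bounds(3)[OF u inc j that(3)] by (simp add: mix_def e_def)
      next
        case False
        then show ?thesis using that Bj mix_bounds(2)[OF u inc j that(3)] by (simp add: mix_def e_def)
      qed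
    qed (simp add: e0)
    also have "\<dots> \<le> 2 ^ k * (1 - ?p) * circ W1"
    proof (rule mult_right_mono[OF _ circ_nonneg])
      show "(\<Prod>j=1..k. e j) \<le> 2 ^ k * (1 - ?p)"
    proof -
      have Bk: "B \<subseteq> {1..k}" using B S by auto
      have prodB: "(\<Prod>j\<in>B. f j) = f j1 * f j2" for f :: "nat \<Rightarrow> real" unfolding Bj(1) using Bj(2) by simp
      have eB: "(\<Prod>j\<in>B. e j) = s j1 * s j2" unfolding prodB by (simp add: e_def Bj(1))
      have "(\<Prod>j=1..k. e j) = (\<Prod>j\<in>{1..k} - B. e j) * (s j1 * s j2)"
        unfolding eB[symmetric] using Bk by (intro prod.subset_diff) auto
      also have "\<dots> \<le> 2 ^ k * (1 - ?p)"
      proof (rule mult_mono)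
        have "(\<Prod>j\<in>{1..k} - B. e j) \<le> (\<Prod>j\<in>{1..k} - B. 2)" by (intro prod_mono) (auto simp: e_def)
        also have "\<dots> \<le> 2 ^ k" using card_mono[of "{1..k}" "{1..k} - B"] by simp
        finally show "(\<Prod>j\<in>{1..k} - B. e j) \<le> 2 ^ k" .
        \<comment> \<open>By the arithmetic-geometric mean inequality c1 c2 + s1 s2 is at most half
          of the four squares, that is at most 1, and p is at most c1 c2.\<close>
        have "?p = (\<Prod>j\<in>{1..k} - B. c j) * (c j1 * c j2)"
          unfolding prodB[symmetric] using Bk by (intro prod.subset_diff) auto
        also have "\<dots> \<le> 1 * (c j1 * c j2)" using c0 c1 by (intro mult_right_mono prod_le_1) auto
        finally have "?p \<le> c j1 * c j2" by simp
        moreover have "2 * (c j1 * c j2) \<le> (c j1)\<^sup>2 + (c j2)\<^sup>2" "2 * (s j1 * s j2) \<le> (s j1)\<^sup>2 + (s j2)\<^sup>2"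
          using sum_squares_bound[of "c j1" "c j2"] sum_squares_bound[of "s j1" "s j2"] by simp_all
        ultimately show "s j1 * s j2 \<le> 1 - ?p" using cs[OF jk(1)] cs[OF jk(2)] by linarith
      qed (simp_all add: s0)
      finally show ?thesis .
    qed
    qed
    also have "\<dots> \<le> 2 ^ k * (1 - ?p) * (1 / 8) ^ k" using W1(2) p01 by (intro mult_left_mono) auto
    finally show ?thesis .
  qed
  have "form W1 u = form (W1 - Q W1) u" by (simp add: W1)
  also have "\<dots> = (\<Sum>S | S \<subseteq> {1..k} \<and> 2 \<le> card S. form W1 (mix S u))" by (rule form_Q_perp[OF u])
  also have "\<dots> \<le> (\<Sum>S | S \<subseteq> {1..k} \<and> 2 \<le> card S. 2 ^ k * (1 - ?p) * (1 / 8) ^ k)"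
    by (intro sum_mono) (use tS in \<open>auto simp: abs_le_iff\<close>)
  also have "\<dots> = real (card {S. S \<subseteq> {1..k} \<and> 2 \<le> card S}) * (2 ^ k * (1 - ?p) * (1 / 8) ^ k)" by simp
  \<comment> \<open>At most 2^k sets S with weight 2^k each against the size 8^(-k) of
    \<open>W1\<close>.\<close>
  also have "\<dots> \<le> 2 ^ k * (2 ^ k * (1 - ?p) * (1 / 8) ^ k)"
  proof (intro mult_right_mono)
    have "card {S. S \<subseteq> {1..k} \<and> 2 \<le> card S} \<le> card (Pow {1..k})" by (intro card_mono) auto
    then show "real (card {S. S \<subseteq> {1..k} \<and> 2 \<le> card S}) \<le> 2 ^ k" by (simp add: card_Pow of_nat_le_iff[symmetric] del: of_nat_le_iff)
  qed (use p01 in auto)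
  also have "\<dots> = (1 / 2) ^ k * (1 - ?p)" by (simp add: power_mult_distrib[symmetric] power_divide field_simps)
  also have "\<dots> \<le> 1 * (1 - ?p)" using p01 by (intro mult_right_mono power_le_one) auto
  finally show "form (W0 + W1) u \<le> 1" using t0 by (simp add: mform_add)
qed

section \<open>Strict optimality from certificates\<close>

abbreviation "e a \<equiv> rank_one k d (\<lambda>j. unitv (a j))"

lemma e_tensors: "e a \<in> tensors k d" by (simp add: tensors_def rank_one_def)

lemma tinner_e: "a \<in> G \<Longrightarrow> tinner k d (e a) X = X a" by (simp add: tinner_rank_one mform_unitv)

lemma Q_apply: "a \<in> G \<Longrightarrow> Q X a = tinner k d (Q (e a)) X" using tinner_e[of a "Q X"] by (simp add: Q_sym)

lemma tinner_abs_le: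
  assumes "\<And>a. a \<in> G \<Longrightarrow> \<bar>X a\<bar> \<le> c"
  shows "\<bar>tinner k d X Y\<bar> \<le> c * (\<Sum>a\<in>G. \<bar>Y a\<bar>)" unfolding tinner_def sum_distrib_left
proof (intro order.trans[OF sum_abs] sum_mono)
  fix a assume "a \<in> G"
  then show "\<bar>X a * Y a\<bar> \<le> c * \<bar>Y a\<bar>" unfolding abs_mult by (intro mult_right_mono assms) auto
qed

lemma tinner_disjoint_support:
  assumes "\<And>a. a \<in> \<Omega> \<Longrightarrow> Y a = 0" "\<And>a. a \<notin> \<Omega> \<Longrightarrow> X a = 0"
  shows "tinner k d X Y = 0" unfolding tinner_def by (rule sum.neutral) (use assms in auto)

text \<open>
  The perturbation \<open>X - T\<close> vanishes on \<open>\<Omega>\<close>. The certificates \<open>Ye a\<close> show that its component in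
  the range of \<^term>\<open>Q\<close> is at most polynomially larger than the complementary one, in the
  entrywise \<open>l1\<close> norm; this replaces the usual operator norm bound for the sampling operator.
\<close>

lemma star_norm_less_of_certificate:
  assumes T: "T \<in> tensors k d" "Q T = T"
    and W0: "W0 \<in> tensors k d" "QS {} W0 = W0" "circ W0 = 1" "tinner k d W0 T = star_norm k d \<delta> T"
    and Y: "\<And>a. a \<notin> \<Omega> \<Longrightarrow> Y a = 0" "Y \<in> tensors k d"
    and YD: "\<And>a. a \<in> G \<Longrightarrow> \<bar>(W0 - Q Y) a\<bar> \<le> N * q"
    and Yc: "circ (Y - Q Y) \<le> (1 / 8) ^ k / 2"
    and Ye: "\<And>a b. a \<in> G \<Longrightarrow> b \<notin> \<Omega> \<Longrightarrow> Ye a b = 0"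
      "\<And>a b. a \<in> G \<Longrightarrow> b \<in> G \<Longrightarrow> \<bar>Ye a b\<bar> \<le> 2 * N"
      "\<And>a b. a \<in> G \<Longrightarrow> b \<in> G \<Longrightarrow> \<bar>(Q (e a) - Q (Ye a)) b\<bar> \<le> q"
    and q: "0 \<le> q" "8 * 8 ^ k * N ^ 4 * q < 1"
    and X: "X \<in> tensors k d" "restrict_tensor \<Omega> X = restrict_tensor \<Omega> T" "X \<noteq> T"
  shows "star_norm k d \<delta> T < star_norm k d \<delta> X"
proof -
  define D where "D = X - T"
  have D: "D \<in> tensors k d" "D \<noteq> 0" using X T by (auto simp: D_def tensors_diff)
  have D\<Omega>: "D a = 0" if "a \<in> \<Omega>" for a
    using fun_cong[OF X(2), of a] that by (simp add: restrict_tensor_def D_def)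
  define A where "A = Q D"
  define A' where "A' = D - Q D"
  have QA: "Q A = A" "Q A' = 0" by (simp_all add: A_def A'_def Q_Q Q_diff)
  have AA': "D = A + A'" by (simp add: A_def A'_def)
  define s where "s = (\<Sum>a\<in>G. \<bar>A a\<bar>)"
  define s' where "s' = (\<Sum>a\<in>G. \<bar>A' a\<bar>)"
  have s0: "0 \<le> s" "0 \<le> s'" by (auto simp: s_def s'_def intro: sum_nonneg)
  have N1: "1 \<le> N" by (rule N_ge_1)
  have A_entry: "\<bar>A a\<bar> \<le> 2 * N * s' + q * s" if a: "a \<in> G" for a
  proof -
    have "A a = tinner k d (Q (e a)) A" using Q_apply[OF a, of A] QA by simp
    also have "\<dots> = tinner k d (Q (e a) - Q (Ye a)) A + tinner k d (Q (Ye a)) A"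
      by (simp add: tinner_diff_left)
    also have "tinner k d (Q (Ye a)) A = tinner k d (Ye a) A" by (simp add: Q_sym QA)
    \<comment> \<open>\<open>Ye a\<close> lives on \<Omega>, where D vanishes, so its pairing with A
      is minus its pairing with A'.\<close>
    also have "\<dots> = tinner k d (Ye a) D - tinner k d (Ye a) A'" by (simp add: AA' tinner_add_right)
    also have "tinner k d (Ye a) D = 0" by (rule tinner_disjoint_support[of \<Omega>]) (use D\<Omega> Ye(1)[OF a] in auto)
    finally have "A a = tinner k d (Q (e a) - Q (Ye a)) A - tinner k d (Ye a) A'" by linarith
    moreover have "\<bar>tinner k d (Q (e a) - Q (Ye a)) A\<bar> \<le> q * s"
      unfolding s_def by (rule tinner_abs_le) (rule Ye(3)[OF a])
    moreover have "\<bar>tinner k d (Ye a) A'\<bar> \<le> 2 * N * s'"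
      unfolding s'_def by (rule tinner_abs_le) (rule Ye(2)[OF a])
    ultimately show ?thesis by linarith
  qed
  have "s \<le> (\<Sum>a\<in>G. 2 * N * s' + q * s)" unfolding s_def[of] by (rule sum_mono) (rule A_entry[unfolded s_def])
  then have s_le1: "s \<le> 2 * N\<^sup>2 * s' + N * q * s" by (simp add: power2_eq_square algebra_simps)
  have N4: "N * q \<le> 1 / 2"
  proof -
    have "2 * (N * q) \<le> 8 * 8 ^ k * N ^ 4 * q"
    proof -
      have "2 * N \<le> 8 * 8 ^ k * N ^ 4"
      proof (rule mult_mono)
        show "(2::real) \<le> 8 * 8 ^ k" using one_le_power[of "8::real" k] by linarith
        show "N \<le> N ^ 4" using N1 by (rule self_le_power) simp
      qed auto
      from mult_right_mono[OF this q(1)] show ?thesis by (simp add: mult.assoc)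
    qed
    then show ?thesis using q(2) by linarith
  qed
  have "N * q * s \<le> 1 / 2 * s" using N4 s0 by (intro mult_right_mono) auto
  then have s_le: "s \<le> 4 * N\<^sup>2 * s'" using s_le1 by linarith
  have "s' > 0"
  proof (rule ccontr)
    assume "\<not> s' > 0"
    then have "s' = 0" using s0 by simp
    then have "s = 0" using s_le s0 by simp
    have "D a = 0" if "a \<in> G" for a
      using \<open>s = 0\<close> \<open>s' = 0\<close> that by (simp add: AA' s_def s'_def sum_nonneg_eq_0_iff)
    then have "D = 0" using D by (auto simp: tensors_def fun_eq_iff)
    then show False using D by simp
  qed
  \<comment> \<open>Since \<open>circ A' \<le> s'\<close>, the summand \<open>c *\<^sub>R A'\<close>
    uses up exactly the half of the margin \<open>(1 / 8) ^ k\<close> that \<open>Yc\<close> leaves.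
    Its pairing with D is a positive multiple of the squared norm of A', the source of
    strictness.\<close>
  define c where "c = (1 / 8) ^ k / (2 * s')"
  have c0: "c > 0" using \<open>s' > 0\<close> by (simp add: c_def)
  define W1 where "W1 = (Y - Q Y) + c *\<^sub>R A'"
  have W1: "circ W1 \<le> (1 / 8) ^ k"
  proof -
    have "circ (c *\<^sub>R A') \<le> \<bar>c\<bar> * circ A'" by (rule circ_scale)
    also have "\<dots> \<le> \<bar>c\<bar> * s'" unfolding s'_def by (intro mult_left_mono circ_le_sum_abs) auto
    also have "\<dots> = (1 / 8) ^ k / 2" using c0 \<open>s' > 0\<close> by (simp add: c_def)
    finally show ?thesis using circ_add[of "Y - Q Y" "c *\<^sub>R A'"] Yc by (simp add: W1_def)
  qed
  have QW1: "Q W1 = 0" by (simp add: W1_def Q_add Q_diff Q_Q Q_scale QA)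
  have "circ (W0 + W1) \<le> 1" by (rule circ_dual_sum_le_one) (use W0 QW1 W1 in auto)
  moreover have "W0 + W1 \<in> tensors k d"
    using W0 Y D by (simp add: W1_def A'_def tensors_add tensors_diff tensors_scale Q_tensors)
  ultimately have "tinner k d (W0 + W1) X \<le> star_norm k d \<delta> X" by (intro le_star)
  moreover have "tinner k d (W0 + W1) X = star_norm k d \<delta> T + tinner k d (W0 - Q Y) A + c * tinner k d A' A'"
  proof -
    have "X = T + D" by (simp add: D_def)
    have W1T: "tinner k d W1 T = 0"
    proof -
      have "tinner k d W1 T = tinner k d W1 (Q T)" using T by simp
      also have "\<dots> = tinner k d (Q W1) T" by (rule Q_sym[symmetric])
      finally show ?thesis by (simp add: QW1 tinner_def)
    qed
    have YD0: "tinner k d Y D = 0" by (rule tinner_disjoint_support[of \<Omega>]) (use D\<Omega> Y in auto)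
    have W0Q: "Q W0 = W0" using W0 by (intro Q_eq_self_if_QS_empty)
    have "tinner k d (W0 + W1) D = tinner k d (W0 - Q Y) D + tinner k d Y D + c * tinner k d A' D"
      by (simp add: W1_def tinner_add_left tinner_diff_left tinner_scaleR_left)
    also have "tinner k d (W0 - Q Y) D = tinner k d (W0 - Q Y) A"
      unfolding A_def Q_sym[symmetric] by (simp add: Q_diff W0Q Q_Q)
    also have "tinner k d A' D = tinner k d A' A'"
    proof -
      have "tinner k d A' A = tinner k d (Q A') D" unfolding A_def by (rule Q_sym[symmetric])
      also have "\<dots> = 0" by (simp add: QA tinner_def)
      finally show ?thesis by (simp add: AA' tinner_add_right)
    qed
    finally have "tinner k d (W0 + W1) D = tinner k d (W0 - Q Y) A + c * tinner k d A' A'"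
      unfolding YD0 by linarith
    moreover have "tinner k d (W0 + W1) T = star_norm k d \<delta> T" unfolding tinner_add_left W1T W0(4) by simp
    ultimately show ?thesis unfolding \<open>X = T + D\<close> tinner_add_right by linarith
  qed
  \<comment> \<open>The residual error is at most 4 N^3 q s', while Cauchy-Schwarz bounds the gain
    below by c s'^2 / N; together they account for the fourth power of N in the hypothesis on
    q.\<close>
  moreover have "\<bar>tinner k d (W0 - Q Y) A\<bar> < c * tinner k d A' A'"
  proof -
    have "\<bar>tinner k d (W0 - Q Y) A\<bar> \<le> N * q * s" unfolding s_def by (rule tinner_abs_le) (rule YD)
    also have "\<dots> \<le> N * q * (4 * N\<^sup>2 * s')" using s_le q N1 by (intro mult_left_mono) auto
    also have "\<dots> = 4 * N ^ 4 * q / N * s'" using N1 by (simp add: power2_eq_square power4_eq_xxxx)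
    also have "\<dots> < (1 / 8) ^ k / 2 / N * s'"
    proof -
      have "4 * N ^ 4 * q < (1 / 8) ^ k / 2" using q(2) by (simp add: power_divide field_simps)
      then show ?thesis using N1 \<open>s' > 0\<close> by (intro mult_strict_right_mono divide_strict_right_mono) auto
    qed
    also have "\<dots> = c * (s'\<^sup>2 / N)" using \<open>s' > 0\<close> by (simp add: c_def power2_eq_square)
    also have "\<dots> \<le> c * tinner k d A' A'"
    proof -
      have "s'\<^sup>2 \<le> (\<Sum>a\<in>G. (1::real)\<^sup>2) * (\<Sum>a\<in>G. \<bar>A' a\<bar>\<^sup>2)"
        using Cauchy_Schwarz_ineq_sum[of "\<lambda>_. 1" "\<lambda>a. \<bar>A' a\<bar>" G] by (simp add: s'_def)
      then have "s'\<^sup>2 \<le> N * tinner k d A' A'" by (simp add: tinner_def power2_eq_square)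
      then have "s'\<^sup>2 / N \<le> tinner k d A' A'" using N1 by (simp add: pos_divide_le_eq mult.commute)
      then show ?thesis using c0 by (intro mult_left_mono) auto
    qed
    finally show ?thesis .
  qed
  ultimately show ?thesis by linarith
qed

end

subsection \<open>The golfing scheme\<close>

lemma sum_list_abs_le: "\<bar>sum_list (map f xs)\<bar> \<le> sum_list (map (\<lambda>x. \<bar>f x\<bar>) xs)" for f :: "'a \<Rightarrow> real"
  by (induction xs) auto

text \<open>Entries are grouped by their pair of coordinates. The multiplicity bound does not refer
  to the weights, so one event about the sample controls all weights simultaneously.\<close>

lemma sum_list_pair_le:
  fixes \<phi> \<psi> :: "nat \<Rightarrow> real"
  assumes mem: "\<And>x. x \<in> set xs \<Longrightarrow> x j1 \<in> A \<and> x j2 \<in> B" and fin: "finite A" "finite B"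
    and nonneg: "\<And>i. 0 \<le> \<phi> i" "\<And>i. 0 \<le> \<psi> i"
    and cnt: "\<And>i1 i2. i1 \<in> A \<Longrightarrow> i2 \<in> B \<Longrightarrow> real (length (filter (\<lambda>x. x j1 = i1 \<and> x j2 = i2) xs)) \<le> c"
  shows "(\<Sum>x\<leftarrow>xs. \<phi> (x j1) * \<psi> (x j2)) \<le> c * (\<Sum>i\<in>A. \<phi> i) * (\<Sum>i\<in>B. \<psi> i)"
proof -
  have "(\<Sum>x\<leftarrow>xs. \<phi> (x j1) * \<psi> (x j2)) = (\<Sum>i1\<in>A. \<Sum>i2\<in>B. real (length (filter (\<lambda>x. x j1 = i1 \<and> x j2 = i2) xs)) * (\<phi> i1 * \<psi> i2))"
    using mem
  proof (induction xs)
    case (Cons x xs)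
    have x: "x j1 \<in> A" "x j2 \<in> B" using Cons.prems by auto
    have "(\<Sum>i1\<in>A. \<Sum>i2\<in>B. real (length (filter (\<lambda>x. x j1 = i1 \<and> x j2 = i2) (x # xs))) * (\<phi> i1 * \<psi> i2))
      = (\<Sum>i1\<in>A. \<Sum>i2\<in>B. (if x j1 = i1 then if x j2 = i2 then \<phi> i1 * \<psi> i2 else 0 else 0) +
          real (length (filter (\<lambda>x. x j1 = i1 \<and> x j2 = i2) xs)) * (\<phi> i1 * \<psi> i2))"
      by (intro sum.cong) (auto simp: algebra_simps)
    also have "\<dots> = (\<Sum>i1\<in>A. if x j1 = i1 then \<Sum>i2\<in>B. (if x j2 = i2 then \<phi> i1 * \<psi> i2 else 0) else 0) + (\<Sum>x\<leftarrow>xs. \<phi> (x j1) * \<psi> (x j2))"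
      using Cons by (subst Cons.IH) (auto simp: sum.distrib intro!: sum.cong)
    also have "\<dots> = \<phi> (x j1) * \<psi> (x j2) + (\<Sum>x\<leftarrow>xs. \<phi> (x j1) * \<psi> (x j2))" using x fin by simp
    finally show ?case by simp
  qed simp
  also have "\<dots> \<le> (\<Sum>i1\<in>A. \<Sum>i2\<in>B. c * (\<phi> i1 * \<psi> i2))"
    by (intro sum_mono mult_right_mono cnt mult_nonneg_nonneg nonneg)
  also have "\<dots> = c * (\<Sum>i\<in>A. \<phi> i) * (\<Sum>i\<in>B. \<psi> i)" by (simp add: sum_distrib_left sum_distrib_right mult_ac)
  finally show ?thesis .
qed

lemma card_UN_real_le:
  assumes "finite I" "\<And>i. i \<in> I \<Longrightarrow> real (card (A i)) \<le> c"
  shows "real (card (\<Union>i\<in>I. A i)) \<le> real (card I) * c"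
proof -
  have "real (card (\<Union>i\<in>I. A i)) \<le> real (\<Sum>i\<in>I. card (A i))"
    using card_UN_le[OF assms(1)] of_nat_le_iff by blast
  also have "\<dots> \<le> (\<Sum>i\<in>I. c)" unfolding of_nat_sum by (intro sum_mono assms)
  finally show ?thesis by simp
qed

lemma sum_grid_pair:
  fixes \<phi> \<psi> :: "nat \<Rightarrow> real"
  assumes j: "j1 \<in> {1..k}" "j2 \<in> {1..k}" "j1 \<noteq> j2"
  shows "(\<Sum>a\<in>grid k d. \<phi> (a j1) * \<psi> (a j2)) = (\<Prod>j\<in>{1..k} - {j1, j2}. real (d j)) * (\<Sum>i=1..d j1. \<phi> i) * (\<Sum>i=1..d j2. \<psi> i)"
proof -
  define g where "g j = (if j = j1 then \<phi> else if j = j2 then \<psi> else (\<lambda>_. 1))" for j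
  have split: "(\<Prod>j=1..k. f j) = (\<Prod>j\<in>{1..k} - {j1, j2}. f j) * (f j1 * f j2)" for f :: "nat \<Rightarrow> real"
    using j by (subst prod.subset_diff[of "{j1, j2}"]) auto
  have "(\<Sum>a\<in>grid k d. \<phi> (a j1) * \<psi> (a j2)) = (\<Sum>a\<in>grid k d. \<Prod>j=1..k. g j (a j))"
    unfolding split using j by (intro sum.cong) (auto simp: g_def)
  also have "\<dots> = (\<Prod>j=1..k. \<Sum>i=1..d j. g j i)" by (rule sum_grid_prod)
  also have "\<dots> = (\<Prod>j\<in>{1..k} - {j1, j2}. real (d j)) * ((\<Sum>i=1..d j1. \<phi> i) * (\<Sum>i=1..d j2. \<psi> i))"
    unfolding split using j by (auto simp: g_def)
  finally show ?thesis by (simp add: mult.assoc)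
qed

context tensor_proj
begin

text \<open>The sampling operator with multiplicities, scaled so that for positive m its average
  over all lists of length m is X on the grid.\<close>

definition samp :: "nat \<Rightarrow> (nat \<Rightarrow> nat) list \<Rightarrow> tensor \<Rightarrow> tensor" where
  "samp m xs X = (\<lambda>a. N / real m * (\<Sum>x\<leftarrow>xs. if x = a then X a else 0))"

lemma sum_samp:
  assumes "set xs \<subseteq> G"
  shows "(\<Sum>a\<in>G. samp m xs X a * g a) = N / real m * (\<Sum>x\<leftarrow>xs. X x * g x)"
proof -
  have "(\<Sum>a\<in>G. (\<Sum>x\<leftarrow>xs. if x = a then X a else 0) * g a) = (\<Sum>x\<leftarrow>xs. X x * g x)" using assms
  proof (induction xs)
    case (Cons x xs)
    have "(\<Sum>a\<in>G. (if x = a then X a else 0) * g a) = (\<Sum>a\<in>G. if x = a then X a * g a else 0)"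
      by (intro sum.cong) auto
    also have "\<dots> = X x * g x" using Cons.prems by simp
    finally show ?case using Cons by (simp add: distrib_right sum.distrib)
  qed simp
  then show ?thesis by (simp only: samp_def sum_distrib_left[symmetric] mult.assoc)
qed

lemma samp_outside: "a \<notin> set xs \<Longrightarrow> samp m xs X a = 0"
proof -
  assume "a \<notin> set xs"
  then have "(\<Sum>x\<leftarrow>xs. if x = a then X a else 0) = 0" by (induction xs) auto
  then show ?thesis by (simp add: samp_def)
qed

lemma samp_tensors: "set xs \<subseteq> G \<Longrightarrow> samp m xs X \<in> tensors k d" by (auto simp: tensors_def intro!: samp_outside)

lemma samp_abs_le:
  assumes "length xs = m" "m > 0" "\<bar>X a\<bar> \<le> M"
  shows "\<bar>samp m xs X a\<bar> \<le> N * M"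
proof -
  have "\<bar>\<Sum>x\<leftarrow>xs. if x = a then X a else 0\<bar> \<le> real (length xs) * M"
  proof (induction xs)
    case (Cons x xs)
    have "0 \<le> M" using assms(3) by linarith
    then have "\<bar>if x = a then X a else 0\<bar> \<le> M" using assms(3) by simp
    then show ?case using Cons by (simp add: distrib_right)
  qed simp
  then have "N / real m * \<bar>\<Sum>x\<leftarrow>xs. if x = a then X a else 0\<bar> \<le> N / real m * (real m * M)"
    using assms(1) by (intro mult_left_mono) auto
  then show ?thesis using assms(2) by (simp add: samp_def abs_mult)
qed

text \<open>The state carries the residual together with a deterministic bound on its entries. The
  bound halves in every round regardless of the sample, so the errors allowed by
  \<open>golf_good\<close> form a geometric series.\<close>

definition golf_step :: "nat \<Rightarrow> tensor \<times> real \<Rightarrow> (nat \<Rightarrow> nat) list \<Rightarrow> tensor \<times> real" where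
  "golf_step m s xs = (fst s - Q (samp m xs (fst s)), snd s / 2)"

definition golf_good :: "real \<Rightarrow> nat \<Rightarrow> tensor \<times> real \<Rightarrow> (nat \<Rightarrow> nat) list \<Rightarrow> bool" where
  "golf_good \<epsilon> m s xs \<longleftrightarrow> (\<forall>b\<in>G. \<bar>(fst s - Q (samp m xs (fst s))) b\<bar> \<le> snd s / 2) \<and>
     circ (samp m xs (fst s) - fst s) \<le> \<epsilon> * snd s"

definition golf_inv :: "tensor \<times> real \<Rightarrow> bool" where
  "golf_inv s \<longleftrightarrow> fst s \<in> tensors k d \<and> Q (fst s) = fst s \<and> 0 < snd s \<and> (\<forall>a\<in>G. \<bar>fst s a\<bar> \<le> snd s)"

lemma golf_inv_step:
  assumes "golf_inv s" "golf_good \<epsilon> m s xs"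
  shows "golf_inv (golf_step m s xs)"
  using assms by (auto simp: golf_inv_def golf_good_def golf_step_def tensors_diff Q_tensors Q_diff Q_Q)

text \<open>The certificate is the sum of the sampled residuals, and the residuals telescope. Both
  factors 2 in the conclusion are sums of the geometric series 1 + 1/2 + 1/4 + ...\<close>

lemma golfing_certificate:
  assumes "golf_inv s" "traj (golf_step m) (golf_good \<epsilon> m) s xss" "xss \<in> nlists L (nlists m G)" "m > 0" "\<epsilon> \<ge> 0"
  shows "\<exists>Y\<in>tensors k d. (\<forall>a. a \<notin> set (concat xss) \<longrightarrow> Y a = 0) \<and> (\<forall>a\<in>G. \<bar>(fst s - Q Y) a\<bar> \<le> snd s / 2 ^ L) \<and>
    circ (Y - Q Y) \<le> 2 * (2 + 2 * real k) * \<epsilon> * snd s \<and> (\<forall>a\<in>G. \<bar>Y a\<bar> \<le> 2 * N * snd s)" using assms(1-3)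
proof (induction xss arbitrary: s L)
  case Nil
  have "Q 0 = 0" using Q_diff[of 0 0] by simp
  then have Q0: "circ (0 - Q 0) = 0" "\<And>a. (fst s - Q 0) a = fst s a" by simp_all
  show ?case
    using Nil \<open>\<epsilon> \<ge> 0\<close> by (intro bexI[of _ 0] conjI) (unfold Q0, auto simp: golf_inv_def nlists_def tensors_def)
next
  case (Cons xs xss)
  define D where "D = fst s"
  define M where "M = snd s"
  define R where "R = samp m xs D"
  obtain L' where L: "L = Suc L'" using Cons.prems by (cases L) (auto simp: nlists_def)
  have xs: "set xs \<subseteq> G" "length xs = m" and xss: "xss \<in> nlists L' (nlists m G)"
    using Cons.prems L by (auto simp: nlists_def)
  have good: "golf_good \<epsilon> m s xs" and tr: "traj (golf_step m) (golf_good \<epsilon> m) (golf_step m s xs) xss"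
    using Cons.prems by auto
  have inv: "D \<in> tensors k d" "Q D = D" "0 < M" "\<forall>a\<in>G. \<bar>D a\<bar> \<le> M"
    using Cons.prems by (auto simp: golf_inv_def D_def M_def)
  obtain Y where Y: "Y \<in> tensors k d" "\<forall>a. a \<notin> set (concat xss) \<longrightarrow> Y a = 0"
    "\<forall>a\<in>G. \<bar>(D - Q R - Q Y) a\<bar> \<le> M / 2 / 2 ^ L'" "circ (Y - Q Y) \<le> 2 * (2 + 2 * real k) * \<epsilon> * (M / 2)"
    "\<forall>a\<in>G. \<bar>Y a\<bar> \<le> 2 * N * (M / 2)" using Cons.IH[OF golf_inv_step[OF Cons.prems(1) good] tr xss]
    unfolding golf_step_def fst_conv snd_conv D_def[symmetric] M_def[symmetric] R_def[symmetric] by blast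
  show ?case
  proof (intro bexI[of _ "R + Y"] conjI ballI allI impI)
    show "R + Y \<in> tensors k d" using Y samp_tensors[OF xs(1)] by (simp add: R_def tensors_add)
  next
    fix a assume "a \<notin> set (concat (xs # xss))"
    then show "(R + Y) a = 0" using Y by (simp add: R_def samp_outside)
  next
    fix a assume "a \<in> G"
    moreover have "fst s - Q (R + Y) = D - Q R - Q Y" by (simp only: D_def Q_add diff_diff_eq)
    ultimately show "\<bar>(fst s - Q (R + Y)) a\<bar> \<le> snd s / 2 ^ L" using Y L by (simp add: M_def)
  next
    have "circ (R - D - Q (R - D)) \<le> (2 + 2 * real k) * circ (R - D)" by (rule circ_Q_perp_le)
    also have "\<dots> \<le> (2 + 2 * real k) * (\<epsilon> * M)"
      using good by (intro mult_left_mono) (auto simp: golf_good_def R_def D_def M_def)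
    finally have 1: "circ (R - D - Q (R - D)) \<le> (2 + 2 * real k) * (\<epsilon> * M)" .
    \<comment> \<open>As \<open>Q D = D\<close>, subtracting D leaves the complementary component
      unchanged and replaces the sample R by its deviation from the mean, which
      \<open>golf_good\<close> controls.\<close>
    have "R + Y - Q (R + Y) = (R - D - Q (R - D)) + (Y - Q Y)"
      unfolding Q_add Q_diff inv(2) by (simp only: algebra_simps)
    then have "circ (R + Y - Q (R + Y)) \<le> circ (R - D - Q (R - D)) + circ (Y - Q Y)" using circ_add by metis
    with 1 Y(4) show "circ (R + Y - Q (R + Y)) \<le> 2 * (2 + 2 * real k) * \<epsilon> * snd s"
      unfolding M_def by (simp only: algebra_simps)
  next
    fix a assume a: "a \<in> G"
    have "\<bar>R a\<bar> \<le> N * M" unfolding R_def using xs inv a assms(4) by (intro samp_abs_le) auto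
    then show "\<bar>(R + Y) a\<bar> \<le> 2 * N * snd s" using Y(5) a by (fastforce simp: M_def)
  qed
qed

text \<open>An entry of the new residual is the deviation of an empirical mean of \<open>f b\<close>
  from its expectation \<open>D b\<close>. Bernstein applies with second moment M^2 B, bound M B and
  deviation M/2, which gives the exponent m / (20 B); the factor \<open>2 * N\<close> counts signs
  and entries.\<close>

lemma contraction_count:
  assumes inv: "golf_inv (D, M)" and m: "m > 0"
    and B: "\<And>a. a \<in> G \<Longrightarrow> N * tinner k d (Q (e a)) (Q (e a)) \<le> B" and B0: "B > 0"
  shows "real (card {xs \<in> nlists m G. \<not> (\<forall>b\<in>G. \<bar>(D - Q (samp m xs D)) b\<bar> \<le> M / 2)})
    \<le> 2 * N * exp (- (real m / (20 * B))) * N ^ m"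
proof -
  have D: "Q D = D" "0 < M" "\<And>a. a \<in> G \<Longrightarrow> \<bar>D a\<bar> \<le> M" using inv by (auto simp: golf_inv_def)
  define f where "f b x = N * (D x * Q (e b) x)" for b x
  define bad where "bad s b = {xs \<in> nlists m G. (\<Sum>x\<leftarrow>xs. s * f b x) \<ge> real m * (s * D b + M / 2)}" for s :: real and b
  have entry: "(D - Q (samp m xs D)) b = D b - (\<Sum>x\<leftarrow>xs. f b x) / real m" if "set xs \<subseteq> G" "b \<in> G" for xs b
  proof -
    have "Q (samp m xs D) b = tinner k d (samp m xs D) (Q (e b))"
      using Q_apply[OF that(2)] by (simp add: tinner_commute)
    also have "\<dots> = N / real m * (\<Sum>x\<leftarrow>xs. D x * Q (e b) x)" unfolding tinner_def by (rule sum_samp[OF that(1)])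
    also have "\<dots> = (\<Sum>x\<leftarrow>xs. f b x) / real m" by (simp add: f_def sum_list_const_mult)
    finally show ?thesis by simp
  qed
  have bad: "real (card (bad s b)) \<le> exp (- (real m / (20 * B))) * N ^ m" if b: "b \<in> G" and s: "s\<^sup>2 = 1" for s b
  proof -
    have s1: "\<bar>s\<bar> = 1" using s by (simp add: power2_eq_1_iff) (auto)
    define nb where "nb = tinner k d (Q (e b)) (Q (e b))"
    \<comment> \<open>An entry of a projected unit tensor is an inner product of two projected unit
      tensors, hence at most the mean of their squared norms.\<close>
    have ent: "N * \<bar>Q (e b) x\<bar> \<le> B" if x: "x \<in> G" for x
    proof -
      have "Q (e b) x = tinner k d (Q (e x)) (Q (e b))" using Q_apply[OF x, of "Q (e b)"] by (simp add: Q_Q)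
      moreover have "2 * \<bar>tinner k d (Q (e x)) (Q (e b))\<bar> \<le> tinner k d (Q (e x)) (Q (e x)) + tinner k d (Q (e b)) (Q (e b))"
      proof -
        have "2 * \<bar>tinner k d X Y\<bar> \<le> tinner k d X X + tinner k d Y Y" for X Y
        proof -
          have "2 * \<bar>tinner k d X Y\<bar> \<le> (\<Sum>a\<in>G. 2 * \<bar>X a * Y a\<bar>)"
            unfolding tinner_def sum_distrib_left[symmetric] using sum_abs[of "\<lambda>a. X a * Y a" G] by simp
          also have "\<dots> \<le> (\<Sum>a\<in>G. X a * X a + Y a * Y a)"
          proof (rule sum_mono)
            fix a show "2 * \<bar>X a * Y a\<bar> \<le> X a * X a + Y a * Y a"
              using sum_squares_bound[of "\<bar>X a\<bar>" "\<bar>Y a\<bar>"] by (simp add: abs_mult power2_eq_square)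
          qed
          finally show ?thesis by (simp add: tinner_def sum.distrib)
        qed
        then show ?thesis .
      qed
      ultimately have "2 * \<bar>Q (e b) x\<bar> \<le> tinner k d (Q (e x)) (Q (e x)) + nb" by (simp add: nb_def)
      then have "N * (2 * \<bar>Q (e b) x\<bar>) \<le> N * (tinner k d (Q (e x)) (Q (e x)) + nb)" by (intro mult_left_mono) auto
      then show ?thesis using B[OF x] B[OF b] by (simp add: nb_def distrib_left)
    qed
    have "real (card (bad s b)) \<le> exp (- (real m * (M / 2)\<^sup>2 / (2 * (2 * (M\<^sup>2 * B) + (M * B) * (M / 2))))) * N ^ m"
      unfolding bad_def
    proof (rule bernstein_count)
      fix x assume x: "x \<in> G"
      have "\<bar>s * f b x\<bar> = \<bar>D x\<bar> * (N * \<bar>Q (e b) x\<bar>)" by (simp add: f_def abs_mult s1)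
      also have "\<dots> \<le> M * B" using D(3)[OF x] D(2) ent[OF x] by (intro mult_mono) auto
      finally show "s * f b x \<le> M * B" by linarith
    next
      have "(\<Sum>x\<in>G. s * f b x) = N * (s * tinner k d D (Q (e b)))"
        by (simp add: f_def tinner_def sum_distrib_left mult_ac)
      also have "tinner k d D (Q (e b)) = D b" using Q_apply[OF b, of D] by (simp add: D tinner_commute)
      finally show "(\<Sum>x\<in>G. s * f b x) \<le> N * (s * D b)" by simp
    next
      have "(\<Sum>x\<in>G. (s * f b x)\<^sup>2) \<le> (\<Sum>x\<in>G. N\<^sup>2 * M\<^sup>2 * (Q (e b) x * Q (e b) x))"
      proof (rule sum_mono)
        fix x assume x: "x \<in> G"
        have "(s * f b x)\<^sup>2 = N\<^sup>2 * (D x)\<^sup>2 * (Q (e b) x * Q (e b) x)"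
          by (simp add: f_def power_mult_distrib s power2_eq_square[of "Q (e b) x"])
        also have "\<dots> \<le> N\<^sup>2 * M\<^sup>2 * (Q (e b) x * Q (e b) x)"
          using power_mono[OF D(3)[OF x], of 2] by (intro mult_right_mono mult_left_mono) auto
        finally show "(s * f b x)\<^sup>2 \<le> N\<^sup>2 * M\<^sup>2 * (Q (e b) x * Q (e b) x)" .
      qed
      also have "\<dots> = N * (M\<^sup>2 * (N * nb))"
        by (simp add: nb_def tinner_def sum_distrib_left power2_eq_square mult_ac)
      also have "\<dots> \<le> N * (M\<^sup>2 * B)" using B[OF b] by (intro mult_left_mono) (auto simp: nb_def)
      finally show "(\<Sum>x\<in>G. (s * f b x)\<^sup>2) \<le> N * (M\<^sup>2 * B)" .
    qed (use D B0 grid_nonempty in \<open>auto intro!: add_pos_pos mult_pos_pos\<close>)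
    also have "real m * (M / 2)\<^sup>2 / (2 * (2 * (M\<^sup>2 * B) + (M * B) * (M / 2))) = real m / (20 * B)"
      using D(2) B0 by (simp add: power2_eq_square field_simps)
    finally show ?thesis .
  qed
  have "{xs \<in> nlists m G. \<not> (\<forall>b\<in>G. \<bar>(D - Q (samp m xs D)) b\<bar> \<le> M / 2)} \<subseteq> (\<Union>b\<in>G. bad 1 b \<union> bad (- 1) b)"
  proof
    fix xs assume "xs \<in> {xs \<in> nlists m G. \<not> (\<forall>b\<in>G. \<bar>(D - Q (samp m xs D)) b\<bar> \<le> M / 2)}"
    then obtain b where xs: "xs \<in> nlists m G" "set xs \<subseteq> G" and b: "b \<in> G" "\<not> \<bar>(D - Q (samp m xs D)) b\<bar> \<le> M / 2"
      by (auto simp: nlists_def)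
    then have "\<not> \<bar>D b - (\<Sum>x\<leftarrow>xs. f b x) / real m\<bar> \<le> M / 2" by (simp only: entry not_False_eq_True)
    moreover have "(\<Sum>x\<leftarrow>xs. f b x) = real m * ((\<Sum>x\<leftarrow>xs. f b x) / real m)" using m by simp
    moreover have "real m * t \<le> real m * t'" if "t \<le> t'" for t t' using that by (intro mult_left_mono) auto
    ultimately have "real m * (D b + M / 2) \<le> (\<Sum>x\<leftarrow>xs. f b x) \<or> real m * (- D b + M / 2) \<le> - (\<Sum>x\<leftarrow>xs. f b x)"
      by (smt (verit) mult_minus_right)
    then have "xs \<in> bad 1 b \<or> xs \<in> bad (- 1) b"
      using xs sum_list_const_mult[of "- 1" "f b" xs] by (simp add: bad_def)
    then show "xs \<in> (\<Union>b\<in>G. bad 1 b \<union> bad (- 1) b)" using b by blast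
  qed
  then have "card {xs \<in> nlists m G. \<not> (\<forall>b\<in>G. \<bar>(D - Q (samp m xs D)) b\<bar> \<le> M / 2)} \<le> card (\<Union>b\<in>G. bad 1 b \<union> bad (- 1) b)"
    by (intro card_mono) (auto simp: bad_def)
  moreover have "real (card (\<Union>b\<in>G. bad 1 b \<union> bad (- 1) b)) \<le> N * (2 * (exp (- (real m / (20 * B))) * N ^ m))"
  proof (rule card_UN_real_le)
    fix b assume b: "b \<in> G"
    have "real (card (bad 1 b \<union> bad (- 1) b)) \<le> real (card (bad 1 b)) + real (card (bad (- 1) b))"
      using card_Un_le[of "bad 1 b" "bad (- 1) b"] by linarith
    then show "real (card (bad 1 b \<union> bad (- 1) b)) \<le> 2 * (exp (- (real m / (20 * B))) * N ^ m)"
      using bad[OF b, of 1] bad[OF b, of "- 1"] by simp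
  qed simp
  ultimately show ?thesis by (simp add: mult_ac)
qed

subsection \<open>Concentration of the incoherent norm\<close>

definition others :: "nat \<Rightarrow> nat \<Rightarrow> nat set" where
  "others j1 j2 = {1..k} - {j1, j2}"

definition pairdim :: "nat \<Rightarrow> nat \<Rightarrow> real" where
  "pairdim j1 j2 = real (d j1) * real (d j2)"

lemma prod_split_pair:
  fixes f :: "nat \<Rightarrow> real"
  assumes "1 \<le> j1" "j1 < j2" "j2 \<le> k"
  shows "(\<Prod>j=1..k. f j) = (\<Prod>j\<in>others j1 j2. f j) * (f j1 * f j2)"
  unfolding others_def using assms by (subst prod.subset_diff[of "{j1, j2}"]) auto

lemma pairdim_ge_1:
  assumes "1 \<le> j1" "j1 < j2" "j2 \<le> k"
  shows "1 \<le> pairdim j1 j2"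
proof -
  have "1 \<le> d j1" "1 \<le> d j2" using assms by (auto intro: dpos)
  then have "1 * 1 \<le> real (d j1) * real (d j2)" by (intro mult_mono) auto
  then show ?thesis by (simp add: pairdim_def)
qed

lemma pairdim_others:
  assumes "1 \<le> j1" "j1 < j2" "j2 \<le> k"
  shows "(\<Prod>j\<in>others j1 j2. real (d j)) = N / pairdim j1 j2"
  unfolding N_eq prod_split_pair[OF assms] pairdim_def[symmetric] using pairdim_ge_1[OF assms] by simp

context
  fixes D :: tensor and M H g :: real and j1 j2 :: nat and z :: "nat \<times> nat \<Rightarrow> int"
  assumes j: "1 \<le> j1" "j1 < j2" "j2 \<le> k"
    and z: "z \<in> lattice_net k d"
    and zb: "\<And>j i. j \<in> others j1 j2 \<Longrightarrow> i \<in> {1..d j} \<Longrightarrow> \<bar>lattice_vec d z j i\<bar> \<le> 2 * \<delta> j"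
    and DM: "\<And>a. a \<in> G \<Longrightarrow> \<bar>D a\<bar> \<le> M" and M0: "M > 0"
    and H: "N * (\<Prod>j\<in>others j1 j2. \<delta> j) \<le> H * sqrt (pairdim j1 j2)" "N \<le> H\<^sup>2" and H0: "H > 0"
    and g0: "g > 0"
begin

definition "nvec = lattice_vec d z"
definition "nprod a = (\<Prod>j=1..k. nvec j (a j))"
definition "nscale = sqrt (pairdim j1 j2)"
text \<open>For flat vectors the product of the two factors has size 1 / \<open>nscale\<close>, so g
  measures how far a pair of entries exceeds the flat profile.\<close>

definition "is_light a \<longleftrightarrow> \<bar>nvec j1 (a j1) * nvec j2 (a j2)\<bar> \<le> g / nscale"
definition "light_part a = N * (D a * nprod a) * of_bool (is_light a)"
definition "heavy_part a = N * (D a * nprod a) * of_bool (\<not> is_light a)"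

lemma nscale: "0 < nscale" "nscale\<^sup>2 = pairdim j1 j2" using pairdim_ge_1[OF j] by (auto simp: nscale_def)

lemma nvec_sq: "j \<in> {1..k} \<Longrightarrow> (\<Sum>i=1..d j. (nvec j i)\<^sup>2) \<le> 4"
proof -
  assume j: "j \<in> {1..k}"
  have "real_of_int (\<Sum>i=1..d j. (z (j, i))\<^sup>2) \<le> real_of_int (4 * int (d j))"
    using z j unfolding lattice_net_def of_int_le_iff by blast
  then have "(\<Sum>i=1..d j. (real_of_int (z (j, i)))\<^sup>2) \<le> 4 * real (d j)" by simp
  then have "(\<Sum>i=1..d j. (real_of_int (z (j, i)))\<^sup>2) / real (d j) \<le> 4"
    using dpos[OF j] by (simp add: pos_divide_le_eq)
  then show ?thesis by (simp add: nvec_def lattice_vec_def power_divide sum_divide_distrib)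
qed

lemma rest_le:
  assumes a: "a \<in> G"
  shows "N * \<bar>D a * (\<Prod>j\<in>others j1 j2. nvec j (a j))\<bar> \<le> 2 ^ k * M * H * nscale"
proof -
  have "\<bar>\<Prod>j\<in>others j1 j2. nvec j (a j)\<bar> \<le> (\<Prod>j\<in>others j1 j2. 2 * \<delta> j)" unfolding abs_prod
    by (intro prod_mono conjI) (use zb gridD[OF a] in \<open>auto simp: nvec_def others_def\<close>)
  also have "\<dots> = 2 ^ card (others j1 j2) * (\<Prod>j\<in>others j1 j2. \<delta> j)" by (simp add: prod.distrib)
  also have "\<dots> \<le> 2 ^ k * (\<Prod>j\<in>others j1 j2. \<delta> j)"
  proof (intro mult_right_mono power_increasing prod_nonneg)
    show "card (others j1 j2) \<le> k" using card_mono[of "{1..k}" "others j1 j2"] by (simp add: others_def)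
  qed (auto simp: others_def intro: less_imp_le[OF \<delta>_pos])
  finally have "\<bar>D a\<bar> * \<bar>\<Prod>j\<in>others j1 j2. nvec j (a j)\<bar> \<le> M * (2 ^ k * (\<Prod>j\<in>others j1 j2. \<delta> j))"
    using DM[OF a] M0 by (intro mult_mono) auto
  then have "N * \<bar>D a * (\<Prod>j\<in>others j1 j2. nvec j (a j))\<bar> \<le> N * (M * (2 ^ k * (\<Prod>j\<in>others j1 j2. \<delta> j)))"
    unfolding abs_mult by (intro mult_left_mono) auto
  also have "\<dots> = 2 ^ k * M * (N * (\<Prod>j\<in>others j1 j2. \<delta> j))" by simp
  also have "\<dots> \<le> 2 ^ k * M * (H * nscale)" unfolding nscale_def using M0 by (intro mult_left_mono H(1)) auto
  finally show ?thesis by (simp only: mult.assoc)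
qed

lemma abs_term:
  assumes a: "a \<in> G"
  shows "\<bar>N * (D a * nprod a)\<bar> \<le> 2 ^ k * M * H * nscale * \<bar>nvec j1 (a j1) * nvec j2 (a j2)\<bar>"
proof -
  have "\<bar>N * (D a * nprod a)\<bar> = N * \<bar>D a * (\<Prod>j\<in>others j1 j2. nvec j (a j))\<bar> * \<bar>nvec j1 (a j1) * nvec j2 (a j2)\<bar>"
    unfolding nprod_def prod_split_pair[OF j] by (simp add: abs_mult)
  also have "\<dots> \<le> 2 ^ k * M * H * nscale * \<bar>nvec j1 (a j1) * nvec j2 (a j2)\<bar>"
    by (intro mult_right_mono rest_le a) auto
  finally show ?thesis .
qed

text \<open>Truncation bounds a summand by 2^k M H g. The second moment is bounded by the sum of the
  squared products over the whole grid, which factorizes and is at most 4^k N M^2. The factor M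
  cancels, so the exponent does not depend on the golfing round.\<close>

lemma light_count:
  assumes \<epsilon>: "\<epsilon> > 0"
  shows "real (card {xs \<in> nlists m G. (\<Sum>x\<leftarrow>xs. light_part x) \<ge> real m * ((\<Sum>a\<in>G. light_part a) / N + \<epsilon> * M / 3)})
    \<le> exp (- (real m * \<epsilon>\<^sup>2 / (36 * 4 ^ k * H\<^sup>2 + 6 * 2 ^ k * H * g * \<epsilon>))) * N ^ m"
proof -
  have "real (card {xs \<in> nlists m G. (\<Sum>x\<leftarrow>xs. light_part x) \<ge> real m * ((\<Sum>a\<in>G. light_part a) / N + \<epsilon> * M / 3)})
    \<le> exp (- (real m * (\<epsilon> * M / 3)\<^sup>2 / (2 * (2 * (4 ^ k * H\<^sup>2 * M\<^sup>2) + (2 ^ k * M * H * g) * (\<epsilon> * M / 3))))) * N ^ m"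
  proof (rule bernstein_count)
    fix a assume a: "a \<in> G"
    show "light_part a \<le> 2 ^ k * M * H * g"
    proof (cases "is_light a")
      case True
      have "\<bar>N * (D a * nprod a)\<bar> \<le> 2 ^ k * M * H * nscale * \<bar>nvec j1 (a j1) * nvec j2 (a j2)\<bar>" by (rule abs_term[OF a])
      also have "\<dots> \<le> 2 ^ k * M * H * nscale * (g / nscale)"
        using True M0 H0 nscale by (intro mult_left_mono) (auto simp: is_light_def)
      also have "\<dots> = 2 ^ k * M * H * g" using nscale by simp
      finally show ?thesis using True by (simp add: light_part_def)
    qed (use M0 H0 g0 in \<open>simp add: light_part_def\<close>)
  next
    have "(\<Sum>a\<in>G. (light_part a)\<^sup>2) \<le> (\<Sum>a\<in>G. N\<^sup>2 * M\<^sup>2 * (\<Prod>j=1..k. (nvec j (a j))\<^sup>2))"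
    proof (rule sum_mono)
      fix a assume a: "a \<in> G"
      have "(light_part a)\<^sup>2 \<le> N\<^sup>2 * (D a)\<^sup>2 * (nprod a)\<^sup>2" by (simp add: light_part_def power_mult_distrib of_bool_def)
      also have "\<dots> \<le> N\<^sup>2 * M\<^sup>2 * (nprod a)\<^sup>2"
        using power_mono[OF DM[OF a], of 2] by (intro mult_right_mono mult_left_mono) auto
      finally show "(light_part a)\<^sup>2 \<le> N\<^sup>2 * M\<^sup>2 * (\<Prod>j=1..k. (nvec j (a j))\<^sup>2)" by (simp add: nprod_def prod_power_distrib)
    qed
    also have "\<dots> = N\<^sup>2 * M\<^sup>2 * (\<Prod>j=1..k. \<Sum>i=1..d j. (nvec j i)\<^sup>2)"
      by (simp add: sum_distrib_left[symmetric] sum_grid_prod[of "\<lambda>j i. (nvec j i)\<^sup>2"])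
    also have "(\<Prod>j=1..k. \<Sum>i=1..d j. (nvec j i)\<^sup>2) \<le> (\<Prod>j=1..k. 4)"
      by (intro prod_mono conjI sum_nonneg nvec_sq) auto
    also have "(\<Prod>j=1..k. 4 :: real) = 4 ^ k" by simp
    also have "N\<^sup>2 * M\<^sup>2 * 4 ^ k = N * (4 ^ k * N * M\<^sup>2)" by (simp add: power2_eq_square)
    also have "\<dots> \<le> N * (4 ^ k * H\<^sup>2 * M\<^sup>2)" using H(2) by (intro mult_left_mono mult_right_mono) auto
    finally show "(\<Sum>a\<in>G. (light_part a)\<^sup>2) \<le> N * (4 ^ k * H\<^sup>2 * M\<^sup>2)" by (simp add: mult_left_mono)
  qed (use M0 H0 g0 \<epsilon> grid_nonempty in \<open>auto intro!: add_pos_pos mult_pos_pos\<close>)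
  also have "real m * (\<epsilon> * M / 3)\<^sup>2 / (2 * (2 * (4 ^ k * H\<^sup>2 * M\<^sup>2) + (2 ^ k * M * H * g) * (\<epsilon> * M / 3)))
    = (M\<^sup>2 * (real m * \<epsilon>\<^sup>2)) / (M\<^sup>2 * (36 * 4 ^ k * H\<^sup>2 + 6 * 2 ^ k * H * g * \<epsilon>))"
  proof -
    have "real m * (\<epsilon> * M / 3)\<^sup>2 / (2 * (2 * (4 ^ k * H\<^sup>2 * M\<^sup>2) + (2 ^ k * M * H * g) * (\<epsilon> * M / 3)))
      = (9 * (real m * (\<epsilon> * M / 3)\<^sup>2)) / (9 * (2 * (2 * (4 ^ k * H\<^sup>2 * M\<^sup>2) + (2 ^ k * M * H * g) * (\<epsilon> * M / 3))))"
      by (rule mult_divide_mult_cancel_left[symmetric]) simp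
    also have "9 * (real m * (\<epsilon> * M / 3)\<^sup>2) = M\<^sup>2 * (real m * \<epsilon>\<^sup>2)" by (simp add: power2_eq_square)
    also have "9 * (2 * (2 * (4 ^ k * H\<^sup>2 * M\<^sup>2) + (2 ^ k * M * H * g) * (\<epsilon> * M / 3))) = M\<^sup>2 * (36 * 4 ^ k * H\<^sup>2 + 6 * 2 ^ k * H * g * \<epsilon>)"
      by (simp add: power2_eq_square algebra_simps)
    finally show ?thesis .
  qed
  also have "\<dots> = real m * \<epsilon>\<^sup>2 / (36 * 4 ^ k * H\<^sup>2 + 6 * 2 ^ k * H * g * \<epsilon>)" using M0 by simp
  finally show ?thesis .
qed

text \<open>On the heavy part \<open>|s t| > g / q\<close> one has \<open>|s t| \<le> (q / g) s\<^sup>2 t\<^sup>2\<close>, and \<open>s\<^sup>2\<close>, \<open>t\<^sup>2\<close> sum to at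
  most 4, so only the largest multiplicity of a pair of coordinates matters.\<close>

lemma heavy_abs:
  assumes a: "a \<in> G"
  shows "\<bar>heavy_part a\<bar> \<le> 2 ^ k * M * H * pairdim j1 j2 / g * ((nvec j1 (a j1))\<^sup>2 * (nvec j2 (a j2))\<^sup>2)"
proof (cases "is_light a")
  case False
  let ?t = "\<bar>nvec j1 (a j1) * nvec j2 (a j2)\<bar>"
  have "g < ?t * nscale" using False nscale by (simp only: is_light_def not_le pos_divide_less_eq)
  then have "g * ?t \<le> ?t * nscale * ?t" by (intro mult_right_mono) auto
  then have t: "?t \<le> nscale / g * ?t\<^sup>2" using g0 by (simp add: pos_le_divide_eq power2_eq_square mult_ac)
  have "\<bar>heavy_part a\<bar> \<le> 2 ^ k * M * H * nscale * ?t" using abs_term[OF a] False by (simp add: heavy_part_def)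
  also have "\<dots> \<le> 2 ^ k * M * H * nscale * (nscale / g * ?t\<^sup>2)"
    using M0 H0 nscale by (intro mult_left_mono t) auto
  also have "\<dots> = 2 ^ k * M * H * nscale\<^sup>2 / g * ((nvec j1 (a j1))\<^sup>2 * (nvec j2 (a j2))\<^sup>2)"
    by (simp add: power2_eq_square)
  finally show ?thesis by (simp only: nscale(2))
qed (use M0 H0 g0 pairdim_ge_1[OF j] in \<open>simp add: heavy_part_def\<close>)

lemma heavy_mean: "\<bar>\<Sum>a\<in>G. heavy_part a\<bar> / N \<le> 16 * 2 ^ k * M * H / g"
proof -
  let ?c = "2 ^ k * M * H * pairdim j1 j2 / g"
  have c0: "0 \<le> ?c" using M0 H0 g0 pairdim_ge_1[OF j] by simp
  have "\<bar>\<Sum>a\<in>G. heavy_part a\<bar> \<le> (\<Sum>a\<in>G. ?c * ((nvec j1 (a j1))\<^sup>2 * (nvec j2 (a j2))\<^sup>2))"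
    by (intro order.trans[OF sum_abs] sum_mono heavy_abs)
  also have "\<dots> = ?c * (N / pairdim j1 j2 * (\<Sum>i=1..d j1. (nvec j1 i)\<^sup>2) * (\<Sum>i=1..d j2. (nvec j2 i)\<^sup>2))"
    unfolding sum_distrib_left[symmetric] pairdim_others[OF j, symmetric] others_def
    using j by (subst sum_grid_pair) auto
  also have "\<dots> \<le> ?c * (N / pairdim j1 j2 * 4 * 4)"
    using j nvec_sq pairdim_ge_1[OF j] by (intro mult_left_mono[OF _ c0] mult_mono) (auto intro!: sum_nonneg mult_nonneg_nonneg)
  also have "\<dots> = N * (16 * 2 ^ k * M * H / g)" using pairdim_ge_1[OF j] by simp
  finally show ?thesis using N_ge_1 by (simp add: pos_divide_le_eq mult.commute)
qed

text \<open>The sample enters only through \<open>cnt\<close>, which does not mention the lattice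
  point, so one event serves the whole net. The two summands come from the expected multiplicity of
  a pair and from the slack x.\<close>

lemma heavy_sample:
  assumes xs: "set xs \<subseteq> G" and m: "m > 0" and x: "x \<ge> 0"
    and cnt: "\<And>i1 i2. i1 \<in> {1..d j1} \<Longrightarrow> i2 \<in> {1..d j2} \<Longrightarrow>
      real (length (filter (\<lambda>x. x j1 = i1 \<and> x j2 = i2) xs)) \<le> 2 * real m / pairdim j1 j2 + x"
  shows "\<bar>\<Sum>x\<leftarrow>xs. heavy_part x\<bar> / real m \<le> 16 * 2 ^ k * M * H * (2 / g + pairdim j1 j2 * x / (real m * g))"
proof -
  let ?c = "2 ^ k * M * H * pairdim j1 j2 / g" and ?n = "2 * real m / pairdim j1 j2 + x"
  have pd: "0 < pairdim j1 j2" using pairdim_ge_1[OF j] by simp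
  have c0: "0 \<le> ?c" "0 \<le> ?n" using M0 H0 g0 pd x by auto
  have "\<bar>\<Sum>x\<leftarrow>xs. heavy_part x\<bar> \<le> (\<Sum>x\<leftarrow>xs. \<bar>heavy_part x\<bar>)" by (rule sum_list_abs_le)
  also have "\<dots> \<le> (\<Sum>x\<leftarrow>xs. ?c * ((nvec j1 (x j1))\<^sup>2 * (nvec j2 (x j2))\<^sup>2))"
    by (intro sum_list_mono heavy_abs) (use xs in auto)
  also have "\<dots> = ?c * (\<Sum>x\<leftarrow>xs. (nvec j1 (x j1))\<^sup>2 * (nvec j2 (x j2))\<^sup>2)" by (rule sum_list_const_mult)
  also have "\<dots> \<le> ?c * (?n * (\<Sum>i=1..d j1. (nvec j1 i)\<^sup>2) * (\<Sum>i=1..d j2. (nvec j2 i)\<^sup>2))"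
  proof (intro mult_left_mono sum_list_pair_le)
    fix x assume "x \<in> set xs"
    then have "x \<in> G" using xs by blast
    then show "x j1 \<in> {1..d j1} \<and> x j2 \<in> {1..d j2}" using gridD j by auto
  qed (use c0 cnt in auto)
  also have "\<dots> \<le> ?c * (?n * 4 * 4)"
    using j nvec_sq by (intro mult_left_mono[OF _ c0(1)] mult_mono) (use c0 in \<open>auto intro!: sum_nonneg mult_nonneg_nonneg\<close>)
  also have "\<dots> = real m * (16 * 2 ^ k * M * H * (2 / g + pairdim j1 j2 * x / (real m * g)))"
    using pd m g0 by (simp add: field_simps)
  finally show ?thesis using m by (simp add: pos_divide_le_eq mult.commute)
qed

text \<open>The heavy part is not centred: 3 / g collects 2 / g from its sampled sum and 1 / g from
  its mean, both estimated in absolute value.\<close>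

lemma net_point_bound:
  assumes xs: "xs \<in> nlists m G" and m: "m > 0" and x: "x \<ge> 0"
    and cnt: "\<And>i1 i2. i1 \<in> {1..d j1} \<Longrightarrow> i2 \<in> {1..d j2} \<Longrightarrow>
      real (length (filter (\<lambda>x. x j1 = i1 \<and> x j2 = i2) xs)) \<le> 2 * real m / pairdim j1 j2 + x"
    and lt: "(\<Sum>x\<leftarrow>xs. light_part x) < real m * ((\<Sum>a\<in>G. light_part a) / N + \<epsilon> * M / 3)"
  shows "form (samp m xs D - D) nvec \<le> \<epsilon> * M / 3 + 16 * 2 ^ k * M * H * (3 / g + pairdim j1 j2 * x / (real m * g))"
proof -
  have xsG: "set xs \<subseteq> G" using xs by (simp add: nlists_def)
  have split: "N * (D a * nprod a) = light_part a + heavy_part a" for a by (simp add: light_part_def heavy_part_def)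
  have 1: "form (samp m xs D) nvec = (\<Sum>x\<leftarrow>xs. light_part x) / real m + (\<Sum>x\<leftarrow>xs. heavy_part x) / real m"
  proof -
    have "form (samp m xs D) nvec = N / real m * (\<Sum>x\<leftarrow>xs. D x * nprod x)"
      unfolding mform_def nprod_def[symmetric] by (rule sum_samp[OF xsG])
    also have "\<dots> = (\<Sum>x\<leftarrow>xs. light_part x + heavy_part x) / real m" by (simp add: sum_list_const_mult split[symmetric])
    finally show ?thesis by (simp add: sum_list_addf add_divide_distrib)
  qed
  have 2: "form D nvec = (\<Sum>a\<in>G. light_part a) / N + (\<Sum>a\<in>G. heavy_part a) / N"
  proof -
    have "N * form D nvec = (\<Sum>a\<in>G. light_part a + heavy_part a)"
      unfolding mform_def nprod_def[symmetric] sum_distrib_left split ..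
    moreover have "N \<noteq> 0" using N_ge_1 by linarith
    ultimately show ?thesis by (metis add_divide_distrib nonzero_mult_div_cancel_left sum.distrib)
  qed
  have 3: "(\<Sum>x\<leftarrow>xs. light_part x) / real m < (\<Sum>a\<in>G. light_part a) / N + \<epsilon> * M / 3"
    using lt m by (simp add: pos_divide_less_eq mult.commute)
  have 4: "(\<Sum>x\<leftarrow>xs. heavy_part x) / real m \<le> 16 * 2 ^ k * M * H * (2 / g + pairdim j1 j2 * x / (real m * g))"
    by (rule order.trans[OF _ heavy_sample[OF xsG m x cnt]]) (use m in \<open>auto intro!: divide_right_mono\<close>)
  have 5: "- ((\<Sum>a\<in>G. heavy_part a) / N) \<le> 16 * 2 ^ k * M * H / g"
  proof -
    have "\<bar>(\<Sum>a\<in>G. heavy_part a) / N\<bar> = \<bar>\<Sum>a\<in>G. heavy_part a\<bar> / N" by (simp add: abs_divide)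
    then show ?thesis using heavy_mean by linarith
  qed
  have "16 * 2 ^ k * M * H * (2 / g + pairdim j1 j2 * x / (real m * g)) + 16 * 2 ^ k * M * H / g
     = 16 * 2 ^ k * M * H * (3 / g + pairdim j1 j2 * x / (real m * g))"
    by (simp add: algebra_simps add_divide_distrib[symmetric])
  then show ?thesis using 1 2 3 4 5 unfolding mform_diff by linarith
qed

end

section \<open>Union bound for the incoherent norm of the sampling error\<close>

lemma pair_count:
  assumes j: "1 \<le> j1" "j1 < j2" "j2 \<le> k" and m: "m > 0" and x: "x \<ge> 0"
    and i: "i1 \<in> {1..d j1}" "i2 \<in> {1..d j2}"
  shows "real (card {xs \<in> nlists m G. \<not> real (length (filter (\<lambda>x. x j1 = i1 \<and> x j2 = i2) xs)) \<le> 2 * real m / pairdim j1 j2 + x})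
    \<le> exp (- (x / 6)) * N ^ m"
proof -
  let ?S = "{a \<in> G. a j1 = i1 \<and> a j2 = i2}" and ?p = "1 / pairdim j1 j2"
  have "real (card ?S) = (\<Sum>a\<in>G. of_bool (a j1 = i1) * of_bool (a j2 = i2))"
    unfolding card_filter_real[OF finite_grid] of_bool_conj ..
  also have "\<dots> = N / pairdim j1 j2 * (\<Sum>i=1..d j1. of_bool (i = i1)) * (\<Sum>i=1..d j2. of_bool (i = i2))"
    unfolding pairdim_others[OF j, symmetric] others_def
    using j by (subst sum_grid_pair[where \<phi> = "\<lambda>i. of_bool (i = i1)" and \<psi> = "\<lambda>i. of_bool (i = i2)"]) auto
  also have "\<dots> = N * ?p" using i by (simp add: of_bool_def)
  finally have cS: "real (card ?S) \<le> N * ?p" by simp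
  have "{xs \<in> nlists m G. \<not> real (length (filter (\<lambda>x. x j1 = i1 \<and> x j2 = i2) xs)) \<le> 2 * real m / pairdim j1 j2 + x}
    \<subseteq> {xs \<in> nlists m G. real (length (filter (\<lambda>a. a \<in> ?S) xs)) \<ge> 2 * real m * ?p + x}"
  proof
    fix xs assume xs: "xs \<in> {xs \<in> nlists m G. \<not> real (length (filter (\<lambda>x. x j1 = i1 \<and> x j2 = i2) xs)) \<le> 2 * real m / pairdim j1 j2 + x}"
    then have "filter (\<lambda>x. x j1 = i1 \<and> x j2 = i2) xs = filter (\<lambda>a. a \<in> ?S) xs"
      by (intro filter_cong) (auto simp: nlists_def)
    then show "xs \<in> {xs \<in> nlists m G. real (length (filter (\<lambda>a. a \<in> ?S) xs)) \<ge> 2 * real m * ?p + x}"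
      using xs by simp
  qed
  then have "real (card {xs \<in> nlists m G. \<not> real (length (filter (\<lambda>x. x j1 = i1 \<and> x j2 = i2) xs)) \<le> 2 * real m / pairdim j1 j2 + x})
    \<le> real (card {xs \<in> nlists m G. real (length (filter (\<lambda>a. a \<in> ?S) xs)) \<ge> 2 * real m * ?p + x})"
    by (intro of_nat_mono card_mono) auto
  also have "\<dots> \<le> exp (- (x / 6)) * N ^ m"
    using pairdim_ge_1[OF j] m x grid_nonempty by (intro chernoff_count cS) auto
  finally show ?thesis .
qed

text \<open>One third of the error budget goes to the light part, which pays for the exponentially
  many lattice points, and two thirds to the heavy part, which pays for at most N pairs of
  coordinates. The factor \<open>(real k)\<^sup>2\<close> covers the choices of the exempt
  modes.\<close>

lemma circ_count:
  assumes DM: "\<And>a. a \<in> G \<Longrightarrow> \<bar>D a\<bar> \<le> M" and M0: "M > 0"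
    and H: "\<And>j1 j2. 1 \<le> j1 \<Longrightarrow> j1 < j2 \<Longrightarrow> j2 \<le> k \<Longrightarrow> N * (\<Prod>j\<in>others j1 j2. \<delta> j) \<le> H * sqrt (pairdim j1 j2)"
      "N \<le> H\<^sup>2" and H0: "H > 0" and g0: "g > 0" and \<epsilon>: "\<epsilon> > 0" and m: "m > 0" and x: "x \<ge> 0"
    and small: "\<And>j1 j2. 1 \<le> j1 \<Longrightarrow> j1 < j2 \<Longrightarrow> j2 \<le> k \<Longrightarrow>
      16 * 2 ^ k * H * (3 / g + pairdim j1 j2 * x / (real m * g)) \<le> 2 * \<epsilon> / 3"
  shows "real (card {xs \<in> nlists m G. \<not> circ (samp m xs D - D) \<le> \<epsilon> * M})
    \<le> (real k)\<^sup>2 * (exp (6 * real (\<Sum>j=1..k. d j)) * exp (- (real m * \<epsilon>\<^sup>2 / (36 * 4 ^ k * H\<^sup>2 + 6 * 2 ^ k * H * g * \<epsilon>)))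
        + N * exp (- (x / 6))) * N ^ m"
proof -
  define Pr where "Pr = {(j1, j2). 1 \<le> j1 \<and> j1 < j2 \<and> j2 \<le> k}"
  have PrS: "Pr \<subseteq> {1..k} \<times> {1..k}" by (auto simp: Pr_def)
  then have fPr: "finite Pr" by (rule finite_subset) simp
  have cPr: "real (card Pr) \<le> (real k)\<^sup>2"
  proof -
    have "card Pr \<le> card ({1..k} \<times> {1..k})" by (intro card_mono PrS) simp
    then show ?thesis by (simp add: card_cartesian_product power2_eq_square flip: of_nat_mult)
  qed
  define Z where "Z j1 j2 = {z \<in> lattice_net k d. \<forall>j\<in>others j1 j2. \<forall>i\<in>{1..d j}. \<bar>lattice_vec d z j i\<bar> \<le> 2 * \<delta> j}" for j1 j2
  have fZ: "finite (Z j1 j2)" for j1 j2 by (simp add: Z_def)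
  define E1 where "E1 = exp (- (real m * \<epsilon>\<^sup>2 / (36 * 4 ^ k * H\<^sup>2 + 6 * 2 ^ k * H * g * \<epsilon>)))"
  define A1 where "A1 j1 j2 z = {xs \<in> nlists m G. (\<Sum>x\<leftarrow>xs. light_part D g j1 j2 z x) \<ge> real m * ((\<Sum>a\<in>G. light_part D g j1 j2 z a) / N + \<epsilon> * M / 3)}" for j1 j2 z
  define A2 where "A2 j1 j2 i = {xs \<in> nlists m G. \<not> real (length (filter (\<lambda>x. x j1 = fst i \<and> x j2 = snd i) xs)) \<le> 2 * real m / pairdim j1 j2 + x}" for j1 j2 i
  define bad where "bad p = (\<Union>z\<in>Z (fst p) (snd p). A1 (fst p) (snd p) z) \<union> (\<Union>i\<in>{1..d (fst p)} \<times> {1..d (snd p)}. A2 (fst p) (snd p) i)" for p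
  have fin: "finite (A1 j1 j2 z)" "finite (A2 j1 j2 i)" for j1 j2 z i by (auto simp: A1_def A2_def)
  have sub: "{xs \<in> nlists m G. \<not> circ (samp m xs D - D) \<le> \<epsilon> * M} \<subseteq> (\<Union>p\<in>Pr. bad p)"
  proof (rule ccontr)
    assume "\<not> ?thesis"
    then obtain xs where xs: "xs \<in> nlists m G" "\<not> circ (samp m xs D - D) \<le> \<epsilon> * M" and nb: "\<And>p. p \<in> Pr \<Longrightarrow> xs \<notin> bad p"
      by blast
    have "circ (samp m xs D - D) \<le> \<epsilon> * M"
    proof (rule circ_le)
      fix j1 j2 v assume j: "1 \<le> j1" "j1 < j2" "j2 \<le> k" and v: "incoherent k d \<delta> j1 j2 v"
      obtain z where z: "z \<in> lattice_net k d" "\<And>j i. j \<in> others j1 j2 \<Longrightarrow> i \<in> {1..d j} \<Longrightarrow> \<bar>lattice_vec d z j i\<bar> \<le> 2 * \<delta> j"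
        and le: "form (samp m xs D - D) v \<le> form (samp m xs D - D) (lattice_vec d z)"
        using lattice_rounding[OF dpos \<delta>_ge v] unfolding others_def by blast
      have nb': "xs \<notin> bad (j1, j2)" using nb j by (simp add: Pr_def)
      have "z \<in> Z j1 j2" using z by (simp add: Z_def)
      then have a1: "xs \<notin> A1 j1 j2 z" using nb' by (auto simp: bad_def)
      have a2: "xs \<notin> A2 j1 j2 (i1, i2)" if "i1 \<in> {1..d j1}" "i2 \<in> {1..d j2}" for i1 i2
        using nb' that by (auto simp: bad_def)
      have nv: "nvec z = lattice_vec d z" by (rule nvec_def[OF j z DM M0 H(1)[OF j] H(2) H0 g0])
      have "form (samp m xs D - D) (nvec z) \<le> \<epsilon> * M / 3 + 16 * 2 ^ k * M * H * (3 / g + pairdim j1 j2 * x / (real m * g))"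
      proof (rule net_point_bound[OF j z DM M0 H(1)[OF j] H(2) H0 g0 xs(1) m x])
        show "(\<Sum>x\<leftarrow>xs. light_part D g j1 j2 z x) < real m * ((\<Sum>a\<in>G. light_part D g j1 j2 z a) / N + \<epsilon> * M / 3)"
          using a1 xs(1) by (simp add: A1_def)
      qed (use a2 xs(1) in \<open>auto simp: A2_def\<close>)
      also have "16 * 2 ^ k * M * H * (3 / g + pairdim j1 j2 * x / (real m * g)) = M * (16 * 2 ^ k * H * (3 / g + pairdim j1 j2 * x / (real m * g)))"
        by simp
      also have "\<dots> \<le> M * (2 * \<epsilon> / 3)" using M0 by (intro mult_left_mono small j) auto
      also have "\<epsilon> * M / 3 + M * (2 * \<epsilon> / 3) = \<epsilon> * M" by simp
      finally have "form (samp m xs D - D) (nvec z) \<le> \<epsilon> * M" by linarith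
      then show "form (samp m xs D - D) v \<le> \<epsilon> * M" using le by (simp only: nv)
    qed
    then show False using xs by simp
  qed
  have badp: "real (card (bad p)) \<le> exp (6 * real (\<Sum>j=1..k. d j)) * (E1 * N ^ m) + N * (exp (- (x / 6)) * N ^ m)" if p: "p \<in> Pr" for p
  proof -
    obtain j1 j2 where pj: "p = (j1, j2)" and j: "1 \<le> j1" "j1 < j2" "j2 \<le> k" using p by (auto simp: Pr_def)
    have "real (card (\<Union>z\<in>Z j1 j2. A1 j1 j2 z)) \<le> real (card (Z j1 j2)) * (E1 * N ^ m)"
    proof (rule card_UN_real_le[OF fZ])
      fix z assume "z \<in> Z j1 j2"
      then have z: "z \<in> lattice_net k d" "\<And>j i. j \<in> others j1 j2 \<Longrightarrow> i \<in> {1..d j} \<Longrightarrow> \<bar>lattice_vec d z j i\<bar> \<le> 2 * \<delta> j"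
        by (auto simp: Z_def)
      show "real (card (A1 j1 j2 z)) \<le> E1 * N ^ m"
        unfolding A1_def E1_def by (rule light_count[OF j z DM M0 H(1)[OF j] H(2) H0 g0 \<epsilon>])
    qed
    also have "\<dots> \<le> exp (6 * real (\<Sum>j=1..k. d j)) * (E1 * N ^ m)"
    proof (rule mult_right_mono)
      have "card (Z j1 j2) \<le> card (lattice_net k d)" by (intro card_mono) (auto simp: Z_def)
      then show "real (card (Z j1 j2)) \<le> exp (6 * real (\<Sum>j=1..k. d j))"
        using card_lattice_net[of k d] by linarith
    qed (simp add: E1_def)
    finally have 1: "real (card (\<Union>z\<in>Z j1 j2. A1 j1 j2 z)) \<le> exp (6 * real (\<Sum>j=1..k. d j)) * (E1 * N ^ m)" .
    have "real (card (\<Union>i\<in>{1..d j1} \<times> {1..d j2}. A2 j1 j2 i)) \<le> real (card ({1..d j1} \<times> {1..d j2})) * (exp (- (x / 6)) * N ^ m)"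
      by (rule card_UN_real_le) (auto simp: A2_def intro!: pair_count j m x)
    also have "\<dots> \<le> N * (exp (- (x / 6)) * N ^ m)"
    proof (rule mult_right_mono)
      have "1 * pairdim j1 j2 \<le> (\<Prod>j\<in>others j1 j2. real (d j)) * pairdim j1 j2"
        using pairdim_ge_1[OF j] by (intro mult_right_mono prod_ge_1) (use dpos in \<open>auto simp: others_def\<close>)
      also have "\<dots> = N" using pairdim_ge_1[OF j] by (simp add: pairdim_others[OF j])
      finally show "real (card ({1..d j1} \<times> {1..d j2})) \<le> N" by (simp add: card_cartesian_product pairdim_def)
    qed auto
    finally have 2: "real (card (\<Union>i\<in>{1..d j1} \<times> {1..d j2}. A2 j1 j2 i)) \<le> N * (exp (- (x / 6)) * N ^ m)" .
    have "real (card (bad p)) \<le> real (card (\<Union>z\<in>Z j1 j2. A1 j1 j2 z)) + real (card (\<Union>i\<in>{1..d j1} \<times> {1..d j2}. A2 j1 j2 i))"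
      unfolding bad_def pj fst_conv snd_conv of_nat_add[symmetric] of_nat_le_iff by (rule card_Un_le)
    then show ?thesis using 1 2 by linarith
  qed
  have "real (card {xs \<in> nlists m G. \<not> circ (samp m xs D - D) \<le> \<epsilon> * M}) \<le> real (card (\<Union>p\<in>Pr. bad p))"
  proof (intro of_nat_mono card_mono sub)
    show "finite (\<Union>p\<in>Pr. bad p)" using fPr fZ fin by (auto simp: bad_def)
  qed
  also have "\<dots> \<le> real (card Pr) * (exp (6 * real (\<Sum>j=1..k. d j)) * (E1 * N ^ m) + N * (exp (- (x / 6)) * N ^ m))"
    by (rule card_UN_real_le[OF fPr badp])
  also have "\<dots> \<le> (real k)\<^sup>2 * (exp (6 * real (\<Sum>j=1..k. d j)) * (E1 * N ^ m) + N * (exp (- (x / 6)) * N ^ m))"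
    by (intro mult_right_mono cPr) (auto simp: E1_def intro!: add_nonneg_nonneg mult_nonneg_nonneg)
  finally show ?thesis by (simp add: E1_def algebra_simps)
qed

section \<open>Probability of exact recovery\<close>

definition recovers :: "tensor \<Rightarrow> (nat \<Rightarrow> nat) set \<Rightarrow> bool" where
  "recovers T \<Omega> \<longleftrightarrow> (\<forall>X\<in>tensors k d. restrict_tensor \<Omega> X = restrict_tensor \<Omega> T \<longrightarrow> X \<noteq> T \<longrightarrow>
     star_norm k d \<delta> T < star_norm k d \<delta> X)"

text \<open>More observations leave fewer competitors. This is the monotonicity required for passing
  from lists to subsets.\<close>

lemma recovers_mono:
  assumes "recovers T \<Omega>" "\<Omega> \<subseteq> \<Omega>'"
  shows "recovers T \<Omega>'"
proof -
  have "restrict_tensor \<Omega> X = restrict_tensor \<Omega> T" if "restrict_tensor \<Omega>' X = restrict_tensor \<Omega>' T" for X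
  proof
    fix a
    show "restrict_tensor \<Omega> X a = restrict_tensor \<Omega> T a"
      using fun_cong[OF that, of a] assms(2) by (auto simp: restrict_tensor_def)
  qed
  with assms(1) show ?thesis unfolding recovers_def by blast
qed

lemma completions_of_recovers:
  assumes T: "T \<in> tensors k d" and rec: "recovers T \<Omega>"
  shows "completions k d \<delta> T \<Omega> = {T}"
proof -
  let ?feas = "\<lambda>X. X \<in> tensors k d \<and> restrict_tensor \<Omega> X = restrict_tensor \<Omega> T"
  have less: "star_norm k d \<delta> T < star_norm k d \<delta> X" if "?feas X" "X \<noteq> T" for X
    using rec that by (simp add: recovers_def)
  have "is_arg_min (star_norm k d \<delta>) ?feas X \<longleftrightarrow> X = T" for X
  proof
    assume "is_arg_min (star_norm k d \<delta>) ?feas X"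
    then have X: "?feas X" "\<not> star_norm k d \<delta> T < star_norm k d \<delta> X" using T by (auto simp: is_arg_min_def)
    then show "X = T" using less by blast
  next
    assume "X = T"
    then show "is_arg_min (star_norm k d \<delta>) ?feas X"
      unfolding is_arg_min_def using T less by (metis less_irrefl order_less_trans)
  qed
  then show ?thesis by (auto simp: completions_def)
qed

text \<open>A single list of batches has to serve the dual tensor and all the projected unit
  tensors, so the trajectory bound is united over at most 2 N starting states. Together with the
  factor N in the failure bound of a round this produces the square of N.\<close>

lemma recovery_probability:
  assumes T: "T \<in> tensors k d" "QS {} T = T"
    and W0: "W0 \<in> tensors k d" "QS {} W0 = W0" "circ W0 = 1" "tinner k d W0 T = star_norm k d \<delta> T"
    and M0: "M0 > 0" "M0 \<le> N" "\<And>a. a \<in> G \<Longrightarrow> \<bar>W0 a\<bar> \<le> M0"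
    and B: "\<And>a. a \<in> G \<Longrightarrow> N * tinner k d (Q (e a)) (Q (e a)) \<le> B" and B0: "B > 0"
    and H: "\<And>j1 j2. 1 \<le> j1 \<Longrightarrow> j1 < j2 \<Longrightarrow> j2 \<le> k \<Longrightarrow> N * (\<Prod>j\<in>others j1 j2. \<delta> j) \<le> H * sqrt (pairdim j1 j2)"
      "N \<le> H\<^sup>2" and H0: "H > 0" and g0: "g > 0" and \<epsilon>: "\<epsilon> > 0" and m: "m > 0" and \<Lambda>: "\<Lambda> \<ge> 0"
    and small: "\<And>j1 j2. 1 \<le> j1 \<Longrightarrow> j1 < j2 \<Longrightarrow> j2 \<le> k \<Longrightarrow>
      16 * 2 ^ k * H * (3 / g + pairdim j1 j2 * (6 * \<Lambda>) / (real m * g)) \<le> 2 * \<epsilon> / 3"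
    and L: "8 * 8 ^ k * N ^ 4 < 2 ^ L" and Lm: "L * m \<le> n" and n: "n \<le> card G"
    and m1: "\<Lambda> \<le> real m / (20 * B)"
    and m2: "6 * real (\<Sum>j=1..k. d j) + \<Lambda> \<le> real m * \<epsilon>\<^sup>2 / (36 * 4 ^ k * H\<^sup>2 + 6 * 2 ^ k * H * g * \<epsilon>)"
    and \<epsilon>M: "2 * (2 + 2 * real k) * \<epsilon> * M0 \<le> (1 / 8) ^ k / 2"
  shows "measure_pmf.prob (sample_pmf k d n) {\<Omega>. completions k d \<delta> T \<Omega> = {T}} \<ge> 1 - 6 * (real k)\<^sup>2 * N\<^sup>2 * real L * exp (- \<Lambda>)"
proof -
  \<comment> \<open>The contraction fails with weight 2 and the incoherent norm with weight 2 k^2;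
    their sum is at most 3 k^2 because k^2 is at least 2.\<close>
  define p where "p = 3 * (real k)\<^sup>2 * N * exp (- \<Lambda>)"
  have N1: "1 \<le> N" by (rule N_ge_1)
  have k2': "2 \<le> (real k)\<^sup>2" using k2 power_mono[of 2 "real k" 2] by simp
  let ?X = "nlists m G" and ?good = "golf_good \<epsilon> m" and ?step = "golf_step m"
  have cX: "real (card ?X) = N ^ m" by (simp add: card_nlists)
  have badb: "real (card {xs \<in> ?X. \<not> ?good s xs}) \<le> p * real (card ?X)" if inv: "golf_inv s" for s
  proof -
    define D where "D = fst s"
    define M where "M = snd s"
    have s: "s = (D, M)" by (simp add: D_def M_def)
    have DM: "\<And>a. a \<in> G \<Longrightarrow> \<bar>D a\<bar> \<le> M" "M > 0" using inv by (auto simp: s golf_inv_def)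
    let ?A = "{xs \<in> ?X. \<not> (\<forall>b\<in>G. \<bar>(D - Q (samp m xs D)) b\<bar> \<le> M / 2)}"
    let ?C = "{xs \<in> ?X. \<not> circ (samp m xs D - D) \<le> \<epsilon> * M}"
    have "{xs \<in> ?X. \<not> ?good s xs} = ?A \<union> ?C" by (auto simp: golf_good_def s)
    then have "real (card {xs \<in> ?X. \<not> ?good s xs}) \<le> real (card ?A) + real (card ?C)"
      using card_Un_le[of ?A ?C] by (simp only: of_nat_add[symmetric] of_nat_le_iff)
    also have "real (card ?A) \<le> 2 * N * exp (- \<Lambda>) * N ^ m"
    proof -
      have "real (card ?A) \<le> 2 * N * exp (- (real m / (20 * B))) * N ^ m"
        by (rule contraction_count[OF inv[unfolded s] m B B0])
      also have "\<dots> \<le> 2 * N * exp (- \<Lambda>) * N ^ m" using m1 by (intro mult_right_mono mult_left_mono) auto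
      finally show ?thesis .
    qed
    also have "real (card ?C) \<le> (real k)\<^sup>2 * (2 * N * exp (- \<Lambda>)) * N ^ m"
    proof -
      let ?S = "6 * real (\<Sum>j=1..k. d j)" and ?E = "exp (- (real m * \<epsilon>\<^sup>2 / (36 * 4 ^ k * H\<^sup>2 + 6 * 2 ^ k * H * g * \<epsilon>)))"
      \<comment> \<open>The multiplicity slack is x = 6 \<Lambda>, for which the Chernoff exponent x
        / 6 equals \<Lambda>.\<close>
      have "real (card ?C) \<le> (real k)\<^sup>2 * (exp ?S * ?E + N * exp (- (6 * \<Lambda> / 6))) * N ^ m"
        by (rule circ_count[OF DM H H0 g0 \<epsilon> m _ small]) (use \<Lambda> in auto)
      also have "\<dots> \<le> (real k)\<^sup>2 * (2 * N * exp (- \<Lambda>)) * N ^ m"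
      proof (intro mult_right_mono mult_left_mono)
        have "exp ?S * ?E \<le> exp (- \<Lambda>)" unfolding exp_add[symmetric] using m2 by simp
        also have "\<dots> \<le> N * exp (- \<Lambda>)" using N1 by simp
        finally have "exp ?S * ?E \<le> N * exp (- \<Lambda>)" .
        moreover have "6 * \<Lambda> / 6 = \<Lambda>" by simp
        ultimately show "exp ?S * ?E + N * exp (- (6 * \<Lambda> / 6)) \<le> 2 * N * exp (- \<Lambda>)" by (simp only:)
      qed auto
      finally show ?thesis .
    qed
    finally have "real (card {xs \<in> ?X. \<not> ?good s xs}) \<le> (2 + 2 * (real k)\<^sup>2) * (N * exp (- \<Lambda>) * N ^ m)"
      by (simp add: algebra_simps)
    also have "\<dots> \<le> (3 * (real k)\<^sup>2) * (N * exp (- \<Lambda>) * N ^ m)" using k2' by (intro mult_right_mono) auto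
    finally show ?thesis by (simp add: cX p_def mult_ac)
  qed
  define start where "start = insert (W0, M0) ((\<lambda>a. (Q (e a), 1)) ` G)"
  have fin_start: "finite start" and card_start: "real (card start) \<le> 2 * N"
  proof -
    show "finite start" by (simp add: start_def)
    have "card start \<le> Suc (card ((\<lambda>a. (Q (e a), 1::real)) ` G))" unfolding start_def by (rule card_insert_le_m1) simp_all
    also have "\<dots> \<le> Suc (card G)" by (simp add: card_image_le)
    finally show "real (card start) \<le> 2 * N" using N1 by linarith
  qed
  have inv_start: "golf_inv s" if "s \<in> start" for s
  proof -
    have "\<bar>Q (e a) b\<bar> \<le> 1" if "a \<in> G" "b \<in> G" for a b
    proof -
      have "(Q (e a) b)\<^sup>2 \<le> tinner k d (Q (e a)) (Q (e a))"
        unfolding tinner_def power2_eq_square using that by (intro member_le_sum) auto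
      also have "\<dots> = Q (e a) a" using Q_apply[OF that(1), of "Q (e a)"] by (simp add: Q_Q)
      \<comment> \<open>The diagonal entry of the projection equals a squared norm, which dominates
        its own square, so it is at most 1.\<close>
      also have "\<dots> \<le> 1"
      proof -
        have "(Q (e a) a)\<^sup>2 \<le> tinner k d (Q (e a)) (Q (e a))"
          unfolding tinner_def power2_eq_square using that by (intro member_le_sum) auto
        also have "\<dots> = Q (e a) a" using Q_apply[OF that(1), of "Q (e a)"] by (simp add: Q_Q)
        finally have "Q (e a) a * Q (e a) a \<le> 1 * Q (e a) a" by (simp add: power2_eq_square)
        then show ?thesis by (cases "Q (e a) a > 0") (auto dest: mult_right_le_imp_le)
      qed
      finally show ?thesis by (simp add: abs_square_le_1)
    qed
    moreover have "Q W0 = W0" using W0 by (intro Q_eq_self_if_QS_empty)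
    ultimately show ?thesis using that W0 M0 by (auto simp: start_def golf_inv_def Q_Q Q_tensors)
  qed
  define all_good where "all_good xss \<longleftrightarrow> (\<forall>s\<in>start. traj ?step ?good s xss)" for xss
  have bad_all: "real (card {xss \<in> nlists L ?X. \<not> all_good xss}) \<le> 2 * N * (real L * p * (N ^ m) ^ L)"
  proof -
    have "{xss \<in> nlists L ?X. \<not> all_good xss} = (\<Union>s\<in>start. {xss \<in> nlists L ?X. \<not> traj ?step ?good s xss})"
      by (auto simp: all_good_def)
    also have "real (card \<dots>) \<le> real (card start) * (real L * p * (N ^ m) ^ L)"
    proof (rule card_UN_real_le[OF fin_start])
      fix s assume "s \<in> start"
      then show "real (card {xss \<in> nlists L ?X. \<not> traj ?step ?good s xss}) \<le> real L * p * (N ^ m) ^ L"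
        unfolding cX[symmetric]
        by (intro adaptive_union_bound[where I = golf_inv, OF _ golf_inv_step badb inv_start]) auto
    qed
    also have "\<dots> \<le> 2 * N * (real L * p * (N ^ m) ^ L)"
      by (intro mult_right_mono card_start) (auto simp: p_def)
    finally show ?thesis .
  qed
  have good_rec: "recovers T (set (concat xss))" if xss: "xss \<in> nlists L ?X" "all_good xss" for xss
  proof -
    let ?O = "set (concat xss)"
    have cert: "\<exists>Y\<in>tensors k d. (\<forall>a. a \<notin> ?O \<longrightarrow> Y a = 0) \<and> (\<forall>a\<in>G. \<bar>(fst s - Q Y) a\<bar> \<le> snd s / 2 ^ L) \<and>
      circ (Y - Q Y) \<le> 2 * (2 + 2 * real k) * \<epsilon> * snd s \<and> (\<forall>a\<in>G. \<bar>Y a\<bar> \<le> 2 * N * snd s)" if "s \<in> start" for s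
      using that xss \<epsilon> m by (intro golfing_certificate inv_start) (auto simp: all_good_def)
    obtain Y where Y: "Y \<in> tensors k d" "\<And>a. a \<notin> ?O \<Longrightarrow> Y a = 0" "\<And>a. a \<in> G \<Longrightarrow> \<bar>(W0 - Q Y) a\<bar> \<le> M0 / 2 ^ L"
      "circ (Y - Q Y) \<le> 2 * (2 + 2 * real k) * \<epsilon> * M0" using cert[of "(W0, M0)"] by (auto simp: start_def)
    have "\<exists>Y. (\<forall>b. b \<notin> ?O \<longrightarrow> Y b = 0) \<and> (\<forall>b\<in>G. \<bar>Y b\<bar> \<le> 2 * N) \<and> (\<forall>b\<in>G. \<bar>(Q (e a) - Q Y) b\<bar> \<le> 1 / 2 ^ L)" if "a \<in> G" for a
    proof -
      have "(Q (e a), 1) \<in> start" using that by (simp add: start_def)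
      from cert[OF this] show ?thesis unfolding fst_conv snd_conv mult_1_right by blast
    qed
    then obtain Ye where Ye: "\<And>a b. a \<in> G \<Longrightarrow> b \<notin> ?O \<Longrightarrow> Ye a b = 0"
      "\<And>a b. a \<in> G \<Longrightarrow> b \<in> G \<Longrightarrow> \<bar>Ye a b\<bar> \<le> 2 * N"
      "\<And>a b. a \<in> G \<Longrightarrow> b \<in> G \<Longrightarrow> \<bar>(Q (e a) - Q (Ye a)) b\<bar> \<le> 1 / 2 ^ L" by metis
    have "star_norm k d \<delta> T < star_norm k d \<delta> X"
      if X: "X \<in> tensors k d" "restrict_tensor ?O X = restrict_tensor ?O T" "X \<noteq> T" for X
    proof (rule star_norm_less_of_certificate[OF T(1) Q_eq_self_if_QS_empty[OF T] W0 Y(2,1) _ _ Ye _ _ X])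
      fix a assume "a \<in> G"
      then have "\<bar>(W0 - Q Y) a\<bar> \<le> M0 / 2 ^ L" by (rule Y(3))
      also have "\<dots> \<le> N / 2 ^ L" using M0 by (intro divide_right_mono) auto
      finally show "\<bar>(W0 - Q Y) a\<bar> \<le> N * (1 / 2 ^ L)" by simp
    next
      show "circ (Y - Q Y) \<le> (1 / 8) ^ k / 2" using Y(4) \<epsilon>M by linarith
    next
      show "8 * 8 ^ k * N ^ 4 * (1 / 2 ^ L) < 1" using L by simp
    qed auto
    then show ?thesis by (simp add: recovers_def)
  qed
  let ?g = "\<lambda>\<Omega>. of_bool (recovers T \<Omega>) :: real"
  have gmono: "?g \<Omega> \<le> ?g \<Omega>'" if "\<Omega> \<subseteq> \<Omega>'" "\<Omega>' \<subseteq> G" for \<Omega> \<Omega>' :: "(nat \<Rightarrow> nat) set"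
    using recovers_mono[of T \<Omega> \<Omega>'] that by auto
  have NLm: "(N ^ m) ^ L = N ^ (L * m)" by (simp add: power_mult[symmetric] mult.commute)
  have "(1 - 2 * N * real L * p) * N ^ (L * m) \<le> real (card {xss \<in> nlists L ?X. all_good xss})"
  proof -
    have "real (card (nlists L ?X)) = real (card {xss \<in> nlists L ?X. all_good xss}) + real (card {xss \<in> nlists L ?X. \<not> all_good xss})"
      unfolding of_nat_add[symmetric] by (subst card_Un_disjoint[symmetric]) (auto intro!: arg_cong[of _ _ card])
    moreover have "real (card (nlists L ?X)) = N ^ (L * m)" by (simp add: card_nlists NLm[symmetric])
    ultimately show ?thesis using bad_all unfolding NLm by (simp add: algebra_simps)
  qed
  also have "\<dots> \<le> real (card {xss \<in> nlists L ?X. recovers T (set (concat xss))})"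
    by (intro of_nat_mono card_mono) (auto dest: good_rec)
  also have "\<dots> \<le> real (card {xs \<in> nlists (L * m) G. recovers T (set xs)})"
    by (intro of_nat_mono card_nlists_concat_le) simp
  also have "\<dots> = (\<Sum>xs\<in>nlists (L * m) G. ?g (set xs))" by (intro card_filter_real finite_nlists finite_grid)
  finally have "1 - 2 * N * real L * p \<le> (\<Sum>xs\<in>nlists (L * m) G. ?g (set xs)) / N ^ (L * m)"
    using N1 by (simp add: pos_le_divide_eq)
  \<comment> \<open>Monotonicity is used twice: to discard multiplicities at sample size L * m, and
    then to enlarge the subset to size n.\<close>
  also have "\<dots> \<le> (\<Sum>\<Omega>\<in>nsub (L * m) G. ?g \<Omega>) / real (card G choose (L * m))"
    using Lm n by (intro nlists_average_le_nsub gmono) auto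
  also have "\<dots> \<le> (\<Sum>\<Omega>\<in>nsub n G. ?g \<Omega>) / real (card G choose n)"
    using Lm n by (intro nsub_average_mono gmono) auto
  also have "\<dots> = real (card {\<Omega> \<in> nsub n G. recovers T \<Omega>}) / real (card (nsub n G))"
    by (simp only: card_filter_real[OF finite_nsub[OF finite_grid]] card_nsub[OF finite_grid])
  also have "\<dots> \<le> real (card (nsub n G \<inter> {\<Omega>. completions k d \<delta> T \<Omega> = {T}})) / real (card (nsub n G))"
    by (intro divide_right_mono of_nat_mono card_mono) (auto simp: completions_of_recovers T)
  also have "\<dots> = measure_pmf.prob (sample_pmf k d n) {\<Omega>. completions k d \<delta> T \<Omega> = {T}}"
  proof -
    have "card (nsub n G) > 0" using n by (simp add: card_nsub)
    then have "nsub n G \<noteq> {}" by auto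
    then have "measure_pmf.prob (pmf_of_set (nsub n G)) A = real (card (nsub n G \<inter> A)) / real (card (nsub n G))" for A
      by (intro measure_pmf_of_set) simp_all
    then show ?thesis by (simp add: sample_pmf_def nsub_def)
  qed
  finally show ?thesis by (simp add: p_def power2_eq_square mult_ac)
qed

end

subsection \<open>Orthogonal projections onto fiber spaces\<close>

definition ip :: "nat \<Rightarrow> vect \<Rightarrow> vect \<Rightarrow> real" where
  "ip m u v = (\<Sum>i=1..m. u i * v i)"

lemma ip_commute: "ip m u v = ip m v u" by (simp add: ip_def mult.commute)

lemma ip_add_left: "ip m (u + v) w = ip m u w + ip m v w" by (simp add: ip_def distrib_right sum.distrib)

lemma ip_diff_left: "ip m (u - v) w = ip m u w - ip m v w"
  by (simp add: ip_def left_diff_distrib sum_subtractf)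

lemma ip_scale_left: "ip m (c *\<^sub>R u) w = c * ip m u w"
  by (simp add: ip_def scaleR_fun_def sum_distrib_left mult.assoc)

lemma ip_diff_right: "ip m w (u - v) = ip m w u - ip m w v"
  by (simp add: ip_def right_diff_distrib sum_subtractf)

lemma ip_scale_right: "ip m w (c *\<^sub>R u) = c * ip m w u"
  by (simp add: ip_def scaleR_fun_def sum_distrib_left mult_ac)

lemma ip_self_nonneg: "0 \<le> ip m u u" by (simp add: ip_def sum_nonneg)

lemma ip_self_eq_0: "ip m u u = 0 \<Longrightarrow> i \<in> {1..m} \<Longrightarrow> u i = 0" by (simp add: ip_def sum_nonneg_eq_0_iff)

text \<open>On arbitrary functions \<open>ip\<close> is only semidefinite; a null vector vanishes on
  the index range and is orthogonal to everything. This covers the degenerate step of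
  Gram-Schmidt.\<close>

lemma ip_eq_0_of_self: "ip m u u = 0 \<Longrightarrow> ip m w u = 0"
  unfolding ip_def[of m w] by (rule sum.neutral) (auto dest: ip_self_eq_0)

lemma ip_cauchy_schwarz: "\<bar>ip m u v\<bar> \<le> sqrt (ip m u u) * sqrt (ip m v v)"
proof -
  have "(ip m u v)\<^sup>2 \<le> ip m u u * ip m v v"
    using Cauchy_Schwarz_ineq_sum[of u v "{1..m}"] by (simp add: ip_def power2_eq_square)
  then have "\<bar>ip m u v\<bar> \<le> sqrt (ip m u u * ip m v v)" by (simp add: real_le_rsqrt)
  then show ?thesis by (simp add: real_sqrt_mult)
qed

lemma orth_proj_exists:
  assumes "finite B"
  shows "\<exists>v\<in>span B. \<forall>w\<in>span B. ip m (u - v) w = 0" using assms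
proof (induction B arbitrary: u rule: finite_induct)
  case empty
  then show ?case by (simp add: ip_def)
next
  case (insert b B)
  obtain b0 where b0: "b0 \<in> span B" "\<And>w. w \<in> span B \<Longrightarrow> ip m (b - b0) w = 0" using insert.IH[of b] by blast
  obtain v0 where v0: "v0 \<in> span B" "\<And>w. w \<in> span B \<Longrightarrow> ip m (u - v0) w = 0" using insert.IH[of u] by blast
  \<comment> \<open>Gram-Schmidt: the new generator is first made orthogonal to
    \<open>span B\<close>. If nothing of it remains, \<open>t\<close> defaults to 0 by division by
    zero and \<open>b'\<close> is orthogonal to everything anyway.\<close>
  define b' where "b' = b - b0"
  define t where "t = ip m u b' / ip m b' b'"
  have sub: "span B \<subseteq> span (insert b B)" by (rule span_mono) auto
  have b'_in: "b' \<in> span (insert b B)"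
    unfolding b'_def using b0 sub by (intro span_diff) (auto intro: span_base)
  have orth: "ip m (u - (v0 + t *\<^sub>R b')) b' = 0"
  proof (cases "ip m b' b' = 0")
    case True
    then show ?thesis by (rule ip_eq_0_of_self)
  next
    case False
    have "ip m v0 b' = 0" using b0(2)[OF v0(1)] by (simp add: b'_def ip_commute)
    then show ?thesis using False by (simp add: ip_diff_left ip_add_left ip_scale_left t_def)
  qed
  show ?case
  proof (intro bexI[of _ "v0 + t *\<^sub>R b'"] ballI)
    fix w assume "w \<in> span (insert b B)"
    then obtain c where "w - c *\<^sub>R b \<in> span B" by (auto simp: span_insert)
    then have "(w - c *\<^sub>R b) + c *\<^sub>R b0 \<in> span B" by (intro span_add span_scale b0(1))
    also have "(w - c *\<^sub>R b) + c *\<^sub>R b0 = w - c *\<^sub>R b'" unfolding b'_def scaleR_right_diff_distrib by simp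
    finally have s: "w - c *\<^sub>R b' \<in> span B" .
    have "ip m (u - (v0 + t *\<^sub>R b')) (w - c *\<^sub>R b') = 0"
      using v0(2)[OF s] b0(2)[OF s] by (simp add: ip_diff_left ip_add_left ip_scale_left b'_def)
    then show "ip m (u - (v0 + t *\<^sub>R b')) w = 0" using orth unfolding ip_diff_right ip_scale_right by simp
  next
    show "v0 + t *\<^sub>R b' \<in> span (insert b B)" using v0 b'_in sub by (intro span_add span_scale) auto
  qed
qed

lemma vecs_subspace: "subspace (vecs m)" by (auto simp: subspace_def vecs_def scaleR_fun_def)

locale finite_span =
  fixes m :: nat and B :: "vect set" and V :: "vect set"
  assumes fin: "finite B" and B: "B \<subseteq> vecs m" and V: "V = span B"
begin

lemma V_vecs: "V \<subseteq> vecs m" unfolding V using B vecs_subspace by (rule span_minimal)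

lemma orth_proj_eqI:
  assumes "v \<in> V" "\<And>w. w \<in> V \<Longrightarrow> ip m (u - v) w = 0"
  shows "orth_proj m V u = v" unfolding orth_proj_def
proof (rule the_equality)
  show "v \<in> V \<and> (\<forall>w\<in>V. (\<Sum>i=1..m. (u i - v i) * w i) = 0)" using assms by (simp add: ip_def)
next
  fix v' assume v': "v' \<in> V \<and> (\<forall>w\<in>V. (\<Sum>i=1..m. (u i - v' i) * w i) = 0)"
  have in_V: "v - v' \<in> V" using v' assms(1) unfolding V by (blast intro: span_diff)
  have "(\<Sum>i=1..m. (u i - v' i) * (v - v') i) = 0" using v' in_V by blast
  then have "ip m (u - v') (v - v') = 0" by (simp add: ip_def)
  moreover have "ip m (u - v) (v - v') = 0" using assms(2) in_V by blast
  ultimately have "ip m (v - v') (v - v') = 0" unfolding ip_diff_left by linarith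
  then have "(v - v') i = 0" for i
    using ip_self_eq_0[of m "v - v'" i] in_V V_vecs by (cases "i \<in> {1..m}") (auto simp: vecs_def)
  then show "v' = v" by (auto simp: fun_eq_iff)
qed

lemma orth_proj_mem: "orth_proj m V u \<in> V"
  and orth_proj_orth: "w \<in> V \<Longrightarrow> ip m (u - orth_proj m V u) w = 0"
proof -
  obtain v where v: "v \<in> V" "\<And>w. w \<in> V \<Longrightarrow> ip m (u - v) w = 0" using orth_proj_exists[OF fin] V by blast
  then have "orth_proj m V u = v" by (rule orth_proj_eqI)
  with v show "orth_proj m V u \<in> V" "w \<in> V \<Longrightarrow> ip m (u - orth_proj m V u) w = 0" by simp_all
qed

lemma orth_proj_self: "u \<in> V \<Longrightarrow> orth_proj m V u = u" by (rule orth_proj_eqI) (simp_all add: ip_def)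

lemma orth_proj_diff: "orth_proj m V (u - v) = orth_proj m V u - orth_proj m V v"
proof (rule orth_proj_eqI)
  show "orth_proj m V u - orth_proj m V v \<in> V" using orth_proj_mem unfolding V by (blast intro: span_diff)
  fix w assume "w \<in> V"
  then show "ip m (u - v - (orth_proj m V u - orth_proj m V v)) w = 0"
    using orth_proj_orth[of w u] orth_proj_orth[of w v] unfolding ip_diff_left by linarith
qed

lemma orth_proj_sym: "ip m (orth_proj m V u) v = ip m u (orth_proj m V v)"
proof -
  have "ip m (v - orth_proj m V v) (orth_proj m V u) = 0" "ip m (u - orth_proj m V u) (orth_proj m V v) = 0"
    by (intro orth_proj_orth orth_proj_mem)+
  then show ?thesis
    unfolding ip_diff_left by (simp add: ip_commute[of m v] ip_commute[of m "orth_proj m V v"])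
qed

lemma dim_pos:
  assumes "f \<in> V" "f \<noteq> 0"
  shows "dim V > 0"
proof (rule ccontr)
  assume "\<not> dim V > 0"
  obtain A where A: "A \<subseteq> V" "independent A" "V \<subseteq> span A" "card A = dim V" by (rule basis_exists)
  \<comment> \<open>An infinite basis would also have cardinality 0; the finite spanning set
    excludes it.\<close>
  then have "finite A" using independent_span_bound[OF fin, of A] V by auto
  then have "A = {}" using A \<open>\<not> dim V > 0\<close> by simp
  then show False using A(3) assms by auto
qed

end

section \<open>Fibers and mode projections of the target tensor\<close>

lemma sum_grid_upd:
  fixes f :: "(nat \<Rightarrow> nat) \<Rightarrow> real"
  assumes j: "j \<in> {1..k}"
  shows "(\<Sum>a\<in>grid k d. \<Sum>i=1..d j. f (a(j := i))) = real (d j) * (\<Sum>a\<in>grid k d. f a)"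
proof -
  have upd: "a(j := i) \<in> grid k d" if "a \<in> grid k d" "i \<in> {1..d j}" for a i
    using that j unfolding grid_def by (auto simp: PiE_def extensional_def)
  have "(\<Sum>a\<in>grid k d. \<Sum>i=1..d j. f (a(j := i))) = (\<Sum>(a, i)\<in>grid k d \<times> {1..d j}. f (a(j := i)))"
    by (rule sum.cartesian_product)
  also have "\<dots> = (\<Sum>(a, i)\<in>grid k d \<times> {1..d j}. f a)"
    \<comment> \<open>Exchanging i with the j-th coordinate of a is an involution on the
      pairs.\<close>
    by (rule sum.reindex_bij_witness[of _ "\<lambda>(a, i). (a(j := i), a j)" "\<lambda>(a, i). (a(j := i), a j)"])
       (use upd gridD[OF _ j] in auto)
  also have "\<dots> = (\<Sum>a\<in>grid k d. \<Sum>i=1..d j. f a)" by (rule sum.cartesian_product[symmetric])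
  finally show ?thesis by (simp add: sum_distrib_left)
qed

text \<open>Summation over mode j alone pairs \<open>u j\<close> with a fiber. Overcounting by the
  factor \<open>d j\<close> keeps the full grid as index set instead of deleting a
  coordinate.\<close>

lemma mform_fiber_orthogonal:
  assumes j: "j \<in> {1..k}" "d j \<ge> 1" and orth: "\<And>a. a \<in> grid k d \<Longrightarrow> ip (d j) (u j) (\<lambda>i. T (a(j := i))) = 0"
  shows "mform k d T u = 0"
proof -
  have "real (d j) * mform k d T u = (\<Sum>a\<in>grid k d. \<Sum>i=1..d j. T (a(j := i)) * (\<Prod>l=1..k. u l ((a(j := i)) l)))"
    unfolding mform_def by (rule sum_grid_upd[OF j(1), symmetric])
  also have "\<dots> = (\<Sum>a\<in>grid k d. ip (d j) (u j) (\<lambda>i. T (a(j := i))) * (\<Prod>l\<in>{1..k} - {j}. u l (a l)))"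
  proof (rule sum.cong[OF refl])
    fix a
    have *: "(\<Prod>l=1..k. u l ((a(j := i)) l)) = u j i * (\<Prod>l\<in>{1..k} - {j}. u l (a l))" for i
      using j by (subst prod.remove[of _ j]) (auto intro!: prod.cong)
    show "(\<Sum>i=1..d j. T (a(j := i)) * (\<Prod>l=1..k. u l ((a(j := i)) l)))
      = ip (d j) (u j) (\<lambda>i. T (a(j := i))) * (\<Prod>l\<in>{1..k} - {j}. u l (a l))"
      unfolding * ip_def sum_distrib_right by (rule sum.cong) simp_all
  qed
  also have "\<dots> = 0" by (rule sum.neutral) (simp add: orth)
  finally show ?thesis using j by simp
qed

text \<open>\<open>\<sigma>\<close> stands for the product of the regularity parameter and
  \<open>r_star\<close>; the weights \<open>\<delta> j\<close> depend on these two only through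
  it.\<close>

locale completion_setup =
  fixes k :: nat and d :: "nat \<Rightarrow> nat" and \<delta> :: "nat \<Rightarrow> real" and T :: tensor and \<sigma> :: real
  assumes k: "2 \<le> k" and dp: "\<And>j. j \<in> {1..k} \<Longrightarrow> 1 \<le> d j"
    and T: "T \<in> tensors k d" "T \<noteq> 0"
    and coh: "\<And>j. j \<in> {1..k} \<Longrightarrow> coherence k d T j * real (tucker_rank k d T j) \<le> \<sigma>"
    and \<delta>: "\<And>j. j \<in> {1..k} \<Longrightarrow> \<delta> j = sqrt (\<sigma> / real (d j))"
begin

abbreviation "fibers j \<equiv> {(\<lambda>i. T (a(j := i))) |a. a \<in> grid k d}"

lemma fiber_span:
  assumes j: "j \<in> {1..k}"
  shows "finite_span (d j) (fibers j) (fiber_space k d T j)"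
proof
  show "finite (fibers j)" by simp
  have "a(j := i) \<notin> grid k d" if "i \<notin> {1..d j}" for a i using that gridD[OF _ j, of "a(j := i)" d] by auto
  then show "fibers j \<subseteq> vecs (d j)" using T by (auto simp: vecs_def tensors_def)
qed (simp add: fiber_space_def)

lemma fiber_mem: "a \<in> grid k d \<Longrightarrow> (\<lambda>i. T (a(j := i))) \<in> fiber_space k d T j"
  unfolding fiber_space_def by (rule span_base) auto

abbreviation "P \<equiv> mode_proj k d T"

lemma nonzero_fiber:
  obtains f where "f \<in> fiber_space k d T j" "f \<noteq> 0"
proof -
  obtain a where a: "T a \<noteq> 0" using T by (auto simp: fun_eq_iff)
  then have "a \<in> grid k d" using T by (auto simp: tensors_def)
  moreover have "(\<lambda>i. T (a(j := i))) \<noteq> 0"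
  proof
    assume "(\<lambda>i. T (a(j := i))) = 0"
    from fun_cong[OF this, of "a j"] show False using a by simp
  qed
  ultimately show thesis using that fiber_mem by blast
qed

lemma proj_unitv_le:
  assumes j: "j \<in> {1..k}" and i: "i \<in> {1..d j}"
  shows "sqrt (ip (d j) (P j (unitv i)) (P j (unitv i))) \<le> \<delta> j"
proof -
  interpret finite_span "d j" "fibers j" "fiber_space k d T j" by (rule fiber_span[OF j])
  obtain f where "f \<in> fiber_space k d T j" "f \<noteq> 0" by (rule nonzero_fiber)
  \<comment> \<open>With rank 0 the coherence would default to 0 by division by zero and bound
    nothing; positivity lets the rank cancel.\<close>
  then have "tucker_rank k d T j > 0" unfolding tucker_rank_def by (rule dim_pos)
  define mx where "mx = (MAX i\<in>{1..d j}. (L2_set (P j (unitv i)) {1..d j})\<^sup>2)"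
  have "coherence k d T j * real (tucker_rank k d T j) = real (d j) * mx"
    using \<open>tucker_rank k d T j > 0\<close> by (simp add: coherence_def mx_def)
  then have "mx \<le> \<sigma> / real (d j)" using coh[OF j] dp[OF j] by (simp add: pos_le_divide_eq mult.commute)
  moreover have "(L2_set (P j (unitv i)) {1..d j})\<^sup>2 \<le> mx" unfolding mx_def using i by (intro Max_ge) auto
  moreover have "(L2_set (P j (unitv i)) {1..d j})\<^sup>2 = ip (d j) (P j (unitv i)) (P j (unitv i))"
    by (simp add: L2_set_def ip_def sum_nonneg power2_eq_square)
  ultimately show ?thesis unfolding \<delta>[OF j] by (intro real_sqrt_le_mono) linarith
qed

text \<open>An entry of the projection is the inner product of u with a projected unit vector;
  Cauchy-Schwarz and the coherence bound finish.\<close>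

lemma proj_incoherent:
  assumes j: "j \<in> {1..k}" and i: "i \<in> {1..d j}"
  shows "\<bar>P j u i\<bar> \<le> \<delta> j * sqrt (\<Sum>i=1..d j. (u i)\<^sup>2)"
proof -
  interpret finite_span "d j" "fibers j" "fiber_space k d T j" by (rule fiber_span[OF j])
  have "P j u i = ip (d j) (P j u) (unitv i)"
  proof -
    have "ip (d j) (P j u) (unitv i) = (\<Sum>l=1..d j. if l = i then P j u l else 0)"
      unfolding ip_def by (intro sum.cong) (auto simp: unitv_def)
    then show ?thesis using i by simp
  qed
  also have "\<dots> = ip (d j) u (P j (unitv i))" unfolding mode_proj_def by (rule orth_proj_sym)
  finally have "\<bar>P j u i\<bar> \<le> sqrt (ip (d j) u u) * sqrt (ip (d j) (P j (unitv i)) (P j (unitv i)))"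
    by (simp only: ip_cauchy_schwarz)
  also have "\<dots> \<le> sqrt (ip (d j) u u) * \<delta> j"
    using ip_self_nonneg by (intro mult_left_mono[OF proj_unitv_le[OF j i]] real_sqrt_ge_zero)
  finally show ?thesis by (simp add: ip_def power2_eq_square mult.commute)
qed

text \<open>A nonzero fiber f is fixed by its projection, so each squared entry is at most \<sigma>
  / d_1 times |f|^2. Summing over the d_1 entries gives |f|^2 \<le> \<sigma> |f|^2.\<close>

lemma \<sigma>_ge_1: "1 \<le> \<sigma>"
proof -
  have j: "1 \<in> {1..k}" using k by simp
  interpret finite_span "d 1" "fibers 1" "fiber_space k d T 1" by (rule fiber_span[OF j])
  obtain f where f: "f \<in> fiber_space k d T 1" "f \<noteq> 0" by (rule nonzero_fiber)
  have Pf: "P 1 f = f" unfolding mode_proj_def using f by (intro orth_proj_self)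
  define s where "s = (\<Sum>i=1..d 1. (f i)\<^sup>2)"
  have s: "s > 0"
  proof (rule ccontr)
    assume "\<not> s > 0"
    then have "s = 0" using sum_nonneg[of "{1..d 1}" "\<lambda>i. (f i)\<^sup>2"] by (simp add: s_def)
    then have "f i = 0" for i
      using f(1) V_vecs by (cases "i \<in> {1..d 1}") (auto simp: s_def sum_nonneg_eq_0_iff vecs_def)
    then show False using f by auto
  qed
  have d1: "1 \<le> d 1" using dp[OF j] .
  \<comment> \<open>Nonnegativity comes first: for negative \<sigma> the square of
    \<open>\<delta> 1\<close> would not be \<sigma> / d_1.\<close>
  have \<sigma>0: "0 \<le> \<sigma>"
  proof -
    have "0 \<le> coherence k d T 1 * real (tucker_rank k d T 1)"
      unfolding coherence_def using d1 by (intro mult_nonneg_nonneg) (auto simp: Max_ge_iff intro!: exI[of _ 1])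
    then show ?thesis using coh[OF j] by linarith
  qed
  have "s \<le> (\<Sum>i=1..d 1. (\<delta> 1)\<^sup>2 * s)" unfolding s_def
  proof (rule sum_mono)
    fix i assume i: "i \<in> {1..d 1}"
    have "\<bar>f i\<bar> \<le> \<delta> 1 * sqrt (\<Sum>i=1..d 1. (f i)\<^sup>2)" using proj_incoherent[OF j i, of f] by (simp add: Pf)
    then have "\<bar>f i\<bar>\<^sup>2 \<le> (\<delta> 1 * sqrt (\<Sum>i=1..d 1. (f i)\<^sup>2))\<^sup>2" by (intro power_mono) auto
    then show "(f i)\<^sup>2 \<le> (\<delta> 1)\<^sup>2 * (\<Sum>i=1..d 1. (f i)\<^sup>2)" by (simp add: power_mult_distrib sum_nonneg)
  qed
  also have "\<dots> = \<sigma> * s" using d1 \<sigma>0 by (simp add: \<delta>[OF j])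
  finally show ?thesis using s by simp
qed

sublocale tensor_proj k d \<delta> P
proof
  show "2 \<le> k" by (rule k)
  fix j assume j: "j \<in> {1..k}"
  show "1 \<le> d j" by (rule dp[OF j])
  have "1 / sqrt (real (d j)) = sqrt (1 / real (d j))" by (simp add: real_sqrt_divide)
  also have "\<dots> \<le> \<delta> j" unfolding \<delta>[OF j] using \<sigma>_ge_1 by (intro real_sqrt_le_mono divide_right_mono) auto
  finally show "1 / sqrt (real (d j)) \<le> \<delta> j" .
  interpret finite_span "d j" "fibers j" "fiber_space k d T j" by (rule fiber_span[OF j])
  fix u v assume u: "u \<in> vecs (d j)" and v: "v \<in> vecs (d j)"
  show "P j u \<in> vecs (d j)" using orth_proj_mem V_vecs unfolding mode_proj_def by blast
  show "(\<Sum>i=1..d j. P j u i * v i) = (\<Sum>i=1..d j. u i * P j v i)"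
    using orth_proj_sym[of u v] unfolding ip_def mode_proj_def .
  show "P j (P j u) = P j u" unfolding mode_proj_def by (intro orth_proj_self orth_proj_mem)
  show "P j (u - v) = P j u - P j v" unfolding mode_proj_def by (rule orth_proj_diff)
  show "\<bar>P j u i\<bar> \<le> \<delta> j * sqrt (\<Sum>i=1..d j. (u i)\<^sup>2)" if "i \<in> {1..d j}" for i
    by (rule proj_incoherent[OF j that])
qed

lemma Q0_eq: "Q0 k d T X = QS {} X" by (simp add: Q0_def QS_def)

lemma QT_eq: "QT k d T X = Q X"
proof -
  have "(mode_proj k d T)(j := mode_proj_perp k d T j) = (\<lambda>l. if l \<in> {j} then (\<lambda>u. u - P l u) else P l)" for j
    by (auto simp: mode_proj_perp_def[abs_def])
  then show ?thesis by (simp only: QT_def Q_def Q0_eq) (simp only: QS_def)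
qed

text \<open>A complementary factor is orthogonal to all fibers of its mode, so only the term with S
  empty survives in the expansion of the form.\<close>

lemma QS_empty_T: "QS {} T = T"
proof (rule tensor_eqI[OF QS_tensors T(1)])
  fix u assume u: "vfam u"
  have zero: "form T (mix S u) = 0" if S: "S \<subseteq> {1..k}" "S \<noteq> {}" for S
  proof -
    obtain j where j: "j \<in> S" using S by blast
    then have jk: "j \<in> {1..k}" using S by blast
    interpret finite_span "d j" "fibers j" "fiber_space k d T j" by (rule fiber_span[OF jk])
    show ?thesis
    proof (rule mform_fiber_orthogonal[of j k d "mix S u" T, OF jk dp[OF jk]])
      fix a assume "a \<in> grid k d"
      then show "ip (d j) (mix S u j) (\<lambda>i. T (a(j := i))) = 0"
        using orth_proj_orth[OF fiber_mem, of a "u j"] j unfolding mix_def mode_proj_def by simp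
    qed
  qed
  have "form T u = (\<Sum>S\<in>Pow {1..k}. form T (mix S u))" by (rule form_expand_mix)
  also have "\<dots> = (\<Sum>S\<in>{{}}. form T (mix S u))" by (rule sum.mono_neutral_right) (use zero in auto)
  finally show "form (QS {} T) u = form T u" by (simp add: form_QS[OF u])
qed

end

subsection \<open>Choice of the sample size\<close>

text \<open>The numerical demands of \<open>recovery_probability\<close>, with t the average
  dimension and K the incoherence constant H times the largest entry of the dual tensor. After the
  conditions on L, the lower bounds on m serve the entrywise contraction, the pair multiplicities
  and the union over the lattice; the last clause is the failure probability.\<close>

definition batch_plan :: "nat \<Rightarrow> real \<Rightarrow> real \<Rightarrow> real \<Rightarrow> real \<Rightarrow> real \<Rightarrow> nat \<Rightarrow> nat \<Rightarrow> nat \<Rightarrow> real \<Rightarrow> bool" where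
  "batch_plan k t N B K \<beta> n L m \<Lambda> \<longleftrightarrow> \<Lambda> \<ge> 0 \<and> m > 0 \<and> L * m \<le> n \<and> 8 * 8 ^ k * N ^ 4 < 2 ^ L \<and> 20 * B * \<Lambda> \<le> real m \<and>
     2 * (real k)\<^sup>2 * K * t powr (3 / 2) * \<Lambda> \<le> real m \<and>
     900 * 4 ^ k * (K\<^sup>2 + K * sqrt t) * (6 * (real k * t) + \<Lambda>) \<le> real m * (1 / (8 * (real k + 1) * 8 ^ k))\<^sup>2 \<and>
     6 * (real k)\<^sup>2 * N\<^sup>2 * real L * exp (- \<Lambda>) \<le> t powr (- \<beta>)"

text \<open>With t at least 1 + 1/k its logarithm is bounded below by \<open>l0\<close>, so additive
  constants are absorbed into multiples of \<open>ln t\<close>. As \<open>l0\<close> depends on k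
  alone, so does c.\<close>

lemma sample_size_choice:
  fixes k :: nat
  assumes k: "k \<ge> 2"
  shows "\<exists>c>0. \<forall>(t::real) (N::real) (B::real) (K::real) (\<beta>::real) (n::nat).
    1 + 1 / real k \<le> t \<longrightarrow> 1 \<le> N \<longrightarrow> N \<le> (real k * t) ^ k \<longrightarrow> 1 \<le> B \<longrightarrow> 0 \<le> K \<longrightarrow> 0 < \<beta> \<longrightarrow>
    real n \<ge> c * (1 + \<beta>) * ((B / real k + K\<^sup>2 * t) * (ln t)\<^sup>2 + K * t powr (3 / 2) * (ln t)\<^sup>2) \<longrightarrow>
    (\<exists>L m \<Lambda>. batch_plan k t N B K \<beta> n L m \<Lambda>)"
proof -
  define l0 where "l0 = ln (1 + 1 / real k)"
  have k0: "real k > 0" "real k \<ge> 2" using k by auto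
  have l0: "l0 > 0" using k0 by (simp add: l0_def ln_gt_zero)
  define \<epsilon> where "\<epsilon> = 1 / (8 * (real k + 1) * 8 ^ k)"
  have \<epsilon>: "\<epsilon> > 0" using k0 by (simp add: \<epsilon>_def)
  \<comment> \<open>\<open>Nc\<close>, \<open>L0\<close> and \<open>\<Lambda>0\<close> are the
    coefficients in ln N \<le> Nc ln t, L \<le> L0 ln t and \<Lambda> = \<Lambda>0 (1 + \<beta>) ln
    t.\<close>
  define Nc where "Nc = real k * (ln (real k) / l0 + 1)"
  have Nc: "Nc \<ge> 0" using k0 l0 by (simp add: Nc_def)
  define L0 where "L0 = ((real k + 1) * ln 8 / l0 + 4 * Nc) / ln 2 + 2 / l0 + 1"
  have L0: "L0 \<ge> 1" using Nc l0 k0 by (simp add: L0_def)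
  define \<Lambda>0 where "\<Lambda>0 = ln (6 * (real k)\<^sup>2) / l0 + 2 * Nc + L0"
  have k6: "6 * (real k)\<^sup>2 \<ge> 1" using power_mono[of 2 "real k" 2] k0 by simp
  then have \<Lambda>0: "\<Lambda>0 \<ge> 1" using Nc l0 L0 by (simp add: \<Lambda>0_def add_increasing)
  define C2 where "C2 = 900 * 4 ^ k * (6 * real k + \<Lambda>0) / \<epsilon>\<^sup>2"
  have C2: "C2 > 0" using \<epsilon> k0 \<Lambda>0 by (simp add: C2_def)
  \<comment> \<open>A sum of the constants demanded by the contraction, the pair multiplicities, the
    lattice union and \<open>L \<le> n\<close>, so that it dominates each of them.\<close>
  define c where "c = 40 * real k * L0 * \<Lambda>0 + 4 * (real k)\<^sup>2 * L0 * \<Lambda>0 + 2 * L0 * C2 / l0 + real k * L0 / l0"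
  have cparts: "40 * real k * L0 * \<Lambda>0 \<ge> 0" "4 * (real k)\<^sup>2 * L0 * \<Lambda>0 \<ge> 0" "2 * L0 * C2 / l0 \<ge> 0" "real k * L0 / l0 > 0"
    using k0 L0 \<Lambda>0 C2 l0 by (auto intro!: mult_nonneg_nonneg divide_nonneg_pos divide_pos_pos mult_pos_pos)
  have c: "c \<ge> 40 * real k * L0 * \<Lambda>0" "c \<ge> 4 * (real k)\<^sup>2 * L0 * \<Lambda>0" "c \<ge> 2 * L0 * C2 / l0" "c \<ge> real k * L0 / l0" "c > 0"
    unfolding c_def using cparts by linarith+
  show ?thesis
  proof (intro exI[of _ c] conjI c(5) allI impI)
    fix t N B K \<beta> :: real and n :: nat
    assume t: "1 + 1 / real k \<le> t" and N: "1 \<le> N" "N \<le> (real k * t) ^ k" and B: "1 \<le> B" and K: "0 \<le> K" and \<beta>: "0 < \<beta>"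
      and n: "real n \<ge> c * (1 + \<beta>) * ((B / real k + K\<^sup>2 * t) * (ln t)\<^sup>2 + K * t powr (3 / 2) * (ln t)\<^sup>2)"
    define l where "l = ln t"
    have t1: "t > 1" using t k0 by (smt (verit) divide_pos_pos)
    have l: "l \<ge> l0" unfolding l_def l0_def using t k0 t1 by (intro ln_mono) (auto intro: add_pos_pos)
    have l_pos: "l > 0" using l l0 by simp
    have lt: "l \<le> t" using ln_le_minus_one[of t] t1 by (simp add: l_def)
    have scale: "x \<le> x / l0 * l" if "x \<ge> 0" for x
    proof -
      have "x * l0 \<le> x * l" using that l by (intro mult_left_mono) auto
      then show ?thesis using l0 by (simp add: pos_le_divide_eq)
    qed
    define U where "U = K * t powr (3 / 2)"
    have U: "U \<ge> 0" using K by (simp add: U_def)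
    have V: "K\<^sup>2 * t \<ge> 0" using t1 by simp
    have lnN: "ln N \<le> Nc * l"
    proof -
      have "ln N \<le> ln ((real k * t) ^ k)" using N by (intro ln_mono) auto
      also have "\<dots> = real k * (ln (real k) + l)" using k0 t1 by (simp add: ln_realpow ln_mult l_def)
      also have "\<dots> \<le> real k * (ln (real k) / l0 * l + l)" using scale[of "ln (real k)"] k0 by (intro mult_left_mono) auto
      also have "\<dots> = Nc * l" by (simp add: Nc_def algebra_simps)
      finally show ?thesis .
    qed
    define y where "y = ((real k + 1) * ln 8 + 4 * (Nc * l)) / ln 2"
    have y: "y \<ge> 0" using Nc l_pos k0 by (simp add: y_def)
    \<comment> \<open>The added 1 makes the bound on \<open>2 ^ L\<close> strict.\<close>
    define L where "L = nat \<lceil>y\<rceil> + 1"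
    have Ly: "y < real L" "real L \<le> y + 2" "L > 0" using y by (auto simp: L_def) linarith+
    have LL: "real L \<le> L0 * l"
    proof -
      have "y \<le> ((real k + 1) * ln 8 / l0 * l + 4 * (Nc * l)) / ln 2"
        unfolding y_def using scale[of "(real k + 1) * ln 8"] k0 by (intro divide_right_mono add_right_mono) auto
      then have "y + 2 \<le> ((real k + 1) * ln 8 / l0 * l + 4 * (Nc * l)) / ln 2 + 2 / l0 * l + l"
        using scale[of 2] l_pos by linarith
      also have "\<dots> = L0 * l" by (simp add: L0_def algebra_simps add_divide_distrib)
      finally show ?thesis using Ly by linarith
    qed
    have Lpow: "8 * 8 ^ k * N ^ 4 < 2 ^ L"
    proof -
      have "ln (8 * 8 ^ k * N ^ 4) = (real k + 1) * ln 8 + 4 * ln N"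
        using N by (simp add: ln_mult ln_realpow algebra_simps)
      also have "\<dots> \<le> y * ln 2" using lnN by (simp add: y_def)
      also have "\<dots> < real L * ln 2" using Ly by (intro mult_strict_right_mono) auto
      also have "\<dots> = ln (2 ^ L)" by (simp add: ln_realpow)
      finally show ?thesis using N by (subst (asm) ln_less_cancel_iff) auto
    qed
    define \<Lambda> where "\<Lambda> = \<Lambda>0 * (1 + \<beta>) * l"
    have \<Lambda>: "\<Lambda> \<ge> 0" using \<Lambda>0 \<beta> l_pos by (simp add: \<Lambda>_def)
    have b1: "1 + \<beta> \<ge> 1" using \<beta> by simp
    let ?W = "(B / real k + K\<^sup>2 * t) * l\<^sup>2 + U * l\<^sup>2"
    have n': "c * (1 + \<beta>) * ?W \<le> real n" using n by (simp add: l_def U_def)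
    have W: "B / real k * l\<^sup>2 \<le> ?W" "U * l\<^sup>2 \<le> ?W" "(K\<^sup>2 * t + U) * l\<^sup>2 \<le> ?W" "0 \<le> ?W"
    proof -
      have "0 \<le> B / real k * l\<^sup>2" "0 \<le> K\<^sup>2 * t * l\<^sup>2" "0 \<le> U * l\<^sup>2"
        using B U V by (auto intro!: mult_nonneg_nonneg)
      then show "B / real k * l\<^sup>2 \<le> ?W" "U * l\<^sup>2 \<le> ?W" "(K\<^sup>2 * t + U) * l\<^sup>2 \<le> ?W" "0 \<le> ?W"
        unfolding distrib_right by linarith+
    qed
    have big: "a * (1 + \<beta>) * w \<le> real n" if "0 \<le> a" "a \<le> c" "0 \<le> w" "w \<le> ?W" for a w
    proof -
      have "a * (1 + \<beta>) * w \<le> c * (1 + \<beta>) * ?W" using that b1 c by (intro mult_mono) auto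
      then show ?thesis using n' by linarith
    qed
    have l2: "l \<le> l\<^sup>2 / l0" using scale[of l] l_pos by (simp add: power2_eq_square)
    have nL: "real L \<le> real n"
    proof -
      have "L0 * l \<le> L0 * (l\<^sup>2 / l0)" using l2 L0 by (intro mult_left_mono) auto
      also have "\<dots> = real k * L0 / l0 * 1 * (1 / real k * l\<^sup>2)" using k0 by simp
      also have "\<dots> \<le> real k * L0 / l0 * (1 + \<beta>) * (B / real k * l\<^sup>2)"
        using b1 B k0 cparts L0 l0 by (intro mult_mono divide_right_mono) auto
      also have "\<dots> \<le> real n" using cparts c W B k0 by (intro big) auto
      finally show ?thesis using LL by linarith
    qed
    define m where "m = n div L"
    have Lm: "L * m \<le> n" by (simp add: m_def)
    have m1: "m > 0" using nL Ly by (simp add: m_def div_greater_zero_iff)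
    have m2: "x \<le> real m" if "2 * (L0 * l) * x \<le> real n" "x \<ge> 0" for x
    proof -
      \<comment> \<open>Rounding n / L down loses at most a factor 2, because m is at least
        1.\<close>
      have "n < L * m + L" unfolding m_def using Ly(3) by (metis add.commute dividend_less_times_div)
      also have "\<dots> \<le> 2 * (L * m)" using m1 by simp
      finally have "real n < 2 * (real L * real m)" by (metis of_nat_less_iff of_nat_mult of_nat_numeral)
      moreover have "2 * (real L * x) \<le> 2 * (L0 * l) * x" using mult_right_mono[OF LL that(2)] by (simp add: mult.assoc)
      ultimately have "real L * x < real L * real m" using that by linarith
      then show ?thesis using Ly by (simp add: mult_less_cancel_left)
    qed
    have r1: "20 * B * \<Lambda> \<le> real m"
    proof (rule m2)
      have "2 * (L0 * l) * (20 * B * \<Lambda>) = 40 * real k * L0 * \<Lambda>0 * (1 + \<beta>) * (B / real k * l\<^sup>2)"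
        using k0 by (simp add: \<Lambda>_def power2_eq_square)
      also have "\<dots> \<le> real n" using cparts c W B k0 by (intro big) auto
      finally show "2 * (L0 * l) * (20 * B * \<Lambda>) \<le> real n" .
    qed (use B \<Lambda> in auto)
    have r2: "2 * (real k)\<^sup>2 * K * t powr (3 / 2) * \<Lambda> \<le> real m"
    proof (rule m2)
      have "2 * (L0 * l) * (2 * (real k)\<^sup>2 * K * t powr (3 / 2) * \<Lambda>) = 4 * (real k)\<^sup>2 * L0 * \<Lambda>0 * (1 + \<beta>) * (U * l\<^sup>2)"
        by (simp add: \<Lambda>_def U_def power2_eq_square)
      also have "\<dots> \<le> real n" using cparts c W U by (intro big) auto
      finally show "2 * (L0 * l) * (2 * (real k)\<^sup>2 * K * t powr (3 / 2) * \<Lambda>) \<le> real n" .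
    qed (use K \<Lambda> in auto)
    have r3: "900 * 4 ^ k * (K\<^sup>2 + K * sqrt t) * (6 * (real k * t) + \<Lambda>) \<le> real m * \<epsilon>\<^sup>2"
    proof -
      have tU: "(K\<^sup>2 + K * sqrt t) * t = K\<^sup>2 * t + U"
      proof -
        have "t powr (3 / 2) = t powr (1 + 1 / 2)" by simp
        also have "\<dots> = t * sqrt t" using t1 unfolding powr_add by (simp add: powr_half_sqrt)
        finally show ?thesis by (simp add: U_def algebra_simps)
      qed
      \<comment> \<open>The lattice entropy, of order t, dominates the failure exponent, so only the
        logarithm from L arises here; the second one is inserted by \<open>l2\<close>.\<close>
      have "\<Lambda> \<le> \<Lambda>0 * (1 + \<beta>) * t" unfolding \<Lambda>_def using lt \<Lambda>0 \<beta> by (intro mult_left_mono) auto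
      moreover have "6 * (real k * t) * 1 \<le> 6 * (real k * t) * (1 + \<beta>)" using b1 k0 t1 by (intro mult_left_mono) auto
      ultimately have "6 * (real k * t) + \<Lambda> \<le> (6 * real k + \<Lambda>0) * (1 + \<beta>) * t" by (simp add: algebra_simps)
      then have "900 * 4 ^ k * (K\<^sup>2 + K * sqrt t) * (6 * (real k * t) + \<Lambda>)
        \<le> 900 * 4 ^ k * (K\<^sup>2 + K * sqrt t) * ((6 * real k + \<Lambda>0) * (1 + \<beta>) * t)"
        using K t1 by (intro mult_left_mono) auto
      also have "\<dots> = C2 * (1 + \<beta>) * ((K\<^sup>2 + K * sqrt t) * t) * \<epsilon>\<^sup>2" using \<epsilon> by (simp add: C2_def)
      also have "\<dots> = C2 * (1 + \<beta>) * (K\<^sup>2 * t + U) * \<epsilon>\<^sup>2" unfolding tU ..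
      also have "\<dots> \<le> real m * \<epsilon>\<^sup>2"
      proof (intro mult_right_mono m2)
        have "2 * (L0 * l) * (C2 * (1 + \<beta>) * (K\<^sup>2 * t + U)) \<le> 2 * (L0 * (l\<^sup>2 / l0)) * (C2 * (1 + \<beta>) * (K\<^sup>2 * t + U))"
          using l2 L0 C2 b1 U V by (intro mult_right_mono mult_left_mono) auto
        also have "\<dots> = 2 * L0 * C2 / l0 * (1 + \<beta>) * ((K\<^sup>2 * t + U) * l\<^sup>2)" by simp
        also have "\<dots> \<le> real n" using cparts c W U V by (intro big) auto
        finally show "2 * (L0 * l) * (C2 * (1 + \<beta>) * (K\<^sup>2 * t + U)) \<le> real n" .
      qed (use C2 b1 U V in auto)
      finally show ?thesis .
    qed
    have r4: "6 * (real k)\<^sup>2 * N\<^sup>2 * real L * exp (- \<Lambda>) \<le> t powr (- \<beta>)"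
    proof -
      have "0 < 6 * (real k)\<^sup>2" using k6 by linarith
      then have "6 * (real k)\<^sup>2 = exp (ln (6 * (real k)\<^sup>2))" by (rule exp_ln[symmetric])
      also have "\<dots> \<le> exp (ln (6 * (real k)\<^sup>2) / l0 * l)" using scale[of "ln (6 * (real k)\<^sup>2)"] k6 by simp
      finally have 1: "6 * (real k)\<^sup>2 \<le> exp (ln (6 * (real k)\<^sup>2) / l0 * l)" .
      have "N\<^sup>2 = exp (2 * ln N)" using N by (simp add: exp_double)
      also have "\<dots> \<le> exp (2 * Nc * l)" using lnN by simp
      finally have 2: "N\<^sup>2 \<le> exp (2 * Nc * l)" .
      have 3: "real L \<le> exp (L0 * l)" using LL exp_ge_add_one_self[of "L0 * l"] by linarith
      have "6 * (real k)\<^sup>2 * N\<^sup>2 * real L * exp (- \<Lambda>)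
        \<le> exp (ln (6 * (real k)\<^sup>2) / l0 * l) * exp (2 * Nc * l) * exp (L0 * l) * exp (- \<Lambda>)"
        using 1 2 3 by (intro mult_mono) auto
      also have "\<dots> = exp (\<Lambda>0 * l - \<Lambda>)" by (simp add: exp_add[symmetric] \<Lambda>0_def algebra_simps)
      also have "\<dots> \<le> exp (- \<beta> * l)"
      proof -
        have "1 * (\<beta> * l) \<le> \<Lambda>0 * (\<beta> * l)" using \<Lambda>0 \<beta> l_pos by (intro mult_right_mono) auto
        then show ?thesis by (simp add: \<Lambda>_def algebra_simps)
      qed
      also have "\<dots> = t powr (- \<beta>)" using t1 by (simp add: powr_def l_def)
      finally show ?thesis .
    qed
    show "\<exists>L m \<Lambda>. batch_plan k t N B K \<beta> n L m \<Lambda>"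
      using \<Lambda> m1 Lm Lpow r1 r2 r3 r4 unfolding \<epsilon>_def batch_plan_def by blast
  qed
qed

section \<open>Matching the parameters of the theorem\<close>

lemma sqrt_prod: "sqrt (\<Prod>j\<in>A. f j) = (\<Prod>j\<in>A. sqrt (f j))"
  by (induction A rule: infinite_finite_induct) (simp_all add: real_sqrt_mult)

lemma sqrt_power_eq_powr: "x > 0 \<Longrightarrow> sqrt (x ^ n) = x powr (real n / 2)"
  by (simp add: powr_half_sqrt[symmetric] powr_realpow[symmetric] powr_powr)

theorem theorem3:
  fixes k :: nat
  assumes "k \<ge> 2"
  shows "\<exists>c::real. c > 0 \<and>
    (\<forall>(d :: nat \<Rightarrow> nat) (T :: tensor) (lam :: real) (\<delta> :: nat \<Rightarrow> real) (W0 :: tensor) (n :: nat) (\<beta> :: real).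
      (\<forall>j\<in>{1..k}. d j \<ge> 1) \<longrightarrow>
      T \<in> tensors k d \<longrightarrow> T \<noteq> 0 \<longrightarrow>
      lam > 0 \<longrightarrow>
      lam \<ge> 1 / r_star k d T * (MAX j\<in>{1..k}. coherence k d T j * real (tucker_rank k d T j)) \<longrightarrow>
      (\<forall>j\<in>{1..k}. \<delta> j = sqrt (lam * r_star k d T / real (d j))) \<longrightarrow>
      (\<forall>j\<in>{1..k}. 0 < \<delta> j \<and> \<delta> j \<le> 1) \<longrightarrow>
      dual_tensor k d \<delta> T W0 \<longrightarrow>
      n \<le> card (grid k d) \<longrightarrow>
      \<beta> > 0 \<longrightarrow>
      real n \<ge> c * (1 + \<beta>) *
        ((mu_star k d T + (alpha_star k d T W0)\<^sup>2 * lam ^ (k - 2)) *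
            r_star k d T ^ (k - 1) * avg_dim k d * (ln (avg_dim k d))\<^sup>2
         + alpha_star k d T W0 * lam powr (real k / 2 - 1) *
            r_star k d T powr ((real k - 1) / 2) * avg_dim k d powr (3 / 2) *
            (ln (avg_dim k d))\<^sup>2) \<longrightarrow>
      measure_pmf.prob (sample_pmf k d n) {\<Omega>. completions k d \<delta> T \<Omega> = {T}}
        \<ge> 1 - avg_dim k d powr (- \<beta>))"
proof -
  obtain c where c: "c > 0" and choice: "\<And>(t::real) (N::real) (B::real) (K::real) (\<beta>::real) (n::nat).
    1 + 1 / real k \<le> t \<Longrightarrow> 1 \<le> N \<Longrightarrow> N \<le> (real k * t) ^ k \<Longrightarrow> 1 \<le> B \<Longrightarrow> 0 \<le> K \<Longrightarrow> 0 < \<beta> \<Longrightarrow>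
    real n \<ge> c * (1 + \<beta>) * ((B / real k + K\<^sup>2 * t) * (ln t)\<^sup>2 + K * t powr (3 / 2) * (ln t)\<^sup>2) \<Longrightarrow>
    (\<exists>L m \<Lambda>. batch_plan k t N B K \<beta> n L m \<Lambda>)" using sample_size_choice[OF assms] by blast
  show ?thesis
  proof (intro exI[of _ c] conjI c allI impI)
    fix d :: "nat \<Rightarrow> nat" and T :: tensor and lam :: real and \<delta> :: "nat \<Rightarrow> real" and W0 :: tensor and n :: nat and \<beta> :: real
    define r where "r = r_star k d T"
    define t where "t = avg_dim k d"
    define \<sigma> where "\<sigma> = lam * r"
    assume dpos: "\<forall>j\<in>{1..k}. d j \<ge> 1" and T: "T \<in> tensors k d" "T \<noteq> 0" and lam: "lam > 0"
      and lam_ge: "lam \<ge> 1 / r_star k d T * (MAX j\<in>{1..k}. coherence k d T j * real (tucker_rank k d T j))"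
      and \<delta>: "\<forall>j\<in>{1..k}. \<delta> j = sqrt (lam * r_star k d T / real (d j))" and \<delta>01: "\<forall>j\<in>{1..k}. 0 < \<delta> j \<and> \<delta> j \<le> 1"
      and dual: "dual_tensor k d \<delta> T W0" and n: "n \<le> card (grid k d)" and \<beta>: "\<beta> > 0"
      and nbig: "real n \<ge> c * (1 + \<beta>) *
        ((mu_star k d T + (alpha_star k d T W0)\<^sup>2 * lam ^ (k - 2)) *
            r_star k d T ^ (k - 1) * avg_dim k d * (ln (avg_dim k d))\<^sup>2
         + alpha_star k d T W0 * lam powr (real k / 2 - 1) *
            r_star k d T powr ((real k - 1) / 2) * avg_dim k d powr (3 / 2) *
            (ln (avg_dim k d))\<^sup>2)"
    define S where "S = (\<Sum>j=1..k. d j)"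
    have k0: "real k > 0" using assms by simp
    have tS: "real k * t = real S" using k0 by (simp add: t_def avg_dim_def S_def)
    have "(\<Sum>j=1..k. 1) \<le> S" unfolding S_def using dpos by (intro sum_mono) auto
    \<comment> \<open>If all dimensions are 1, the average is 1 and its logarithm 0: the sample size
      condition is void, but the claimed probability bound is 0. Otherwise integrality gives t at
      least 1 + 1/k.\<close>
    then consider "S = k" | "S \<ge> k + 1" by fastforce
    then show "measure_pmf.prob (sample_pmf k d n) {\<Omega>. completions k d \<delta> T \<Omega> = {T}} \<ge> 1 - avg_dim k d powr (- \<beta>)"
    proof cases
      case 1
      then have "t = 1" using tS k0 by simp
      then show ?thesis by (simp add: t_def[symmetric])
    next
      case 2
      have "real k + 1 \<le> real k * t" unfolding tS using 2 by linarith
      then have t: "1 + 1 / real k \<le> t" using k0 by (simp add: field_simps)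
      then have t1: "t > 1" using k0 by (smt (verit) divide_pos_pos)
      have "1 \<in> {1..k}" using assms by simp
      \<comment> \<open>Positivity of \<open>r_star\<close> is read off from the positivity of the
        first weight.\<close>
      then have "0 < lam * r / real (d 1)" using \<delta> \<delta>01 unfolding r_def by (metis real_sqrt_gt_0_iff)
      then have r: "r > 0" using lam dpos by (auto simp: zero_less_divide_iff zero_less_mult_iff)
      interpret completion_setup k d \<delta> T \<sigma>
      proof
        show "2 \<le> k" "T \<in> tensors k d" "T \<noteq> 0" by fact+
        fix j assume j: "j \<in> {1..k}"
        show "1 \<le> d j" using dpos j by blast
        show "\<delta> j = sqrt (\<sigma> / real (d j))" using \<delta> j by (simp add: \<sigma>_def r_def)
        have "coherence k d T j * real (tucker_rank k d T j) \<le> (MAX j\<in>{1..k}. coherence k d T j * real (tucker_rank k d T j))"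
          using j by (intro Max_ge) auto
        also have "\<dots> \<le> \<sigma>" using lam_ge r unfolding \<sigma>_def r_def[symmetric] by (simp add: field_simps)
        finally show "coherence k d T j * real (tucker_rank k d T j) \<le> \<sigma>" .
      qed
      have W0: "W0 \<in> tensors k d" "QS {} W0 = W0" "circ W0 = 1" "tinner k d W0 T = star_norm k d \<delta> T"
        using dual by (auto simp: dual_tensor_def Q0_eq)
      have N1: "1 \<le> N" by (rule N_ge_1)
      have N_le: "N \<le> (real k * t) ^ k"
      proof -
        have "(\<Prod>j=1..k. real (d j)) \<le> (\<Prod>j=1..k. real S)"
          unfolding S_def by (intro prod_mono) (use le_sum_of_member in \<open>auto simp del: of_nat_sum\<close>)
        then show ?thesis unfolding N_eq tS by simp
      qed
      have geo: "geo_dim k d ^ k = N"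
      proof -
        have "0 < (\<Prod>j=1..k. real (d j))" using N1 unfolding N_eq by linarith
        moreover have "(x powr (1 / real k)) ^ k = x" if "x > 0" for x :: real
          using that k0 by (simp add: powr_realpow[symmetric] powr_powr)
        ultimately show ?thesis unfolding N_eq geo_dim_def by blast
      qed
      define M0 where "M0 = max_norm k d W0"
      have M0_ge: "\<bar>W0 a\<bar> \<le> M0" if "a \<in> G" for a
        unfolding M0_def max_norm_def using that by (intro Max_ge) auto
      have M0_le: "M0 \<le> N"
        unfolding M0_def max_norm_def using grid_nonempty entry_le_circ[of _ W0] W0(3) by (subst Max_le_iff) auto
      have M0: "M0 > 0"
      proof (rule ccontr)
        assume "\<not> M0 > 0"
        then have "W0 a = 0" for a using M0_ge[of a] W0(1) by (cases "a \<in> G") (auto simp: tensors_def)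
        then have "W0 = 0" by (simp add: fun_eq_iff)
        then show False using W0(3) circ_zero by simp
      qed
      define mx where "mx = (MAX a\<in>G. (hs_norm k d (QT k d T (e a)))\<^sup>2)"
      have hs: "(hs_norm k d (QT k d T (e a)))\<^sup>2 = tinner k d (Q (e a)) (Q (e a))" for a
        by (simp add: hs_norm_def QT_eq tinner_def sum_nonneg)
      have mx: "tinner k d (Q (e a)) (Q (e a)) \<le> mx" if "a \<in> G" for a
        unfolding mx_def hs[symmetric] using that by (intro Max_ge) auto
      define B where "B = N * mx"
      \<comment> \<open>Q fixes the nonzero tensor T, so each squared entry of T is at most
        \<open>mx\<close> times its squared norm; summing over N entries gives N \<open>mx\<close>
        at least 1.\<close>
      have B1: "1 \<le> B"
      proof -
        have QT: "Q T = T" by (rule Q_eq_self_if_QS_empty[OF T(1) QS_empty_T])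
        define s where "s = tinner k d T T"
        have "s \<noteq> 0"
        proof
          assume "s = 0"
          then have "T a = 0" for a
            using T(1) by (cases "a \<in> G") (auto simp: s_def tinner_def tensors_def sum_nonneg_eq_0_iff)
          then show False using T(2) by (auto simp: fun_eq_iff)
        qed
        then have s: "s > 0" using sum_nonneg[of G "\<lambda>a. T a * T a"] by (simp add: s_def tinner_def)
        have "s \<le> (\<Sum>a\<in>G. mx * s)" unfolding s_def tinner_def[of k d T T]
        proof (rule sum_mono)
          fix a assume a: "a \<in> G"
          have "T a = tinner k d (Q (e a)) T" using Q_apply[OF a, of T] by (simp add: QT)
          then have "T a * T a \<le> tinner k d (Q (e a)) (Q (e a)) * s"
            using Cauchy_Schwarz_ineq_sum[of "Q (e a)" T G] by (simp add: s_def tinner_def power2_eq_square)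
          also have "\<dots> \<le> mx * s" using mx[OF a] s by (intro mult_right_mono) auto
          finally show "T a * T a \<le> mx * (\<Sum>a\<in>G. T a * T a)" by (simp add: s_def tinner_def)
        qed
        also have "\<dots> = B * s" by (simp add: B_def)
        finally show ?thesis using s by simp
      qed
      \<comment> \<open>With this choice \<open>Hpair\<close> is an equality, and
        \<open>N \<le> H\<^sup>2\<close> holds because \<sigma> is at least 1. Multiplied by the
        largest entry of the dual tensor it becomes the factor built from \<open>alpha_star\<close>
        in the second term of the sample size.\<close>
      define H where "H = sqrt (N * \<sigma> ^ (k - 2))"
      define K where "K = H * M0"
      have \<sigma>p: "1 \<le> \<sigma> ^ (k - 2)" using \<sigma>_ge_1 by (rule one_le_power)
      have H0: "H > 0" using N1 \<sigma>p unfolding H_def by (intro real_sqrt_gt_zero mult_pos_pos) linarith+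
      have H2: "H\<^sup>2 = N * \<sigma> ^ (k - 2)" using N1 \<sigma>p by (simp add: H_def)
      have HN: "N \<le> H\<^sup>2" unfolding H2 using mult_left_mono[OF \<sigma>p, of N] by simp
      have K0: "K > 0" using H0 M0 by (simp add: K_def)
      have Hpair: "N * (\<Prod>j\<in>others j1 j2. \<delta> j) \<le> H * sqrt (pairdim j1 j2)" if j: "1 \<le> j1" "j1 < j2" "j2 \<le> k" for j1 j2
      proof -
        have pd: "pairdim j1 j2 > 0" using pairdim_ge_1[OF j] by linarith
        have cardo: "card (others j1 j2) = k - 2"
          unfolding others_def using j by (subst card_Diff_subset) auto
        have "(\<Prod>j\<in>others j1 j2. \<delta> j) = (\<Prod>j\<in>others j1 j2. sqrt (\<sigma> / real (d j)))"
          by (intro prod.cong) (auto simp: others_def \<delta> \<sigma>_def r_def)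
        also have "\<dots> = sqrt (\<Prod>j\<in>others j1 j2. \<sigma> / real (d j))" by (rule sqrt_prod[symmetric])
        also have "(\<Prod>j\<in>others j1 j2. \<sigma> / real (d j)) = \<sigma> ^ (k - 2) * pairdim j1 j2 / N"
          unfolding prod_dividef pairdim_others[OF j] by (simp add: cardo)
        finally have "N * (\<Prod>j\<in>others j1 j2. \<delta> j) = sqrt (N * N) * sqrt (\<sigma> ^ (k - 2) * pairdim j1 j2 / N)"
          by simp
        also have "\<dots> = sqrt (N * N * (\<sigma> ^ (k - 2) * pairdim j1 j2 / N))" by (rule real_sqrt_mult[symmetric])
        also have "N * N * (\<sigma> ^ (k - 2) * pairdim j1 j2 / N) = N * \<sigma> ^ (k - 2) * pairdim j1 j2"
          using N1 by simp
        also have "sqrt \<dots> = H * sqrt (pairdim j1 j2)" by (simp add: H_def real_sqrt_mult)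
        finally show ?thesis by simp
      qed
      have rk: "r ^ (k - 1) = r * r ^ (k - 2)" 
      proof -
        have "k - 1 = Suc (k - 2)" using assms by arith
        then show ?thesis by simp
      qed
      have mu_eq: "mu_star k d T * r ^ (k - 1) * t = B / real k"
        using r t1 by (simp add: mu_star_def geo r_def[symmetric] t_def[symmetric] mx_def[symmetric] B_def)
      have al: "alpha_star k d T W0 = sqrt (N / r) * M0"
        by (simp add: alpha_star_def geo r_def[symmetric] M0_def[symmetric])
      have al2: "(alpha_star k d T W0)\<^sup>2 * lam ^ (k - 2) * r ^ (k - 1) = K\<^sup>2"
        using r N1 unfolding al K_def power_mult_distrib H2 \<sigma>_def rk by simp
      have al1: "alpha_star k d T W0 * lam powr (real k / 2 - 1) * r powr ((real k - 1) / 2) = K"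
      proof -
        have "lam powr (real k / 2 - 1) = sqrt (lam ^ (k - 2))"
          unfolding sqrt_power_eq_powr[OF lam] using assms by (simp add: of_nat_diff diff_divide_distrib)
        moreover have "r powr ((real k - 1) / 2) = sqrt (r ^ (k - 1))"
          unfolding sqrt_power_eq_powr[OF r] using assms by (simp add: of_nat_diff One_nat_def)
        ultimately have "alpha_star k d T W0 * lam powr (real k / 2 - 1) * r powr ((real k - 1) / 2)
          = M0 * sqrt (N / r * lam ^ (k - 2) * r ^ (k - 1))"
          unfolding al real_sqrt_mult by (simp only: mult_ac)
        also have "N / r * lam ^ (k - 2) * r ^ (k - 1) = N * \<sigma> ^ (k - 2)"
          using r unfolding rk \<sigma>_def power_mult_distrib by simp
        finally show ?thesis by (simp add: K_def H_def)
      qed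
      have sum_eq: "(mu_star k d T + (alpha_star k d T W0)\<^sup>2 * lam ^ (k - 2)) * r ^ (k - 1) * t = B / real k + K\<^sup>2 * t"
        by (simp only: distrib_right mu_eq al2)
      have "c * (1 + \<beta>) * ((B / real k + K\<^sup>2 * t) * (ln t)\<^sup>2 + K * t powr (3 / 2) * (ln t)\<^sup>2) \<le> real n"
        using nbig unfolding r_def[symmetric] t_def[symmetric] sum_eq al1 .
      from choice[OF t N1 N_le B1 less_imp_le[OF K0] \<beta> this]
      obtain L m \<Lambda> where \<Lambda>: "\<Lambda> \<ge> 0" and m: "m > 0" and Lm: "L * m \<le> n" and L: "8 * 8 ^ k * N ^ 4 < 2 ^ L"
        and m1: "20 * B * \<Lambda> \<le> real m" and m2: "2 * (real k)\<^sup>2 * K * t powr (3 / 2) * \<Lambda> \<le> real m"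
        and m3: "900 * 4 ^ k * (K\<^sup>2 + K * sqrt t) * (6 * (real k * t) + \<Lambda>) \<le> real m * (1 / (8 * (real k + 1) * 8 ^ k))\<^sup>2"
        and fin: "6 * (real k)\<^sup>2 * N\<^sup>2 * real L * exp (- \<Lambda>) \<le> t powr (- \<beta>)" unfolding batch_plan_def by blast
      \<comment> \<open>Solves \<open>2 * (2 + 2 * real k) * \<epsilon>0 = (1 / 8) ^ k / 2\<close>,
        the total error allowed to the certificate; \<open>\<epsilon>\<close> divides by
        \<open>M0\<close> because golfing errors are relative to the entry bound.\<close>
      define \<epsilon>0 where "\<epsilon>0 = 1 / (8 * (real k + 1) * 8 ^ k)"
      have \<epsilon>0: "\<epsilon>0 > 0" using k0 by (simp add: \<epsilon>0_def)
      define \<epsilon> where "\<epsilon> = \<epsilon>0 / M0"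
      \<comment> \<open>The summand K keeps the uncentred heavy contribution below \<epsilon> / 3.
        The summand sqrt t balances the light part, which costs K g t samples, against the pair
        multiplicities, which cost K t^2 / g up to a logarithm: both become K t^(3/2).\<close>
      define g where "g = 144 * 2 ^ k * (K + sqrt t) / \<epsilon>0"
      have Kt: "K + sqrt t > 0" using K0 t1 by (intro add_pos_pos) auto
      have g0: "g > 0" using Kt \<epsilon>0 by (simp add: g_def)
      have HK: "H = K / M0" using M0 by (simp add: K_def)
      have "1 - 6 * (real k)\<^sup>2 * N\<^sup>2 * real L * exp (- \<Lambda>) \<le> measure_pmf.prob (sample_pmf k d n) {\<Omega>. completions k d \<delta> T \<Omega> = {T}}"
      proof (rule recovery_probability[OF T(1) QS_empty_T W0 M0 M0_le M0_ge _ _ Hpair HN H0 g0 _ m \<Lambda> _ L Lm n])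
        show "N * tinner k d (Q (e a)) (Q (e a)) \<le> B" if "a \<in> G" for a
          unfolding B_def using mx[OF that] by (intro mult_left_mono) auto
        show "0 < B" using B1 by linarith
        show "0 < \<epsilon>" using \<epsilon>0 M0 by (simp add: \<epsilon>_def)
        show "\<Lambda> \<le> real m / (20 * B)" using m1 B1 by (simp add: pos_le_divide_eq mult.commute mult.left_commute)
        show "2 * (2 + 2 * real k) * \<epsilon> * M0 \<le> (1 / 8) ^ k / 2"
        proof -
          have "\<epsilon> * M0 = \<epsilon>0" using M0 by (simp add: \<epsilon>_def)
          moreover have "2 * (2 + 2 * real k) * \<epsilon>0 = (1 / 8) ^ k / 2"
            using k0 by (simp add: \<epsilon>0_def power_divide divide_simps)
          ultimately show ?thesis by (simp add: mult.assoc)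
        qed
      next
        fix j1 j2 assume j: "1 \<le> j1" "j1 < j2" "j2 \<le> k"
        have "pairdim j1 j2 \<le> (real k * t)\<^sup>2"
        proof -
          have "d j1 \<le> S" "d j2 \<le> S" unfolding S_def using j by (auto intro!: le_sum_of_member)
          then have "real (d j1) * real (d j2) \<le> real S * real S" by (intro mult_mono) auto
          then show ?thesis unfolding tS by (simp add: pairdim_def power2_eq_square)
        qed
        then have "2 * K * \<Lambda> * pairdim j1 j2 \<le> 2 * K * \<Lambda> * (real k * t)\<^sup>2"
          using K0 \<Lambda> by (intro mult_left_mono) auto
        also have "\<dots> = 2 * (real k)\<^sup>2 * K * t powr (3 / 2) * \<Lambda> * sqrt t"
        proof -
          have "t powr (3 / 2) * sqrt t = t powr (3 / 2 + 1 / 2)" unfolding powr_add using t1 by (simp add: powr_half_sqrt)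
          also have "\<dots> = t\<^sup>2" using t1 by (simp add: powr_numeral)
          finally show ?thesis by (simp add: power_mult_distrib mult_ac)
        qed
        also have "\<dots> \<le> real m * sqrt t" using m2 t1 by (intro mult_right_mono) auto
        also have "\<dots> \<le> real m * (K + sqrt t)" using K0 by (intro mult_left_mono) auto
        finally have pm: "2 * K * \<Lambda> * pairdim j1 j2 / (real m * (K + sqrt t)) \<le> 1"
          using m Kt by (simp add: pos_divide_le_eq)
        have Kle: "K / (K + sqrt t) \<le> 1" using Kt t1 by (simp add: pos_divide_le_eq)
        have "16 * 2 ^ k * H * (3 / g + pairdim j1 j2 * (6 * \<Lambda>) / (real m * g))
          = \<epsilon> / 3 * (K / (K + sqrt t)) + \<epsilon> / 3 * (2 * K * \<Lambda> * pairdim j1 j2 / (real m * (K + sqrt t)))"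
        proof -
          have "16 * 2 ^ k * (K / M0) * (3 / (144 * 2 ^ k * X / \<epsilon>0) + p * (6 * \<Lambda>) / (real m * (144 * 2 ^ k * X / \<epsilon>0)))
            = \<epsilon>0 / M0 / 3 * (K / X) + \<epsilon>0 / M0 / 3 * (2 * K * \<Lambda> * p / (real m * X))" if "X > 0" for X p
            using that M0 \<epsilon>0 m by (simp add: field_simps)
          from this[OF Kt] show ?thesis unfolding HK g_def \<epsilon>_def .
        qed
        also have "\<dots> \<le> \<epsilon> / 3 * 1 + \<epsilon> / 3 * 1"
          using Kle pm \<epsilon>0 M0 by (intro add_mono mult_left_mono) (auto simp: \<epsilon>_def)
        finally show "16 * 2 ^ k * H * (3 / g + pairdim j1 j2 * (6 * \<Lambda>) / (real m * g)) \<le> 2 * \<epsilon> / 3" by simp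
      next
        \<comment> \<open>The constant 900 is 36 from the second moment plus 864 = 6 * 144 from the
          truncation level.\<close>
        have den: "36 * 4 ^ k * H\<^sup>2 + 6 * 2 ^ k * H * g * \<epsilon> = 4 ^ k * (900 * K\<^sup>2 + 864 * (K * sqrt t)) / M0\<^sup>2"
        proof -
          have "6 * 2 ^ k * H * g * \<epsilon> = 864 * (2 ^ k * 2 ^ k) * (K * (K + sqrt t)) / M0\<^sup>2"
            using \<epsilon>0 M0 by (simp add: HK g_def \<epsilon>_def power2_eq_square)
          also have "(2 ^ k * 2 ^ k :: real) = 4 ^ k" by (simp add: power_mult_distrib[symmetric])
          finally have 1: "6 * 2 ^ k * H * g * \<epsilon> = 864 * 4 ^ k * (K * (K + sqrt t)) / M0\<^sup>2" .
          have 2: "36 * 4 ^ k * H\<^sup>2 = 36 * 4 ^ k * K\<^sup>2 / M0\<^sup>2" by (simp add: HK power_divide)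
          show ?thesis unfolding 1 2 add_divide_distrib[symmetric]
            by (simp add: power2_eq_square algebra_simps)
        qed
        define Z where "Z = 4 ^ k * (900 * K\<^sup>2 + 864 * (K * sqrt t))"
        have Z0: "Z > 0" unfolding Z_def using K0 t1 by (intro mult_pos_pos add_pos_nonneg) auto
        have "Z * (6 * (real k * t) + \<Lambda>) \<le> 900 * 4 ^ k * (K\<^sup>2 + K * sqrt t) * (6 * (real k * t) + \<Lambda>)"
          using K0 t1 k0 \<Lambda> by (intro mult_right_mono) (auto simp: Z_def algebra_simps)
        also have "\<dots> \<le> real m * \<epsilon>0\<^sup>2" using m3 by (simp only: \<epsilon>0_def)
        finally have "6 * (real k * t) + \<Lambda> \<le> real m * \<epsilon>0\<^sup>2 / Z" using Z0 by (simp add: pos_le_divide_eq mult.commute)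
        also have "\<dots> = real m * \<epsilon>\<^sup>2 / (Z / M0\<^sup>2)" using M0 by (simp add: \<epsilon>_def power_divide)
        finally show "6 * real (\<Sum>j=1..k. d j) + \<Lambda> \<le> real m * \<epsilon>\<^sup>2 / (36 * 4 ^ k * H\<^sup>2 + 6 * 2 ^ k * H * g * \<epsilon>)"
          unfolding den Z_def tS S_def .
      qed
      then show ?thesis using fin unfolding t_def by linarith
    qed
  qed
qed

end
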